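(* Let $n\ge1$ and let $\phi_0(t)=(t^{v_0},y_1(t),\ldots,y_n(t))\in\mathcal{P}_{(v_0,w_1,\ldots,w_n)}$ be a non-degenerate parametrized curve with semigroup $\Gamma_0=\langle v_0,\ldots,v_g\rangle$ (minimal generating set) and Apéry set $\{0,a_1,\ldots,a_{v_0-1}\}$. Let $v_{g+1}\in\mathbb{N}\setminus\Gamma_0$ satisfy $v_{g+1}\equiv a_{v_0-1} \bmod v_0$ and $\max\{v_g,a_{v_0-2}\}<v_{g+1}<a_{v_0-1}$, and let $$\phi_1(t)=\left(t^{v_0},y_1(t),\ldots,y_n(t),t^{v_{g+1}}+\sum_{j>v_{g+1}}c_jt^j\right)\in\mathcal{P}_{(v_0,w_1,\ldots,w_n,v_{g+1})}.$$ Then, for every $i\in\{1,\ldots,n\}$, a term of order $l<v_{g+1}$ can be eliminated from the component $y_i(t)$ in $\phi_0(t)$ through the action of an admissible element of $\tilde{\mathcal{A}}_1$ if and only if it can be eliminated (through the action of an admissible element of $\tilde{\mathcal{A}}_1$) from the component $y_i(t)$ in $\phi_1(t)$. Moreover, $\phi_1(t)$ is $\mathcal{A}$-equivalent to $$\left(t^{v_0},j^{k_1}y_1(t),j^{k_2}y_2(t),\ldots,j^{k_n}y_n(t),t^{v_{g+1}}\right)\in\mathcal{P}_{(v_0,w_1,\ldots,w_n,v_{g+1})},$$ where $k_i=\max\{w_i,v_{g+1}-v_0\}$ for $1\le i\le n$.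
   Context: For $N\ge 1$, a parametrization in $\mathbb{C}^{N+1}$ is an analytic map-germ $\phi=(p_0,\ldots,p_N):(\mathbb{C},0)\to(\mathbb{C}^{N+1},0)$, always assumed primitive (not of the form $\psi(\tau(t))$ with $\mathrm{ord}_t\,\tau\ge2$) and non-degenerate (not $\mathcal{A}$-equivalent to a map-germ with an identically zero component). $\mathcal{A}$-equivalence: $\phi_2=\sigma\circ\phi_1\circ\rho^{-1}$ for some $(\rho,\sigma)\in\mathcal{A}=\mathrm{Diff}(\mathbb{C},0)\times\mathrm{Diff}(\mathbb{C}^{N+1},0)$. $j^kf$ is the Taylor polynomial of degree $k$ of $f$ at $0$. Value semigroup: $\Gamma(\phi)=\{\mathrm{ord}_t(g(\phi(t))) : g\in\mathbb{C}\{X,Y_1,\ldots,Y_N\},\ g(\phi(t))\neq 0\}$, a numerical semigroup. For $1\le i\le N$, $\Gamma_i(\phi)=\{\mathrm{ord}_t(h(p_0,\ldots,p_{i-1})) : h\in\mathbb{C}\{X,Y_1,\ldots,Y_{i-1}\},\ h(p_0,\ldots,p_{i-1})\ne 0\}$. The Apéry set of a numerical semigroup $S$ with multiplicity $v_0=\min(S\setminus\{0\})$ is $\{a_0<a_1<\cdots<a_{v_0-1}\}$ with $a_0=0$ and $a_i=\min\bigl(S\setminus\bigcup_{j=0}^{i-1}(a_j+v_0\mathbb{N})\bigr)$. The minimal generating set is listed as $v_0<v_1<\cdots<v_g$. $\mathcal{P}_{(v_0,w_1,\ldots,w_N)}$ is the set of parametrizations $\phi(t)=(t^{v_0},y_1(t),\ldots,y_N(t))$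 such that $y_i(t)=t^{w_i}+(\text{terms of order}>w_i)$ and $w_i=\min(\Gamma(\phi)\setminus\Gamma_i(\phi))$ for $1\le i\le N$, with $v_0=w_0<w_1<\cdots<w_N$, $v_0=\min(\Gamma(\phi)\setminus\{0\})$. $\tilde{\mathcal{A}}_1\subset\mathcal{A}$ is the subgroup of $(\rho,\sigma)$ with $j^1\rho(t)=t$ and Jacobian matrix of $\sigma$ at the origin unipotent upper triangular. For $\phi\in\mathcal{P}_{(v_0,w_1,\ldots,w_N)}$, an admissible element of $\tilde{\mathcal{A}}_1$ is a pair of the form $\rho(t)=t\left(1+\frac{h_0(\phi(t))}{t^{v_0}}\right)^{1/v_0}$ (branch with $\rho'(0)=1$), $\sigma=(X+h_0,Y_1+h_1,\ldots,Y_N+h_N)$, where $h_k\in\langle Y_{k+1},\ldots,Y_N\rangle+\mathcal{M}_{N+1}^2$ and $\mathrm{ord}_t(h_k(\phi(t)))>w_k$ for $0\le k\le N$, with $\mathcal{M}_{N+1}=\langle X,Y_1,\ldots,Y_N\rangle\subset\mathbb{C}\{X,Y_1,\ldots,Y_N\}$. For such a pair $\sigma\circ\phi\circ\rho^{-1}$ again lies in $\mathcal{P}_{(v_0,w_1,\ldots,w_N)}$. The term of order $l>w_i$ in $y_i(t)$ can be eliminated through the action of an admissible element of $\tilde{\mathcal{A}}_1$ if there is such an element with $\sigma\circ\phi\circ\rho^{-1}=(t^{v_0},\overline{y}_1,\ldots,\overline{y}_N)$ and $j^l(\overline{y}_i(t))=j^{l-1}(y_i(t))$. For $\phi_0$ one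 takes $N=n$, for $\phi_1$ one takes $N=n+1$ and $w_{n+1}=v_{g+1}$. *)

theory Defs
  imports "HOL-Complex_Analysis.Complex_Analysis" "HOL-Number_Theory.Cong"
begin

text \<open>
  The numbers of variables \<open>n + 1\<close>, \<open>n + 2\<close> and \<open>i\<close> (for the semigroups of the first \<open>i\<close>
  components) occur in one statement, so \<open>m\<close>-space is represented by the coordinates with index
  below \<open>m\<close> of a point of type \<^typ>\<open>nat \<Rightarrow> complex\<close>; coordinates with index at least \<open>m\<close>
  are irrelevant.  Germs in several variables are represented by functions of which only the
  behaviour near the origin matters.  Germs in the single variable \<open>t\<close> are convergent
  power series of type \<^typ>\<open>complex fps\<close>.
\<close>

definition near0 :: "nat \<Rightarrow> ((nat \<Rightarrow> complex) \<Rightarrow> bool) \<Rightarrow> bool" where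
  "near0 m P \<longleftrightarrow> (\<exists>r>0. \<forall>x. (\<forall>i<m. norm (x i) < r) \<longrightarrow> P x)"

text \<open>The sum ranges over the multi-indices in the first \<open>m\<close> variables.\<close>

definition conv_ps :: "nat \<Rightarrow> ((nat \<Rightarrow> complex) \<Rightarrow> complex) set" where
  "conv_ps m = {f. \<exists>c :: (nat \<Rightarrow> nat) \<Rightarrow> complex.
     near0 m (\<lambda>x. ((\<lambda>\<alpha>. c \<alpha> * (\<Prod>i<m. x i ^ \<alpha> i)) has_sum f x) {\<alpha>. \<forall>i\<ge>m. \<alpha> i = 0})}"

definition ideal_ps ::
  "nat \<Rightarrow> 'i set \<Rightarrow> ('i \<Rightarrow> (nat \<Rightarrow> complex) \<Rightarrow> complex) \<Rightarrow> ((nat \<Rightarrow> complex) \<Rightarrow> complex) set" where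
  "ideal_ps m I e = {f \<in> conv_ps m.
     \<exists>u. (\<forall>i\<in>I. u i \<in> conv_ps m) \<and> near0 m (\<lambda>x. f x = (\<Sum>i\<in>I. u i x * e i x))}"

text \<open>The maximal ideal is generated by the coordinates, hence its square by their pairwise products.\<close>

definition max_ideal_sq :: "nat \<Rightarrow> ((nat \<Rightarrow> complex) \<Rightarrow> complex) set" where
  "max_ideal_sq m = ideal_ps m ({..<m} \<times> {..<m}) (\<lambda>(a, b) x. x a * x b)"

definition fps_ord :: "complex fps \<Rightarrow> enat" where
  "fps_ord f = (if f = 0 then \<infinity> else enat (subdegree f))"

definition jet :: "nat \<Rightarrow> complex fps \<Rightarrow> complex fps" where
  "jet k f = fps_cutoff (Suc k) f"

definition map_germ :: "nat \<Rightarrow> (nat \<Rightarrow> complex fps) \<Rightarrow> bool" where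
  "map_germ N \<phi> \<longleftrightarrow> (\<forall>i\<le>N. fps_conv_radius (\<phi> i) > 0 \<and> fps_nth (\<phi> i) 0 = 0)"

text \<open>The germ \<open>g(\<phi>(t))\<close>, as a power series in \<open>t\<close>.\<close>

definition pull :: "((nat \<Rightarrow> complex) \<Rightarrow> complex) \<Rightarrow> (nat \<Rightarrow> complex fps) \<Rightarrow> complex fps" where
  "pull g \<phi> = fps_expansion (\<lambda>t. g (\<lambda>i. eval_fps (\<phi> i) t)) 0"

definition Diff_line :: "complex fps set" where
  "Diff_line = {\<rho>. fps_conv_radius \<rho> > 0 \<and> fps_nth \<rho> 0 = 0 \<and>
     (\<exists>\<rho>'. fps_conv_radius \<rho>' > 0 \<and> fps_nth \<rho>' 0 = 0 \<and> \<rho> oo \<rho>' = fps_X \<and> \<rho>' oo \<rho> = fps_X)}"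

definition Diff_space :: "nat \<Rightarrow> (nat \<Rightarrow> (nat \<Rightarrow> complex) \<Rightarrow> complex) set" where
  "Diff_space m = {\<sigma>. (\<forall>i<m. \<sigma> i \<in> conv_ps m \<and> \<sigma> i (\<lambda>_. 0) = 0) \<and>
     (\<exists>\<tau>. (\<forall>i<m. \<tau> i \<in> conv_ps m \<and> \<tau> i (\<lambda>_. 0) = 0) \<and>
       near0 m (\<lambda>x. \<forall>i<m. \<sigma> i (\<lambda>j. \<tau> j x) = x i \<and> \<tau> i (\<lambda>j. \<sigma> j x) = x i))}"

definition act ::
  "complex fps \<Rightarrow> (nat \<Rightarrow> (nat \<Rightarrow> complex) \<Rightarrow> complex) \<Rightarrow> (nat \<Rightarrow> complex fps) \<Rightarrow> nat \<Rightarrow> complex fps" where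
  "act \<rho> \<sigma> \<phi> i = pull (\<sigma> i) \<phi> oo fps_inv \<rho>"

definition A_equiv :: "nat \<Rightarrow> (nat \<Rightarrow> complex fps) \<Rightarrow> (nat \<Rightarrow> complex fps) \<Rightarrow> bool" where
  "A_equiv N \<phi>1 \<phi>2 \<longleftrightarrow>
     (\<exists>\<rho>\<in>Diff_line. \<exists>\<sigma>\<in>Diff_space (Suc N). \<forall>i\<le>N. \<phi>2 i = act \<rho> \<sigma> \<phi>1 i)"

definition primitive :: "nat \<Rightarrow> (nat \<Rightarrow> complex fps) \<Rightarrow> bool" where
  "primitive N \<phi> \<longleftrightarrow> \<not> (\<exists>\<psi> \<tau>. map_germ N \<psi> \<and> fps_conv_radius \<tau> > 0 \<and> fps_ord \<tau> \<ge> 2 \<and>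
     (\<forall>i\<le>N. \<phi> i = \<psi> i oo \<tau>))"

definition nondegenerate :: "nat \<Rightarrow> (nat \<Rightarrow> complex fps) \<Rightarrow> bool" where
  "nondegenerate N \<phi> \<longleftrightarrow> \<not> (\<exists>\<phi>'. map_germ N \<phi>' \<and> A_equiv N \<phi> \<phi>' \<and> (\<exists>i\<le>N. \<phi>' i = 0))"

definition parametrization :: "nat \<Rightarrow> (nat \<Rightarrow> complex fps) \<Rightarrow> bool" where
  "parametrization N \<phi> \<longleftrightarrow> map_germ N \<phi> \<and> primitive N \<phi> \<and> nondegenerate N \<phi>"

text \<open>
  The orders of the nonzero \<open>h(p\<^sub>0, \<dots>, p\<^bsub>i-1\<^esub>)\<close>.  For \<open>\<phi>\<close> with components \<open>0, \<dots>, N\<close>, the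
  semigroup of \<open>\<phi>\<close> is the case \<open>i = N + 1\<close>.
\<close>

definition values_upto :: "nat \<Rightarrow> (nat \<Rightarrow> complex fps) \<Rightarrow> nat set" where
  "values_upto i \<phi> = {subdegree (pull h \<phi>) | h. h \<in> conv_ps i \<and> pull h \<phi> \<noteq> 0}"

definition value_semigroup :: "nat \<Rightarrow> (nat \<Rightarrow> complex fps) \<Rightarrow> nat set" where
  "value_semigroup N \<phi> = values_upto (Suc N) \<phi>"

definition is_min :: "nat \<Rightarrow> nat set \<Rightarrow> bool" where
  "is_min a S \<longleftrightarrow> a \<in> S \<and> (\<forall>s\<in>S. a \<le> s)"

inductive_set semigroup_span :: "nat set \<Rightarrow> nat set" for A :: "nat set" where
  zero: "0 \<in> semigroup_span A"
| add: "a \<in> A \<Longrightarrow> s \<in> semigroup_span A \<Longrightarrow> a + s \<in> semigroup_span A"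

definition minimal_generators :: "nat set \<Rightarrow> nat \<Rightarrow> (nat \<Rightarrow> nat) \<Rightarrow> bool" where
  "minimal_generators S g v \<longleftrightarrow> strict_mono_on {..g} v \<and> semigroup_span (v ` {..g}) = S \<and>
     (\<forall>B. B \<subset> v ` {..g} \<longrightarrow> semigroup_span B \<noteq> S)"

text \<open>Only the values \<open>a 0, \<dots>, a (v0 - 1)\<close> are constrained.\<close>

definition is_apery :: "nat set \<Rightarrow> (nat \<Rightarrow> nat) \<Rightarrow> bool" where
  "is_apery S a \<longleftrightarrow> (\<exists>v0. is_min v0 (S - {0}) \<and> a 0 = 0 \<and>
     (\<forall>i. 1 \<le> i \<and> i < v0 \<longrightarrow> is_min (a i) (S - (\<Union>j<i. {a j + v0 * k | k. True}))))"

text \<open>The multiplicity \<open>v\<^sub>0\<close> is \<open>w 0\<close>; the values of \<open>w\<close> above \<open>N\<close> are irrelevant.\<close>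

definition P_set :: "nat \<Rightarrow> (nat \<Rightarrow> nat) \<Rightarrow> (nat \<Rightarrow> complex fps) set" where
  "P_set N w = {\<phi>. parametrization N \<phi> \<and> \<phi> 0 = fps_X ^ w 0 \<and>
     is_min (w 0) (value_semigroup N \<phi> - {0}) \<and> strict_mono_on {..N} w \<and>
     (\<forall>i. 1 \<le> i \<and> i \<le> N \<longrightarrow>
        fps_nth (\<phi> i) (w i) = 1 \<and> (\<forall>j<w i. fps_nth (\<phi> i) j = 0) \<and>
        is_min (w i) (value_semigroup N \<phi> - values_upto i \<phi>))}"

definition jac0 :: "(nat \<Rightarrow> (nat \<Rightarrow> complex) \<Rightarrow> complex) \<Rightarrow> nat \<Rightarrow> nat \<Rightarrow> complex" where
  "jac0 \<sigma> i j = deriv (\<lambda>z. \<sigma> i ((\<lambda>_. 0)(j := z))) 0"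

definition A1_tilde :: "nat \<Rightarrow> (complex fps \<times> (nat \<Rightarrow> (nat \<Rightarrow> complex) \<Rightarrow> complex)) set" where
  "A1_tilde N = {(\<rho>, \<sigma>). \<rho> \<in> Diff_line \<and> \<sigma> \<in> Diff_space (Suc N) \<and> jet 1 \<rho> = fps_X \<and>
     (\<forall>i\<le>N. jac0 \<sigma> i i = 1 \<and> (\<forall>j<i. jac0 \<sigma> i j = 0))}"

text \<open>
  \<^term>\<open>fps_binomial (1 / of_nat v0)\<close> is the expansion of the branch of \<open>(1 + z)\<^bsup>1/v0\<^esup>\<close> with
  value \<open>1\<close> at \<open>z = 0\<close>.
\<close>

definition admissible :: "nat \<Rightarrow> (nat \<Rightarrow> nat) \<Rightarrow> (nat \<Rightarrow> complex fps) \<Rightarrow>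
    complex fps \<Rightarrow> (nat \<Rightarrow> (nat \<Rightarrow> complex) \<Rightarrow> complex) \<Rightarrow> bool" where
  "admissible N w \<phi> \<rho> \<sigma> \<longleftrightarrow> (\<rho>, \<sigma>) \<in> A1_tilde N \<and>
     (\<exists>h. (\<forall>k\<le>N. h k \<in> conv_ps (Suc N) \<and>
             (\<exists>a \<in> ideal_ps (Suc N) {k<..N} (\<lambda>j x. x j). \<exists>b \<in> max_ideal_sq (Suc N).
                near0 (Suc N) (\<lambda>x. h k x = a x + b x)) \<and>
             fps_ord (pull (h k) \<phi>) > enat (w k)) \<and>
          \<rho> = fps_X * (fps_binomial (1 / of_nat (w 0)) oo (pull (h 0) \<phi> / fps_X ^ w 0)) \<and>
          (\<forall>k\<le>N. near0 (Suc N) (\<lambda>x. \<sigma> k x = x k + h k x)))"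

text \<open>The notion is only meant for \<open>l > w i\<close>, so that \<open>l - 1\<close> does not truncate.\<close>

definition eliminable :: "nat \<Rightarrow> (nat \<Rightarrow> nat) \<Rightarrow> (nat \<Rightarrow> complex fps) \<Rightarrow> nat \<Rightarrow> nat \<Rightarrow> bool" where
  "eliminable N w \<phi> i l \<longleftrightarrow> (\<exists>\<rho> \<sigma>. admissible N w \<phi> \<rho> \<sigma> \<and>
     act \<rho> \<sigma> \<phi> 0 = fps_X ^ w 0 \<and> jet l (act \<rho> \<sigma> \<phi> i) = jet (l - 1) (\<phi> i))"

end

(*
  Convergent power series in m variables are exactly the bounded functions near 0 that depend on
  m coordinates and are holomorphic along every holomorphic curve.  In this description sums,
  compositions and uniform limits are immediate, and a fixed point iteration gives the inverse
  of a germ whose Jacobian is unipotent upper triangular.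

  Let v0 = w 0.  The conductor of the semigroup of phi1 is V - v0 + 1: the gaps of the semigroup of
  phi0 above V - v0 are congruent to V, by the shape of its Apery set, and V is a value of phi1.
  Hence every series of order > V - v0 is g(phi1) for a convergent g, and subtracting such g from the
  coordinates truncates phi1.  The linear part of the coordinate change is unipotent upper triangular
  because w j is not a value of the components before the j-th one.

  For the elimination statement an admissible pair for phi0 extends by h_(n+1) = 0.  Conversely setting
  the last coordinate to 0 in an admissible pair for phi1 changes the h_k(phi) only from order V on,
  hence the new y_i only from order V on.
*)
theory Submission
  imports Defs
begin

section \<open>Germs tested on holomorphic curves\<close>

text \<open>Substitution is the basic operation here: curves into germs, germs into germs, the
  inverse of a coordinate change. With multi-index series each substitution would need its own
  rearrangement argument. Testing on curves reduces all of them to holomorphic functions of one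
  variable; the price is paid once, when a Taylor expansion is recovered from the test.

  A value of the semigroup only says that some germ has a given order along the curve. Removing
  leading terms one by one from a series \<open>R\<close> gives no control of convergence, so the
  coefficients of a germ with pull-back \<open>R\<close> have to be kept under geometric bounds.

  A coordinate change that mixes all coordinates need not respect the values of the first
  \<open>i\<close> components. This is the obstacle to keeping the truncated curve in the same
  class. The way out: a germ in the first \<open>i\<close> coordinates whose order along the curve
  is at least \<open>w i\<close> has no linear part, so errors of order \<open>w i\<close> in its
  arguments are felt only beyond \<open>w i\<close>.

  The \<open>w i\<close> inside \<open>k_i\<close> saves the leading term of a component that starts
  at or above the conductor.\<close>

definition polydisc :: "nat \<Rightarrow> real \<Rightarrow> (nat \<Rightarrow> complex) set" where
  "polydisc m r = {x. \<forall>i<m. norm (x i) < r}"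

text \<open>Boundedness is included because it feeds the Cauchy estimates behind the expansion.
  Curves over arbitrary open subsets of the line make closure under composition immediate, without
  any appeal to joint continuity.\<close>

definition plot_holo :: "nat \<Rightarrow> real \<Rightarrow> ((nat \<Rightarrow> complex) \<Rightarrow> complex) \<Rightarrow> bool" where
  "plot_holo m r f \<longleftrightarrow>
     (\<forall>x\<in>polydisc m r. \<forall>y. (\<forall>i<m. x i = y i) \<longrightarrow> f x = f y) \<and>
     (\<exists>B. \<forall>x\<in>polydisc m r. norm (f x) \<le> B) \<and>
     (\<forall>S g. open S \<longrightarrow> (\<forall>i<m. g i holomorphic_on S) \<longrightarrow> (\<forall>z\<in>S. (\<lambda>i. g i z) \<in> polydisc m r) \<longrightarrow>
        (\<lambda>z. f (\<lambda>i. g i z)) holomorphic_on S)"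

lemma near0_polydisc: "near0 m P \<longleftrightarrow> (\<exists>r>0. \<forall>x\<in>polydisc m r. P x)"
  by (auto simp: near0_def polydisc_def)

lemma polydisc_mono: "r \<le> s \<Longrightarrow> m \<ge> k \<Longrightarrow> x \<in> polydisc m r \<Longrightarrow> x \<in> polydisc k s"
  by (auto simp: polydisc_def intro: less_le_trans order.strict_trans2)

lemma plot_holo_cong: "plot_holo m r f \<Longrightarrow> x \<in> polydisc m r \<Longrightarrow> (\<And>i. i < m \<Longrightarrow> x i = y i) \<Longrightarrow> f x = f y"
  by (simp add: plot_holo_def)

lemma plot_holo_bound:
  assumes "plot_holo m r f"
  obtains B where "B > 0" "\<And>x. x \<in> polydisc m r \<Longrightarrow> norm (f x) \<le> B"
proof -
  obtain B where B: "\<forall>x\<in>polydisc m r. norm (f x) \<le> B"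
    using assms by (auto simp: plot_holo_def)
  show thesis
    by (rule that[of "max B 1"]) (use B in \<open>force+\<close>)
qed

lemma plot_holo_plot:
  "plot_holo m r f \<Longrightarrow> open S \<Longrightarrow> (\<And>i. i < m \<Longrightarrow> g i holomorphic_on S) \<Longrightarrow>
   (\<And>z. z \<in> S \<Longrightarrow> (\<lambda>i. g i z) \<in> polydisc m r) \<Longrightarrow> (\<lambda>z. f (\<lambda>i. g i z)) holomorphic_on S"
  unfolding plot_holo_def by blast

lemma plot_holoI:
  assumes "\<And>x y. x \<in> polydisc m r \<Longrightarrow> (\<And>i. i < m \<Longrightarrow> x i = y i) \<Longrightarrow> f x = f y"
    and "\<And>x. x \<in> polydisc m r \<Longrightarrow> norm (f x) \<le> B"
    and "\<And>S g. open S \<Longrightarrow> (\<And>i. i < m \<Longrightarrow> g i holomorphic_on S) \<Longrightarrow>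
            (\<And>z. z \<in> S \<Longrightarrow> (\<lambda>i. g i z) \<in> polydisc m r) \<Longrightarrow> (\<lambda>z. f (\<lambda>i. g i z)) holomorphic_on S"
  shows "plot_holo m r f"
  unfolding plot_holo_def using assms by blast

lemma plot_holo_mono: "plot_holo m r f \<Longrightarrow> s \<le> r \<Longrightarrow> m \<le> k \<Longrightarrow> plot_holo k s f"
  unfolding plot_holo_def
  by (intro conjI; (elim conjE exE)?)
     (meson polydisc_mono order.strict_trans2 | blast intro: polydisc_mono order.strict_trans2)+

lemma holomorphic_uniform_sequence':
  assumes "open S" "\<And>n. f n holomorphic_on S" "uniform_limit S f g sequentially"
  shows "g holomorphic_on S"
proof (rule holomorphic_uniform_sequence[OF assms(1,2)])
  fix x assume "x \<in> S"
  then obtain d where d: "0 < d" "cball x d \<subseteq> S"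
    using assms(1) open_contains_cball by blast
  then show "\<exists>d. 0 < d \<and> cball x d \<subseteq> S \<and> uniform_limit (cball x d) f g sequentially"
    using uniform_limit_on_subset[OF assms(3)] by blast
qed

text \<open>One member of the sequence at distance below 1 bounds the limit, and along each curve
  the limit is a uniform limit of holomorphic functions of one variable.\<close>

lemma plot_holo_uniform_limit:
  assumes f: "\<And>n. plot_holo m r (f n)" and lim: "uniform_limit (polydisc m r) f g sequentially"
    and dep: "\<And>x y. x \<in> polydisc m r \<Longrightarrow> (\<And>i. i < m \<Longrightarrow> x i = y i) \<Longrightarrow> g x = g y"
  shows "plot_holo m r g"
proof -
  obtain n where n: "\<And>x. x \<in> polydisc m r \<Longrightarrow> dist (f n x) (g x) < 1"
    using lim unfolding uniform_limit_iff eventually_sequentially by (metis order_refl zero_less_one)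
  obtain B where B: "\<And>x. x \<in> polydisc m r \<Longrightarrow> norm (f n x) \<le> B"
    using plot_holo_bound[OF f] by metis
  show ?thesis
  proof (rule plot_holoI)
    show "norm (g x) \<le> B + 1" if "x \<in> polydisc m r" for x
      using n[OF that] B[OF that] by norm
    fix S h assume S: "open S" "\<And>i. i < m \<Longrightarrow> h i holomorphic_on S"
      and h: "\<And>z. z \<in> S \<Longrightarrow> (\<lambda>i. h i z) \<in> polydisc m r"
    show "(\<lambda>z. g (\<lambda>i. h i z)) holomorphic_on S"
    proof (rule holomorphic_uniform_sequence'[OF S(1)])
      show "(\<lambda>z. f n (\<lambda>i. h i z)) holomorphic_on S" for n
        using plot_holo_plot[OF f S h] .
      show "uniform_limit S (\<lambda>n z. f n (\<lambda>i. h i z)) (\<lambda>z. g (\<lambda>i. h i z)) sequentially"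
        using lim h unfolding uniform_limit_iff by (force elim!: eventually_mono)
    qed
  qed (rule dep)
qed

text \<open>Summation over all multi-indices is unconditional, hence absolute, so the terms at the
  single point with all coordinates \<open>r\<close> majorise the series on the whole polydisc of
  radius \<open>r\<close>. Along a curve the Weierstrass test applies.\<close>

lemma conv_ps_imp_plot_holo:
  assumes "f \<in> conv_ps m"
  obtains r where "r > 0" "plot_holo m r f"
proof -
  let ?I = "{\<alpha> :: nat \<Rightarrow> nat. \<forall>i\<ge>m. \<alpha> i = 0}"
  obtain c s where s: "s > 0"
    and hs: "\<And>x. x \<in> polydisc m s \<Longrightarrow> ((\<lambda>\<alpha>. c \<alpha> * (\<Prod>i<m. x i ^ \<alpha> i)) has_sum f x) ?I"
    using assms unfolding conv_ps_def near0_polydisc by blast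
  define r where "r = s / 2"
  \<comment> \<open>The radius was halved so that the point with all coordinates \<open>r\<close>
    lies in the open polydisc of convergence.\<close>
  define M where "M \<alpha> = norm (c \<alpha> * (\<Prod>i<m. of_real r ^ \<alpha> i))" for \<alpha>
  have r: "r > 0" "r < s" using s by (auto simp: r_def)
  have "(\<lambda>_. of_real r) \<in> polydisc m s" using r by (auto simp: polydisc_def)
  from hs[OF this] have M: "M summable_on ?I"
    unfolding M_def summable_on_iff_abs_summable_on_complex[symmetric] by (rule has_sum_imp_summable)
  have le: "norm (c \<alpha> * (\<Prod>i<m. x i ^ \<alpha> i)) \<le> M \<alpha>" if "x \<in> polydisc m r" for x \<alpha>
    using that r unfolding M_def norm_mult prod_norm[symmetric] norm_power polydisc_def
    by (intro mult_left_mono prod_mono conjI power_mono) (auto intro!: prod_nonneg less_imp_le)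
  have hs': "((\<lambda>\<alpha>. c \<alpha> * (\<Prod>i<m. x i ^ \<alpha> i)) has_sum f x) ?I" if "x \<in> polydisc m r" for x
    using hs[of x] that r polydisc_mono[of r s m m x] by auto
  have "plot_holo m r f"
  proof (rule plot_holoI)
    show "f x = f y" if "x \<in> polydisc m r" "\<And>i. i < m \<Longrightarrow> x i = y i" for x y
    proof -
      have "y \<in> polydisc m r" using that by (auto simp: polydisc_def)
      from hs'[OF this] have "((\<lambda>\<alpha>. c \<alpha> * (\<Prod>i<m. x i ^ \<alpha> i)) has_sum f y) ?I"
        by (rule has_sum_cong[THEN iffD1, rotated]) (use that in auto)
      with hs'[OF that(1)] show ?thesis by (rule has_sum_unique)
    qed
    show "norm (f x) \<le> infsum M ?I" if "x \<in> polydisc m r" for x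
      using norm_infsum_le[OF hs'[OF that] has_sum_infsum[OF M]] le[OF that] by blast
    fix S g assume S: "open S" "\<And>i. i < m \<Longrightarrow> g i holomorphic_on S"
      and g: "\<And>z. z \<in> S \<Longrightarrow> (\<lambda>i. g i z) \<in> polydisc m r"
    define F where "F X z = (\<Sum>\<alpha>\<in>X. c \<alpha> * (\<Prod>i<m. g i z ^ \<alpha> i))" for X z
    have hol: "F X holomorphic_on S" for X
      unfolding F_def by (intro holomorphic_intros S) auto
    have "uniform_limit S F (\<lambda>z. infsum (\<lambda>\<alpha>. c \<alpha> * (\<Prod>i<m. g i z ^ \<alpha> i)) ?I) (finite_subsets_at_top ?I)"
      unfolding F_def by (rule Weierstrass_m_test_general) (use le g M in auto)
    also have "?this \<longleftrightarrow> uniform_limit S F (\<lambda>z. f (\<lambda>i. g i z)) (finite_subsets_at_top ?I)"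
      by (intro uniform_limit_cong' refl) (use hs'[OF g] in \<open>auto intro: infsumI\<close>)
    finally have lim: "uniform_limit S F (\<lambda>z. f (\<lambda>i. g i z)) (finite_subsets_at_top ?I)" .
    show "(\<lambda>z. f (\<lambda>i. g i z)) holomorphic_on S"
      \<comment> \<open>The limit runs along finite sets of multi-indices rather than a sequence, so
        holomorphy is checked on small discs.\<close>
      unfolding holomorphic_on_open[OF S(1)]
    proof
      fix z assume "z \<in> S"
      then obtain d where d: "0 < d" "cball z d \<subseteq> S"
        using S(1) open_contains_cball by blast
      have "(\<lambda>z. f (\<lambda>i. g i z)) holomorphic_on ball z d"
      proof (rule holomorphic_uniform_limit[where f = F and F = "finite_subsets_at_top ?I" and g = "\<lambda>z. f (\<lambda>i. g i z)"])
        show "\<forall>\<^sub>F n in finite_subsets_at_top ?I. continuous_on (cball z d) (F n) \<and> F n holomorphic_on ball z d"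
          using hol d
          by (intro always_eventually) (meson ball_subset_cball holomorphic_on_imp_continuous_on holomorphic_on_subset)
      qed (use lim d in \<open>auto intro: uniform_limit_on_subset\<close>)
      then show "\<exists>f'. ((\<lambda>z. f (\<lambda>i. g i z)) has_field_derivative f') (at z)"
        using d(1) by (auto simp: holomorphic_on_open)
    qed
  qed
  with r(1) show ?thesis by (rule that)
qed

section \<open>Closure under algebraic operations and composition\<close>

lemma plot_holo_const: "plot_holo m r (\<lambda>_. c)"
  by (rule plot_holoI[where B = "norm c"]) auto

lemma plot_holo_coord: "i < m \<Longrightarrow> plot_holo m r (\<lambda>x. x i)"
  by (rule plot_holoI[where B = r]) (auto simp: polydisc_def intro: less_imp_le)

lemma plot_holo_add:
  assumes "plot_holo m r f" "plot_holo m r g"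
  shows "plot_holo m r (\<lambda>x. f x + g x)"
proof -
  obtain A B where A: "\<And>x. x \<in> polydisc m r \<Longrightarrow> norm (f x) \<le> A"
    and B: "\<And>x. x \<in> polydisc m r \<Longrightarrow> norm (g x) \<le> B"
    using plot_holo_bound[OF assms(1)] plot_holo_bound[OF assms(2)] by metis
  show ?thesis
  proof (rule plot_holoI[where B = "A + B"])
    show "f x + g x = f y + g y" if "x \<in> polydisc m r" "\<And>i. i < m \<Longrightarrow> x i = y i" for x y
      using plot_holo_cong[OF assms(1) that] plot_holo_cong[OF assms(2) that] by simp
    show "norm (f x + g x) \<le> A + B" if "x \<in> polydisc m r" for x
      using A[OF that] B[OF that] by norm
  qed (intro holomorphic_on_add plot_holo_plot[OF assms(1)] plot_holo_plot[OF assms(2)]; assumption)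
qed

lemma plot_holo_mult:
  assumes "plot_holo m r f" "plot_holo m r g"
  shows "plot_holo m r (\<lambda>x. f x * g x)"
proof -
  obtain A B where A: "\<And>x. x \<in> polydisc m r \<Longrightarrow> norm (f x) \<le> A" "A > 0"
    and B: "\<And>x. x \<in> polydisc m r \<Longrightarrow> norm (g x) \<le> B"
    using plot_holo_bound[OF assms(1)] plot_holo_bound[OF assms(2)] by metis
  show ?thesis
  proof (rule plot_holoI[where B = "A * B"])
    show "f x * g x = f y * g y" if "x \<in> polydisc m r" "\<And>i. i < m \<Longrightarrow> x i = y i" for x y
      using plot_holo_cong[OF assms(1) that] plot_holo_cong[OF assms(2) that] by simp
    show "norm (f x * g x) \<le> A * B" if "x \<in> polydisc m r" for x
      using A(1)[OF that] B[OF that] A(2) by (simp add: norm_mult mult_mono)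
  qed (intro holomorphic_on_mult plot_holo_plot[OF assms(1)] plot_holo_plot[OF assms(2)]; assumption)
qed

lemma plot_holo_diff: "plot_holo m r f \<Longrightarrow> plot_holo m r g \<Longrightarrow> plot_holo m r (\<lambda>x. f x - g x)"
  using plot_holo_add[OF _ plot_holo_mult[OF plot_holo_const[of m r "-1"]], of f g] by simp

lemma plot_holo_sum:
  "(\<And>i. i \<in> A \<Longrightarrow> plot_holo m r (f i)) \<Longrightarrow> plot_holo m r (\<lambda>x. \<Sum>i\<in>A. f i x)"
  by (induction A rule: infinite_finite_induct) (auto intro: plot_holo_const plot_holo_add)

lemma plot_holo_compose:
  assumes f: "plot_holo k s f" and g: "\<And>i. i < k \<Longrightarrow> plot_holo m r (g i)"
    and im: "\<And>x. x \<in> polydisc m r \<Longrightarrow> (\<lambda>i. g i x) \<in> polydisc k s"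
  shows "plot_holo m r (\<lambda>x. f (\<lambda>i. g i x))"
proof -
  obtain B where B: "\<And>x. x \<in> polydisc k s \<Longrightarrow> norm (f x) \<le> B"
    using plot_holo_bound[OF f] by metis
  show ?thesis
  proof (rule plot_holoI[where B = B])
    show "f (\<lambda>i. g i x) = f (\<lambda>i. g i y)" if "x \<in> polydisc m r" "\<And>i. i < m \<Longrightarrow> x i = y i" for x y
      using plot_holo_cong[OF f im[OF that(1)]] plot_holo_cong[OF g that] by simp
    show "norm (f (\<lambda>i. g i x)) \<le> B" if "x \<in> polydisc m r" for x
      using B im that by blast
    fix S h assume S: "open S" "\<And>i. i < m \<Longrightarrow> h i holomorphic_on S"
      and h: "\<And>z. z \<in> S \<Longrightarrow> (\<lambda>i. h i z) \<in> polydisc m r"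
    show "(\<lambda>z. f (\<lambda>i. g i (\<lambda>i. h i z))) holomorphic_on S"
      using plot_holo_plot[OF g S h] im[OF h] by (intro plot_holo_plot[OF f S(1)]) auto
  qed
qed

section \<open>Power series expansion of functions tested on curves\<close>

abbreviation multi :: "nat \<Rightarrow> (nat \<Rightarrow> nat) set" where
  "multi m \<equiv> {\<alpha>. \<forall>i\<ge>m. \<alpha> i = 0}"

lemma has_sum_multi_Suc:
  "(g has_sum s) (multi (Suc m)) \<longleftrightarrow> ((\<lambda>(k, \<beta>). g (\<beta>(m := k))) has_sum s) (UNIV \<times> multi m)"
  by (rule has_sum_reindex_bij_witness[of _ "\<lambda>(k, \<beta>). \<beta>(m := k)" "\<lambda>\<alpha>. (\<alpha> m, \<alpha>(m := 0))"])
     (auto simp: fun_eq_iff)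

lemma prod_multi_Suc:
  "(\<Prod>i<Suc m. x i ^ (\<beta>(m := k)) i) = (\<Prod>i<m. x i ^ \<beta> i) * (x m ^ k :: 'a :: comm_monoid_mult)"
proof -
  have "(\<Prod>i<m. x i ^ (\<beta>(m := k)) i) = (\<Prod>i<m. x i ^ \<beta> i)"
    by (rule prod.cong) auto
  then show ?thesis by simp
qed

text \<open>A product of geometric series, summed one variable at a time; it majorises an expansion
  on a smaller polydisc.\<close>

lemma summable_monomials:
  fixes q :: "nat \<Rightarrow> real"
  assumes "\<And>i. i < m \<Longrightarrow> 0 \<le> q i \<and> q i < 1"
  shows "(\<lambda>\<alpha>. \<Prod>i<m. q i ^ \<alpha> i) summable_on multi m"
  using assms
proof (induction m)
  case 0
  have "multi 0 = {\<lambda>_. 0}" by auto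
  then show ?case by simp
next
  case (Suc m)
  obtain S where S: "((\<lambda>\<alpha>. \<Prod>i<m. q i ^ \<alpha> i) has_sum S) (multi m)"
    using Suc by (force simp: summable_on_def)
  have "(\<lambda>k. S * q m ^ k) summable_on UNIV"
    using Suc.prems[of m] by (intro summable_on_cmult_right summable_on_UNIV_nonneg_real_iff[THEN iffD2]) auto
  then have "(\<lambda>(k, \<beta>). (\<Prod>i<m. q i ^ \<beta> i) * q m ^ k) summable_on (UNIV \<times> multi m)"
    using Suc.prems
    by (intro summable_on_SigmaI[where g = "\<lambda>k. S * q m ^ k"])
       (auto intro!: has_sum_cmult_left S mult_nonneg_nonneg prod_nonneg)
  then show ?case
    unfolding summable_on_def has_sum_multi_Suc prod_multi_Suc .
qed

text \<open>Expand in the last variable by one-variable theory and expand the coefficients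
  \<open>a k\<close> by induction. The bound on \<open>c\<close> belongs to the claim because
  absolute summability over pairs of exponents rests on it. The real issue is that each
  \<open>a k\<close> passes the test on curves in the remaining variables; this is obtained without
  differentiating in a parameter.\<close>

lemma plot_holo_expansion:
  assumes "plot_holo m r f" "\<And>x. x \<in> polydisc m r \<Longrightarrow> norm (f x) \<le> B" "0 < s" "s < r"
  shows "\<exists>c. (\<forall>\<alpha>. norm (c \<alpha>) \<le> B / s ^ (\<Sum>i<m. \<alpha> i)) \<and>
     (\<forall>x\<in>polydisc m s. ((\<lambda>\<alpha>. c \<alpha> * (\<Prod>i<m. x i ^ \<alpha> i)) has_sum f x) (multi m))"
  using assms
proof (induction m arbitrary: f B)
  case 0
  have "((\<lambda>\<alpha>. f (\<lambda>_. 0) * (\<Prod>i<0. x i ^ \<alpha> i)) has_sum f x) (multi 0)" for x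
  proof -
    have "multi 0 = {\<lambda>_. 0}" by auto
    moreover have "f (\<lambda>_. 0) = f x"
      using plot_holo_cong[OF 0(1), of "\<lambda>_. 0" x] by (simp add: polydisc_def)
    ultimately show ?thesis by (simp add: has_sum_finite_iff)
  qed
  moreover have "norm (f (\<lambda>_. 0)) \<le> B" using 0 by (auto simp: polydisc_def)
  ultimately show ?case by (intro exI[of _ "\<lambda>_. f (\<lambda>_. 0)"]) auto
next
  case (Suc m)
  note f = Suc.prems(1) and B = Suc.prems(2) and s = Suc.prems(3,4)
  define a where "a k x = (deriv ^^ k) (\<lambda>z. f (x(m := z))) 0 / fact k" for k x
  have upd: "x(m := z) \<in> polydisc (Suc m) r" if "x \<in> polydisc m r" "norm z < r" for x z
    using that by (auto simp: polydisc_def less_Suc_eq)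
  have "B \<ge> 0" using B[of "\<lambda>_. 0"] s by (auto simp: polydisc_def intro: order_trans[OF norm_ge_zero])
  have hol: "(\<lambda>z. f (x(m := z))) holomorphic_on ball 0 r" if "x \<in> polydisc m r" for x
  proof -
    have "(\<lambda>z. (x(m := z)) i) holomorphic_on ball 0 r" for i
      by (cases "i = m") (auto intro: holomorphic_intros)
    then show ?thesis
      using plot_holo_plot[OF f, of "ball 0 r" "\<lambda>i z. (x(m := z)) i"] upd[OF that] by (simp add: fun_upd_def)
  qed
  have a_bound: "norm (a k x) \<le> B / s ^ k" if "x \<in> polydisc m r" for k x
  proof -
    have sub: "cball 0 s \<subseteq> ball (0 :: complex) r" using s by auto
    have "norm ((deriv ^^ k) (\<lambda>z. f (x(m := z))) 0) \<le> fact k * B / s ^ k"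
    proof (rule Cauchy_inequality)
      show "(\<lambda>z. f (x(m := z))) holomorphic_on ball 0 s"
        by (rule holomorphic_on_subset[OF hol[OF that]]) (use sub in auto)
      show "continuous_on (cball 0 s) (\<lambda>z. f (x(m := z)))"
        by (rule continuous_on_subset[OF holomorphic_on_imp_continuous_on[OF hol[OF that]] sub])
    qed (use s in \<open>auto intro!: B upd that\<close>)
    then show ?thesis by (simp add: a_def norm_divide field_simps)
  qed
  have a_sums: "(\<lambda>k. a k x * z ^ k) sums f (x(m := z))" if "x \<in> polydisc m r" "norm z < r" for x z
    using holomorphic_power_series[OF hol[OF that(1)], of z] that(2) by (simp add: a_def)
  \<comment> \<open>Strong induction: \<open>a k x\<close> is the uniform limit, as \<open>z\<close>
    tends to 0, of the quotient of \<open>f(x, z) - (a 0 x + ... + a (k - 1) x * z^(k - 1))\<close>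
    by \<open>z^k\<close>, which involves only \<open>f\<close> and earlier coefficients.\<close>
  have a_holo: "plot_holo m r (a k)" for k
  proof (induction k rule: less_induct)
    case (less k)
    \<comment> \<open>Points tending to 0; the bound \<open>s / 2\<close> turns the tail of the
      Taylor series into a geometric series of ratio 1/2.\<close>
    define z :: "nat \<Rightarrow> complex" where "z n = of_real (s / (real n + 2))" for n
    have z: "z n \<noteq> 0" "norm (z n) \<le> s / 2" "norm (z n) < r" for n
    proof -
      have nz: "norm (z n) = s / (real n + 2)"
        unfolding z_def norm_of_real using s by simp
      have "norm (z n) > 0" unfolding nz using s by simp
      then show "z n \<noteq> 0" by auto
      show "norm (z n) \<le> s / 2" unfolding nz using s by (intro divide_left_mono) auto
      then show "norm (z n) < r" using s by linarith
    qed
    define q where "q n x = (f (\<lambda>i. if i = m then z n else x i) - (\<Sum>i<k. a i x * z n ^ i)) * inverse (z n ^ k)" for n x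
    have q: "plot_holo m r (q n)" for n
      unfolding q_def
      by (intro plot_holo_mult plot_holo_diff plot_holo_sum plot_holo_const less plot_holo_compose[OF f])
         (use z(3)[of n] in \<open>auto simp: polydisc_def less_Suc_eq intro: plot_holo_const plot_holo_coord\<close>)
    have err: "norm (q n x - a k x) \<le> 2 * B / s ^ Suc k * norm (z n)" if x: "x \<in> polydisc m r" for n x
    proof -
      have fe: "(\<lambda>i. if i = m then z n else x i) = x(m := z n)" by auto
      have "(\<lambda>i. a (i + Suc k) x * z n ^ (i + Suc k)) sums
              (f (x(m := z n)) - (\<Sum>i<Suc k. a i x * z n ^ i))"
        using a_sums[OF x z(3), of n] by (rule sums_split_initial_segment)
      from sums_mult2[OF this, of "inverse (z n ^ k)"]
      have "(\<lambda>i. a (i + Suc k) x * z n ^ Suc i) sums (q n x - a k x)"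
        using z(1)[of n] by (simp add: q_def fe power_add field_simps)
      moreover have "norm (a (i + Suc k) x * z n ^ Suc i) \<le> B / s ^ Suc k * norm (z n) * (1 / 2) ^ i" for i
      proof -
        have "norm (z n) ^ i \<le> (s / 2) ^ i" using z(2) by (intro power_mono) auto
        then have "norm (a (i + Suc k) x) * norm (z n) ^ i \<le> B / s ^ (i + Suc k) * (s / 2) ^ i"
          using a_bound[OF x, of "i + Suc k"] \<open>B \<ge> 0\<close> s by (intro mult_mono) auto
        also have "\<dots> = B / s ^ Suc k * (1 / 2) ^ i"
          using s by (simp add: power_add power_divide)
        finally have "norm (a (i + Suc k) x) * norm (z n) ^ i * norm (z n) \<le> B / s ^ Suc k * (1 / 2) ^ i * norm (z n)"
          by (rule mult_right_mono) simp
        then show ?thesis by (simp add: norm_mult norm_power mult_ac)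
      qed
      moreover have "(\<lambda>i. B / s ^ Suc k * norm (z n) * (1 / 2) ^ i) sums (B / s ^ Suc k * norm (z n) * 2)"
        using geometric_sums[of "1 / 2 :: real"] by (intro sums_mult) simp
      ultimately have "norm (q n x - a k x) \<le> B / s ^ Suc k * norm (z n) * 2"
        by (metis (no_types, lifting) norm_suminf_le sums_iff)
      then show ?thesis by (simp add: field_simps)
    qed
    have "(\<lambda>n. s / (real n + 2)) \<longlonglongrightarrow> 0" by real_asymp
    then have z0: "(\<lambda>n. 2 * B / s ^ Suc k * norm (z n)) \<longlonglongrightarrow> 0"
      unfolding z_def norm_of_real by (intro tendsto_mult_right_zero tendsto_rabs_zero)
    show ?case
    proof (rule plot_holo_uniform_limit[OF q])
      show "uniform_limit (polydisc m r) q (a k) sequentially"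
      proof (rule uniform_limitI)
        fix e :: real assume "e > 0"
        from order_tendstoD(2)[OF z0 this]
        show "\<forall>\<^sub>F n in sequentially. \<forall>x\<in>polydisc m r. dist (q n x) (a k x) < e"
        proof eventually_elim
          case (elim n)
          then show ?case unfolding dist_norm using le_less_trans[OF err] by blast
        qed
      qed
    next
      fix x y assume xy: "x \<in> polydisc m r" "\<And>i. i < m \<Longrightarrow> x i = y i"
      have "\<forall>\<^sub>F z in nhds 0. f (x(m := z)) = f (y(m := z))"
      proof (rule eventually_mono[OF eventually_nhds_ball[of r "0 :: complex"]])
        show "f (x(m := z)) = f (y(m := z))" if "z \<in> ball 0 r" for z
          by (rule plot_holo_cong[OF f upd]) (use xy that in \<open>auto simp: less_Suc_eq\<close>)
      qed (use s in simp)
      then show "a k x = a k y"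
        unfolding a_def by (simp add: higher_deriv_cong_ev)
    qed
  qed
  have "\<forall>k. \<exists>c. (\<forall>\<alpha>. norm (c \<alpha>) \<le> (B / s ^ k) / s ^ (\<Sum>i<m. \<alpha> i)) \<and>
     (\<forall>x\<in>polydisc m s. ((\<lambda>\<alpha>. c \<alpha> * (\<Prod>i<m. x i ^ \<alpha> i)) has_sum a k x) (multi m))"
    by (intro allI Suc.IH[OF a_holo a_bound s])
  from choice[OF this] obtain C where C':
    "\<forall>k. (\<forall>\<alpha>. norm (C k \<alpha>) \<le> (B / s ^ k) / s ^ (\<Sum>i<m. \<alpha> i)) \<and>
     (\<forall>x\<in>polydisc m s. ((\<lambda>\<alpha>. C k \<alpha> * (\<Prod>i<m. x i ^ \<alpha> i)) has_sum a k x) (multi m))" ..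
  have C: "norm (C k \<alpha>) \<le> (B / s ^ k) / s ^ (\<Sum>i<m. \<alpha> i)" for k \<alpha>
    using C' by blast
  have Cs: "((\<lambda>\<alpha>. C k \<alpha> * (\<Prod>i<m. x i ^ \<alpha> i)) has_sum a k x) (multi m)" if "x \<in> polydisc m s" for k x
    using C' that by blast
  define c where "c \<alpha> = C (\<alpha> m) (\<alpha>(m := 0))" for \<alpha> :: "nat \<Rightarrow> nat"
  have cb: "norm (c \<alpha>) \<le> B / s ^ (\<Sum>i<Suc m. \<alpha> i)" for \<alpha>
  proof -
    have "(\<Sum>i<m. (\<alpha>(m := 0)) i) = (\<Sum>i<m. \<alpha> i)" by (rule sum.cong) auto
    then show ?thesis
      using C[of "\<alpha> m" "\<alpha>(m := 0)"] by (simp add: c_def power_add mult.commute)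
  qed
  have "((\<lambda>\<alpha>. c \<alpha> * (\<Prod>i<Suc m. x i ^ \<alpha> i)) has_sum f x) (multi (Suc m))"
    if x: "x \<in> polydisc (Suc m) s" for x
  proof -
    have xm: "x \<in> polydisc m s" "norm (x m) < s" using x by (auto simp: polydisc_def)
    have xr: "x \<in> polydisc m r" using xm s by (auto simp: polydisc_def)
    define q where "q i = norm (x i) / s" for i
    have q: "0 \<le> q i \<and> q i < 1" if "i < Suc m" for i
      using x that s by (auto simp: q_def polydisc_def)
    have majs: "(\<lambda>\<alpha>. B * (\<Prod>i<Suc m. q i ^ \<alpha> i)) summable_on multi (Suc m)"
      by (intro summable_on_cmult_right summable_monomials q)
    have maj: "norm (c \<alpha> * (\<Prod>i<Suc m. x i ^ \<alpha> i)) \<le> B * (\<Prod>i<Suc m. q i ^ \<alpha> i)" for \<alpha>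
    proof -
      have "norm (c \<alpha> * (\<Prod>i<Suc m. x i ^ \<alpha> i)) = norm (c \<alpha>) * (\<Prod>i<Suc m. norm (x i) ^ \<alpha> i)"
        by (simp only: norm_mult prod_norm[symmetric] norm_power)
      also have "\<dots> \<le> B / s ^ (\<Sum>i<Suc m. \<alpha> i) * (\<Prod>i<Suc m. norm (x i) ^ \<alpha> i)"
        by (intro mult_right_mono cb prod_nonneg) auto
      also have "\<dots> = B * (\<Prod>i<Suc m. q i ^ \<alpha> i)"
        unfolding q_def power_sum power_divide prod_dividef by simp
      finally show ?thesis .
    qed
    have "(\<lambda>\<alpha>. c \<alpha> * (\<Prod>i<Suc m. x i ^ \<alpha> i)) summable_on multi (Suc m)"
      unfolding summable_on_iff_abs_summable_on_complex
      by (rule summable_on_comparison_test[OF majs maj norm_ge_zero])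
    then have sm: "(\<lambda>(k, \<beta>). c (\<beta>(m := k)) * (\<Prod>i<Suc m. x i ^ (\<beta>(m := k)) i)) summable_on (UNIV \<times> multi m)"
      unfolding summable_on_def has_sum_multi_Suc by simp
    show ?thesis
      unfolding has_sum_multi_Suc
    proof (rule has_sum_SigmaI[where g = "\<lambda>k. a k x * x m ^ k"])
      fix k
      have "((\<lambda>\<beta>. C k \<beta> * (\<Prod>i<m. x i ^ \<beta> i) * x m ^ k) has_sum a k x * x m ^ k) (multi m)"
        by (intro has_sum_cmult_left Cs xm)
      also have "?this \<longleftrightarrow> ((\<lambda>\<beta>. c (\<beta>(m := k)) * (\<Prod>i<Suc m. x i ^ (\<beta>(m := k)) i)) has_sum a k x * x m ^ k) (multi m)"
        unfolding prod_multi_Suc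
        by (intro has_sum_cong) (auto simp: c_def mult.assoc intro!: arg_cong[where f = "C k"])
      finally show "((\<lambda>y. case (k, y) of (k, \<beta>) \<Rightarrow> c (\<beta>(m := k)) * (\<Prod>i<Suc m. x i ^ (\<beta>(m := k)) i)) has_sum a k x * x m ^ k) (multi m)"
        by simp
    next
      have "summable (\<lambda>k. norm (a k x * x m ^ k))"
      proof (rule summable_comparison_test')
        show "summable (\<lambda>k. B * q m ^ k)" using q[of m] by (intro summable_mult summable_geometric) auto
        show "norm (norm (a k x * x m ^ k)) \<le> B * q m ^ k" if "k \<ge> 0" for k
          using mult_right_mono[OF a_bound[OF xr, of k], of "norm (x m) ^ k"]
          by (simp add: norm_mult norm_power q_def power_divide)
      qed
      then show "((\<lambda>k. a k x * x m ^ k) has_sum f x) UNIV"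
        by (rule norm_summable_imp_has_sum) (use a_sums[OF xr, of "x m"] xm s in simp)
    qed (use sm in simp)
  qed
  with cb show ?case by (intro exI[of _ c]) auto
qed

lemma plot_holo_imp_conv_ps:
  assumes "plot_holo m r f" "r > 0"
  shows "f \<in> conv_ps m"
proof -
  obtain B where "\<And>x. x \<in> polydisc m r \<Longrightarrow> norm (f x) \<le> B"
    using plot_holo_bound[OF assms(1)] by metis
  from plot_holo_expansion[OF assms(1) this, of "r / 2"] assms(2)
  show ?thesis unfolding conv_ps_def near0_polydisc
    by (auto intro!: exI[of _ "r / 2"])
qed

lemma conv_ps_iff: "f \<in> conv_ps m \<longleftrightarrow> (\<exists>r>0. plot_holo m r f)"
  using plot_holo_imp_conv_ps conv_ps_imp_plot_holo by metis

section \<open>First order estimates\<close>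

lemma deriv_bound:
  assumes "g holomorphic_on ball 0 r" "\<And>z. norm z < r \<Longrightarrow> norm (g z) \<le> B" "r > 0" "norm z \<le> r / 2"
  shows "norm (deriv g z) \<le> 4 * B / r"
proof -
  \<comment> \<open>A disc of radius \<open>r / 4\<close> about a point of norm at most
    \<open>r / 2\<close> stays in the domain; this radius is the source of the factor 4.\<close>
  have sub: "cball z (r / 4) \<subseteq> ball 0 r"
  proof
    fix w assume "w \<in> cball z (r / 4)"
    then have "norm (w - z) \<le> r / 4" by (simp add: dist_norm norm_minus_commute)
    then show "w \<in> ball 0 r" using assms(3,4) norm_triangle_ineq[of "w - z" z] by simp
  qed
  have "norm ((deriv ^^ 1) g z) \<le> fact 1 * B / (r / 4) ^ 1"
  proof (rule Cauchy_inequality)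
    show "g holomorphic_on ball z (r / 4)" "continuous_on (cball z (r / 4)) g"
      using assms(1) sub
      by (meson ball_subset_cball holomorphic_on_imp_continuous_on holomorphic_on_subset order_trans)+
    show "norm (g w) \<le> B" if "norm (z - w) = r / 4" for w
      using sub that by (intro assms(2)) (auto simp: dist_norm subset_iff)
  qed (use assms in auto)
  then show ?thesis by (simp add: field_simps)
qed

lemma holomorphic_lipschitz:
  assumes "g holomorphic_on ball 0 r" "\<And>z. norm z < r \<Longrightarrow> norm (g z) \<le> B" "r > 0"
    and "norm z \<le> r / 2" "norm w \<le> r / 2"
  shows "norm (g z - g w) \<le> 4 * B / r * norm (z - w)"
proof (rule field_differentiable_bound[where S = "cball 0 (r / 2)" and f' = "deriv g"])
  fix u :: complex assume u: "u \<in> cball 0 (r / 2)"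
  then have "u \<in> ball 0 r" using assms(3) by auto
  then show "(g has_field_derivative deriv g u) (at u within cball 0 (r / 2))"
    using assms(1) by (auto intro: holomorphic_derivI)
  show "norm (deriv g u) \<le> 4 * B / r"
    using deriv_bound[OF assms(1-3)] u by auto
qed (use assms in auto)

lemma plot_holo_coord_holomorphic:
  assumes "plot_holo m r f" "x \<in> polydisc m r"
  shows "(\<lambda>z. f (x(j := z))) holomorphic_on ball 0 r"
proof -
  have "(\<lambda>z. (x(j := z)) i) holomorphic_on ball 0 r" for i
    by (cases "i = j") (auto intro: holomorphic_intros)
  then show ?thesis
    using plot_holo_plot[OF assms(1), of "ball 0 r" "\<lambda>i z. (x(j := z)) i"] assms(2)
    by (auto simp: fun_upd_def polydisc_def)
qed

text \<open>Changing one coordinate at a time reduces a bound for increments to increments along the axes.\<close>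

lemma coordinatewise_increment_bound:
  fixes c :: "nat \<Rightarrow> complex"
  assumes step: "\<And>j x z w. j < m \<Longrightarrow> x \<in> polydisc m s \<Longrightarrow> norm z < s \<Longrightarrow> norm w < s \<Longrightarrow>
      norm (f (x(j := z)) - f (x(j := w)) - c j * (z - w)) \<le> K * norm (z - w)"
    and dep: "\<And>x y. x \<in> polydisc m s \<Longrightarrow> (\<And>i. i < m \<Longrightarrow> x i = y i) \<Longrightarrow> f x = (f y :: complex)"
    and xy: "x \<in> polydisc m s" "y \<in> polydisc m s"
  shows "norm (f x - f y - (\<Sum>j<m. c j * (x j - y j))) \<le> K * (\<Sum>j<m. norm (x j - y j))"
proof -
  define h where "h k i = (if i < k then x i else y i)" for k i :: nat
  have hd: "h k \<in> polydisc m s" for k using xy by (auto simp: h_def polydisc_def)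
  have "norm (f (h k) - f y - (\<Sum>j<k. c j * (x j - y j))) \<le> K * (\<Sum>j<k. norm (x j - y j))" if "k \<le> m" for k
    using that
  proof (induction k)
    case 0
    have "h 0 = y" by (auto simp: h_def)
    then show ?case by simp
  next
    case (Suc k)
    have h1: "(h k)(k := x k) = h (Suc k)" and h2: "(h k)(k := y k) = h k"
      by (auto simp: h_def fun_eq_iff less_Suc_eq)
    have xk: "norm (x k) < s" "norm (y k) < s" using xy Suc.prems by (auto simp: polydisc_def)
    have "norm (f (h (Suc k)) - f (h k) - c k * (x k - y k)) \<le> K * norm (x k - y k)"
      using step[OF _ hd xk, of k k] Suc.prems unfolding h1 h2 by simp
    with Suc show ?case
      using norm_triangle_ineq[of "f (h k) - f y - (\<Sum>j<k. c j * (x j - y j))" "f (h (Suc k)) - f (h k) - c k * (x k - y k)"]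
      by (simp add: algebra_simps)
  qed
  moreover have "f (h m) = f x" by (rule dep[OF hd]) (simp add: h_def)
  ultimately show ?thesis by fastforce
qed

lemma plot_holo_lipschitz:
  assumes "plot_holo m r f" "r > 0"
  obtains L where "L \<ge> 0" "\<And>x y. x \<in> polydisc m (r / 2) \<Longrightarrow> y \<in> polydisc m (r / 2) \<Longrightarrow>
    norm (f x - f y) \<le> L * (\<Sum>j<m. norm (x j - y j))"
proof -
  obtain B where B: "B > 0" "\<And>x. x \<in> polydisc m r \<Longrightarrow> norm (f x) \<le> B"
    using plot_holo_bound[OF assms(1)] by metis
  show thesis
  proof (rule that)
    show "4 * B / r \<ge> 0" using B(1) assms(2) by simp
    fix x y assume xy: "x \<in> polydisc m (r / 2)" "y \<in> polydisc m (r / 2)"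
    have *: "x \<in> polydisc m r" if "x \<in> polydisc m (r / 2)" for x
      using that assms(2) by (auto intro: polydisc_mono[of "r / 2"])
    have "norm (f x - f y - (\<Sum>j<m. 0 * (x j - y j))) \<le> 4 * B / r * (\<Sum>j<m. norm (x j - y j))"
    proof (rule coordinatewise_increment_bound[OF _ _ xy])
      fix j x and z w :: complex
      assume j: "j < m" "x \<in> polydisc m (r / 2)" "norm z < r / 2" "norm w < r / 2"
      have "norm (f (x(j := z)) - f (x(j := w))) \<le> 4 * B / r * norm (z - w)"
        by (rule holomorphic_lipschitz[OF plot_holo_coord_holomorphic[OF assms(1)]])
           (use j * assms(2) in \<open>auto intro!: B(2) simp: polydisc_def\<close>)
      then show "norm (f (x(j := z)) - f (x(j := w)) - 0 * (z - w)) \<le> 4 * B / r * norm (z - w)"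
        by simp
    qed (use plot_holo_cong[OF assms(1)] * in blast)
    then show "norm (f x - f y) \<le> 4 * B / r * (\<Sum>j<m. norm (x j - y j))" by simp
  qed
qed

definition pd0 :: "((nat \<Rightarrow> complex) \<Rightarrow> complex) \<Rightarrow> nat \<Rightarrow> complex" where
  "pd0 f j = deriv (\<lambda>z. f ((\<lambda>_. 0)(j := z))) 0"

lemma jac0_pd0: "jac0 \<sigma> i j = pd0 (\<sigma> i) j"
  by (simp add: jac0_def pd0_def)

text \<open>Along an axis through a point of the polydisc of radius \<open>s\<close>, the derivative
  differs from the one at the origin by at most a multiple of \<open>s\<close>. The factor
  \<open>s\<close> serves twice: it makes the error a small multiple of the increment in the
  contraction argument, and it raises the order of vanishing by one along curves.\<close>

lemma plot_holo_linear_approx: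
  assumes f: "plot_holo m r f" and r: "r > 0"
  obtains K where "K \<ge> 0" "\<And>s x y. 0 < s \<Longrightarrow> s \<le> r / 4 \<Longrightarrow> x \<in> polydisc m s \<Longrightarrow> y \<in> polydisc m s \<Longrightarrow>
    norm (f x - f y - (\<Sum>j<m. pd0 f j * (x j - y j))) \<le> K * s * (\<Sum>j<m. norm (x j - y j))"
proof -
  obtain B where B: "B > 0" "\<And>x. x \<in> polydisc m r \<Longrightarrow> norm (f x) \<le> B"
    using plot_holo_bound[OF f] by metis
  obtain L where L: "L \<ge> 0" "\<And>x y. x \<in> polydisc m (r / 2) \<Longrightarrow> y \<in> polydisc m (r / 2) \<Longrightarrow>
    norm (f x - f y) \<le> L * (\<Sum>j<m. norm (x j - y j))"
    using plot_holo_lipschitz[OF f r] by metis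
  \<comment> \<open>The first summand comes from moving the other coordinates to 0, which changes
    the function by at most \<open>L * m * s\<close> on a disc of radius \<open>r / 2\<close>; the
    second from moving the varying coordinate to 0.\<close>
  define K where "K = 8 * L * m / r + 32 * B / r\<^sup>2"
  show thesis
  proof (rule that)
    show "K \<ge> 0" using B(1) L(1) r by (simp add: K_def)
    fix s x y assume s: "0 < s" "s \<le> r / 4" and xy: "x \<in> polydisc m s" "y \<in> polydisc m s"
    show "norm (f x - f y - (\<Sum>j<m. pd0 f j * (x j - y j))) \<le> K * s * (\<Sum>j<m. norm (x j - y j))"
    proof (rule coordinatewise_increment_bound[OF _ _ xy])
      fix j x and z w :: complex
      assume j: "j < m" and x: "x \<in> polydisc m s" and zw: "norm z < s" "norm w < s"
      define F where "F z = f (x(j := z))" for z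
      define G where "G z = f ((\<lambda>_. 0)(j := z))" for z
      have xr: "x \<in> polydisc m r" by (rule polydisc_mono[OF _ _ x]) (use s r in auto)
      have 0: "(\<lambda>_. 0) \<in> polydisc m r" using r by (simp add: polydisc_def)
      have holF: "F holomorphic_on ball 0 r" and holG: "G holomorphic_on ball 0 r"
        unfolding F_def G_def by (rule plot_holo_coord_holomorphic[OF f]; fact)+
      have GB: "norm (G z) \<le> B" if "norm z < r" for z
        unfolding G_def using that r by (intro B(2)) (auto simp: polydisc_def)
      have FG: "norm (F z - G z) \<le> L * (m * s)" if "norm z < r / 2" for z
      proof -
        have "norm (F z - G z) \<le> L * (\<Sum>i<m. norm ((x(j := z)) i - ((\<lambda>_. 0)(j := z)) i))"
          unfolding F_def G_def
          by (rule L(2)) (use x s that r in \<open>auto simp: polydisc_def intro: less_le_trans\<close>)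
        also have "(\<Sum>i<m. norm ((x(j := z)) i - ((\<lambda>_. 0)(j := z)) i)) \<le> (\<Sum>i<m. s)"
          using x s by (intro sum_mono) (auto simp: polydisc_def intro: less_imp_le)
        finally show ?thesis using L(1) by (simp add: mult_left_mono)
      qed
      have holF': "F holomorphic_on ball 0 (r / 2)" and holG': "G holomorphic_on ball 0 (r / 2)"
        using holF holG r by (auto elim!: holomorphic_on_subset)
      have derivFG: "norm (deriv F u - deriv G 0) \<le> K * s" if u: "norm u < s" for u
      proof -
        have u': "u \<in> ball 0 (r / 2)" using u s by auto
        have "norm (deriv (\<lambda>z. F z - G z) u) \<le> 4 * (L * (m * s)) / (r / 2)"
          by (rule deriv_bound[OF _ FG]) (use u s r holF' holG' in \<open>auto intro: holomorphic_intros\<close>)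
        also have "deriv (\<lambda>z. F z - G z) u = deriv F u - deriv G u"
          using holF' holG' u' by (intro deriv_diff) (auto simp: holomorphic_on_imp_differentiable_at)
        finally have 1: "norm (deriv F u - deriv G u) \<le> 8 * L * m / r * s"
          using r by (simp add: field_simps)
        have "norm (deriv G u - deriv G 0) \<le> 4 * (4 * B / r) / (r / 2) * norm (u - 0)"
        proof (rule holomorphic_lipschitz)
          show "deriv G holomorphic_on ball 0 (r / 2)" by (rule holomorphic_deriv[OF holG']) simp
          show "norm (deriv G z) \<le> 4 * B / r" if "norm z < r / 2" for z
            using deriv_bound[OF holG GB r] that by simp
        qed (use u s r in auto)
        also have "\<dots> \<le> 32 * B / r\<^sup>2 * s"
          using u B(1) r mult_left_mono[of "norm u" s "32 * B / r\<^sup>2"] by (simp add: field_simps power2_eq_square)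
        finally have 2: "norm (deriv G u - deriv G 0) \<le> 32 * B / r\<^sup>2 * s" .
        have "norm (deriv F u - deriv G 0) \<le> norm (deriv F u - deriv G u) + norm (deriv G u - deriv G 0)"
          using norm_triangle_ineq[of "deriv F u - deriv G u" "deriv G u - deriv G 0"] by simp
        then show ?thesis using 1 2 by (simp add: K_def algebra_simps)
      qed
      have "norm ((F z - deriv G 0 * z) - (F w - deriv G 0 * w)) \<le> K * s * norm (z - w)"
      proof (rule field_differentiable_bound[where S = "ball 0 s" and f' = "\<lambda>u. deriv F u - deriv G 0"])
        fix u :: complex assume u: "u \<in> ball 0 s"
        have "(F has_field_derivative deriv F u) (at u)"
          by (rule holomorphic_derivI[OF holF]) (use u s r in auto)
        then have "(F has_field_derivative deriv F u) (at u within ball 0 s)"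
          by (rule has_field_derivative_at_within)
        then show "((\<lambda>u. F u - deriv G 0 * u) has_field_derivative deriv F u - deriv G 0) (at u within ball 0 s)"
          by (auto intro!: derivative_eq_intros)
        show "norm (deriv F u - deriv G 0) \<le> K * s" using derivFG u by simp
      qed (use zw in auto)
      moreover have "pd0 f j = deriv G 0"
        by (simp add: G_def[abs_def] pd0_def)
      ultimately show "norm (f (x(j := z)) - f (x(j := w)) - pd0 f j * (z - w)) \<le> K * s * norm (z - w)"
        by (simp add: F_def algebra_simps)
    next
      fix x y assume x: "x \<in> polydisc m s" "\<And>i. i < m \<Longrightarrow> x i = y i"
      have "x \<in> polydisc m r" by (rule polydisc_mono[OF _ _ x(1)]) (use s r in auto)
      then show "f x = f y" by (rule plot_holo_cong[OF f]) (rule x(2))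
    qed
  qed
qed

lemma common_radius:
  fixes P :: "nat \<Rightarrow> real \<Rightarrow> bool"
  assumes "\<And>i. i < k \<Longrightarrow> \<exists>r>0. P i r" "\<And>i r s. P i r \<Longrightarrow> 0 < s \<Longrightarrow> s \<le> r \<Longrightarrow> P i s"
  shows "\<exists>r>0. \<forall>i<k. P i r"
  using assms(1)
proof (induction k)
  case (Suc k)
  then obtain r s where r: "r > 0" "\<forall>i<k. P i r" and s: "s > 0" "P k s" by (meson lessI less_SucI)
  show ?case
    by (rule exI[of _ "min r s"]) (use r s in \<open>auto simp: less_Suc_eq intro: assms(2)\<close>)
qed (auto intro: exI[of _ 1])

lemma common_plot_holo:
  fixes k :: nat
  assumes "\<And>i. i < k \<Longrightarrow> f i \<in> conv_ps m"
  obtains r where "r > 0" "\<And>i. i < k \<Longrightarrow> plot_holo m r (f i)"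
proof -
  have "\<exists>r>0. \<forall>i<k. plot_holo m r (f i)"
    by (rule common_radius) (use assms in \<open>auto simp: conv_ps_iff intro: plot_holo_mono\<close>)
  then show thesis using that by blast
qed

lemma common_linear_approx:
  fixes k :: nat
  assumes "\<And>i. i < k \<Longrightarrow> plot_holo m r (f i)" "r > 0"
  obtains K where "K \<ge> 0" "\<And>i s x y. i < k \<Longrightarrow> 0 < s \<Longrightarrow> s \<le> r / 4 \<Longrightarrow> x \<in> polydisc m s \<Longrightarrow> y \<in> polydisc m s \<Longrightarrow>
    norm (f i x - f i y - (\<Sum>j<m. pd0 (f i) j * (x j - y j))) \<le> K * s * (\<Sum>j<m. norm (x j - y j))"
proof -
  define Q where "Q i K \<longleftrightarrow> K \<ge> 0 \<and> (\<forall>s x y. 0 < s \<longrightarrow> s \<le> r / 4 \<longrightarrow> x \<in> polydisc m s \<longrightarrow> y \<in> polydisc m s \<longrightarrow>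
    norm (f i x - f i y - (\<Sum>j<m. pd0 (f i) j * (x j - y j))) \<le> K * s * (\<Sum>j<m. norm (x j - y j)))" for i K
  have "\<exists>K. Q i K" if "i < k" for i
  proof -
    from plot_holo_linear_approx[OF assms(1)[OF that] assms(2)] obtain K where "K \<ge> 0"
      "\<And>s x y. 0 < s \<Longrightarrow> s \<le> r / 4 \<Longrightarrow> x \<in> polydisc m s \<Longrightarrow> y \<in> polydisc m s \<Longrightarrow>
        norm (f i x - f i y - (\<Sum>j<m. pd0 (f i) j * (x j - y j))) \<le> K * s * (\<Sum>j<m. norm (x j - y j))"
      by blast
    then have "Q i K" unfolding Q_def by blast
    then show ?thesis ..
  qed
  then obtain K where K: "\<And>i. i < k \<Longrightarrow> Q i (K i)" by metis
  define M where "M = (\<Sum>i<k. K i)"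
  have KM: "K i \<le> M" if "i < k" for i
    unfolding M_def using K that by (intro member_le_sum) (auto simp: Q_def)
  show thesis
  proof (rule that)
    show "M \<ge> 0" unfolding M_def using K by (intro sum_nonneg) (auto simp: Q_def)
    fix i s x y assume *: "i < k" "0 < s" "s \<le> r / 4" "x \<in> polydisc m s" "y \<in> polydisc m s"
    then have "norm (f i x - f i y - (\<Sum>j<m. pd0 (f i) j * (x j - y j))) \<le> K i * s * (\<Sum>j<m. norm (x j - y j))"
      using K[OF *(1)] unfolding Q_def by blast
    also have "\<dots> \<le> M * s * (\<Sum>j<m. norm (x j - y j))"
      using KM * by (intro mult_right_mono sum_nonneg) auto
    finally show "norm (f i x - f i y - (\<Sum>j<m. pd0 (f i) j * (x j - y j))) \<le> M * s * (\<Sum>j<m. norm (x j - y j))" .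
  qed
qed

section \<open>The inverse function theorem for unipotent germs\<close>

definition wnorm :: "nat \<Rightarrow> real \<Rightarrow> (nat \<Rightarrow> complex) \<Rightarrow> real" where
  "wnorm m A d = (\<Sum>i<m. A ^ i * norm (d i))"

lemma wnorm_nonneg: "A \<ge> 0 \<Longrightarrow> wnorm m A d \<ge> 0"
  by (simp add: wnorm_def sum_nonneg)

lemma wnorm_triangle:
  assumes "A \<ge> 0"
  shows "wnorm m A (\<lambda>i. x i + y i) \<le> wnorm m A x + wnorm m A y"
  unfolding wnorm_def sum.distrib[symmetric]
proof (rule sum_mono)
  fix i
  show "A ^ i * norm (x i + y i) \<le> A ^ i * norm (x i) + A ^ i * norm (y i)"
    using mult_left_mono[OF norm_triangle_ineq[of "x i" "y i"], of "A ^ i"] assms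
    by (simp add: algebra_simps)
qed

lemma norm_le_wnorm:
  assumes "A \<ge> 1" "i < m"
  shows "norm (d i) \<le> wnorm m A d"
proof -
  have "norm (d i) \<le> A ^ i * norm (d i)"
    using assms(1) mult_right_mono[OF one_le_power[OF assms(1)], of "norm (d i)" i] by simp
  also have "\<dots> \<le> wnorm m A d"
    unfolding wnorm_def using assms by (intro member_le_sum) auto
  finally show ?thesis .
qed

lemma sum_le_wnorm:
  assumes "A \<ge> 1"
  shows "(\<Sum>i<m. norm (d i)) \<le> wnorm m A d"
  unfolding wnorm_def
proof (rule sum_mono)
  show "norm (d i) \<le> A ^ i * norm (d i)" for i
    using mult_right_mono[OF one_le_power[OF assms], of "norm (d i)" i] by simp
qed

text \<open>
  The weights \<open>A ^ i\<close> make a strictly upper triangular linear part contracting, so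
  \<open>x \<mapsto> \<sigma> x - x\<close> is a contraction near the origin although its linear part need not be small.
\<close>

lemma unipotent_contraction:
  fixes \<sigma> :: "nat \<Rightarrow> (nat \<Rightarrow> complex) \<Rightarrow> complex"
  assumes \<sigma>: "\<And>i. i < m \<Longrightarrow> plot_holo m r (\<sigma> i)" and r: "r > 0"
    and jac: "\<And>i. i < m \<Longrightarrow> jac0 \<sigma> i i = 1" "\<And>i j. i < m \<Longrightarrow> j < i \<Longrightarrow> jac0 \<sigma> i j = 0"
  obtains A s where "A \<ge> 1" "0 < s" "s < r"
    "\<And>x y. x \<in> polydisc m s \<Longrightarrow> y \<in> polydisc m s \<Longrightarrow>
      wnorm m A (\<lambda>i. (\<sigma> i x - x i) - (\<sigma> i y - y i)) \<le> wnorm m A (\<lambda>i. x i - y i) / 2"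
proof -
  obtain K where K: "K \<ge> 0" "\<And>i s x y. i < m \<Longrightarrow> 0 < s \<Longrightarrow> s \<le> r / 4 \<Longrightarrow> x \<in> polydisc m s \<Longrightarrow> y \<in> polydisc m s \<Longrightarrow>
    norm (\<sigma> i x - \<sigma> i y - (\<Sum>j<m. pd0 (\<sigma> i) j * (x j - y j))) \<le> K * s * (\<Sum>j<m. norm (x j - y j))"
    using common_linear_approx[of m m r \<sigma>, OF \<sigma> r] by blast
  define C where "C = 1 + (\<Sum>i<m. \<Sum>j<m. norm (jac0 \<sigma> i j))"
  have C0: "C \<ge> 1" by (simp add: C_def sum_nonneg)
  have C: "norm (jac0 \<sigma> i j) \<le> C" if "i < m" "j < m" for i j
  proof -
    have "norm (jac0 \<sigma> i j) \<le> (\<Sum>j<m. norm (jac0 \<sigma> i j))"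
      using that by (intro member_le_sum) auto
    also have "\<dots> \<le> (\<Sum>i<m. \<Sum>j<m. norm (jac0 \<sigma> i j))"
      using that by (intro member_le_sum[where f = "\<lambda>i. \<Sum>j<m. norm (jac0 \<sigma> i j)"]) (auto intro: sum_nonneg)
    finally show ?thesis by (simp add: C_def)
  qed
  \<comment> \<open>With this \<open>A\<close>,
    \<open>4 * C * (1 + A + ... + A^(j - 1)) = A^j - 1\<close>, so the entries above the diagonal in
    column \<open>j\<close> cost at most a quarter of its weight.\<close>
  define A where "A = 1 + 4 * C"
  have A: "A \<ge> 1" using C0 by (simp add: A_def)
  have geo: "C * (\<Sum>i<j. A ^ i) \<le> A ^ j / 4" for j
  proof -
    have "4 * C * (\<Sum>i<j. A ^ i) = A ^ j - 1"
      by (induction j) (auto simp: A_def algebra_simps)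
    then show ?thesis by simp
  qed
  define S where "S = (\<Sum>i<m. A ^ i)"
  have S: "S \<ge> 0" using A by (simp add: S_def sum_nonneg)
  \<comment> \<open>Chosen so that the remainder beyond the linear part costs at most another
    quarter.\<close>
  define s where "s = min (r / 4) (1 / (4 * (K * S + 1)))"
  have KS: "K * S \<ge> 0" using K(1) S by simp
  have s: "s > 0" "s \<le> r / 4" using r KS by (auto simp: s_def)
  have sKS: "s * (K * S) \<le> 1 / 4"
  proof -
    have "s * (K * S) \<le> 1 / (4 * (K * S + 1)) * (K * S)"
      using KS by (intro mult_right_mono) (auto simp: s_def)
    also have "\<dots> \<le> 1 / 4" using KS by (simp add: field_simps)
    finally show ?thesis .
  qed
  show thesis
  proof (rule that[OF A s(1)])
    show "s < r" using s r by simp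
    fix x y assume xy: "x \<in> polydisc m s" "y \<in> polydisc m s"
    define d where "d j = norm (x j - y j)" for j
    define D where "D = (\<Sum>j<m. d j)"
    have D0: "D \<ge> 0" by (simp add: D_def d_def sum_nonneg)
    have h: "norm ((\<sigma> i x - x i) - (\<sigma> i y - y i)) \<le> (\<Sum>j<m. if i < j then C * d j else 0) + K * s * D" if i: "i < m" for i
    proof -
      \<comment> \<open>The diagonal entry cancels against \<open>x i - y i\<close> and the entries
        below it vanish, so only the strict upper triangle remains.\<close>
      have "(\<Sum>j<m. jac0 \<sigma> i j * (x j - y j)) = (\<Sum>j<m. (if j = i then x i - y i else 0) + (if i < j then jac0 \<sigma> i j * (x j - y j) else 0))"
        using jac i by (intro sum.cong) (auto simp: not_less dest: le_imp_less_or_eq)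
      also have "\<dots> = x i - y i + (\<Sum>j<m. if i < j then jac0 \<sigma> i j * (x j - y j) else 0)"
        using i by (simp add: sum.distrib)
      finally have eq: "(\<sigma> i x - x i) - (\<sigma> i y - y i) =
         (\<Sum>j<m. if i < j then jac0 \<sigma> i j * (x j - y j) else 0) +
         (\<sigma> i x - \<sigma> i y - (\<Sum>j<m. pd0 (\<sigma> i) j * (x j - y j)))"
        by (simp add: jac0_pd0)
      have "norm (\<Sum>j<m. if i < j then jac0 \<sigma> i j * (x j - y j) else 0) \<le> (\<Sum>j<m. if i < j then C * d j else 0)"
        by (rule sum_norm_le) (use C i in \<open>auto simp: norm_mult d_def intro!: mult_right_mono\<close>)
      moreover have "norm (\<sigma> i x - \<sigma> i y - (\<Sum>j<m. pd0 (\<sigma> i) j * (x j - y j))) \<le> K * s * D"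
        using K(2)[OF i s xy] by (simp add: D_def d_def)
      ultimately show ?thesis unfolding eq by (meson add_mono norm_triangle_le)
    qed
    have "wnorm m A (\<lambda>i. (\<sigma> i x - x i) - (\<sigma> i y - y i))
        \<le> (\<Sum>i<m. A ^ i * ((\<Sum>j<m. if i < j then C * d j else 0) + K * s * D))"
      unfolding wnorm_def using A by (intro sum_mono mult_left_mono h) auto
    also have "\<dots> = (\<Sum>i<m. \<Sum>j<m. if i < j then A ^ i * C * d j else 0) + (\<Sum>i<m. A ^ i) * (K * s * D)"
      unfolding distrib_left sum.distrib sum_distrib_right sum_distrib_left
      by (intro arg_cong2[where f = "(+)"] sum.cong) (auto simp: mult_ac)
    \<comment> \<open>Summed by columns, the weights \<open>A^i\<close> with \<open>i < j\<close>
      can be compared with \<open>A^j\<close>, the weight of \<open>d j\<close>.\<close>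
    also have "(\<Sum>i<m. \<Sum>j<m. if i < j then A ^ i * C * d j else 0) = (\<Sum>j<m. \<Sum>i<m. if i < j then A ^ i * C * d j else 0)"
      by (rule sum.swap)
    also have "\<dots> = (\<Sum>j<m. C * (\<Sum>i<j. A ^ i) * d j)"
    proof (rule sum.cong[OF refl])
      fix j assume j: "j \<in> {..<m}"
      have "(\<Sum>i<m. if i < j then A ^ i * C * d j else 0) = (\<Sum>i\<in>{..<m} \<inter> {i. i < j}. A ^ i * C * d j)"
        by (simp add: sum.inter_restrict)
      also have "{..<m} \<inter> {i. i < j} = {..<j}" using j by auto
      finally show "(\<Sum>i<m. if i < j then A ^ i * C * d j else 0) = C * (\<Sum>i<j. A ^ i) * d j"
        by (simp add: sum_distrib_left sum_distrib_right mult_ac)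
    qed
    also have "\<dots> \<le> (\<Sum>j<m. A ^ j / 4 * d j)"
      by (intro sum_mono mult_right_mono geo) (simp add: d_def)
    also have "\<dots> = wnorm m A (\<lambda>i. x i - y i) / 4"
      by (simp add: wnorm_def d_def sum_divide_distrib)
    also have "(\<Sum>i<m. A ^ i) * (K * s * D) = s * (K * S) * D" by (simp add: S_def)
    also have "\<dots> \<le> 1 / 4 * D" by (rule mult_right_mono[OF sKS D0])
    also have "\<dots> \<le> wnorm m A (\<lambda>i. x i - y i) / 4"
      using sum_le_wnorm[OF A, of "\<lambda>i. x i - y i" m] by (simp add: D_def d_def)
    finally show "wnorm m A (\<lambda>i. (\<sigma> i x - x i) - (\<sigma> i y - y i)) \<le> wnorm m A (\<lambda>i. x i - y i) / 2"
      by simp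
  qed
qed

text \<open>The value of the inverse at \<open>x\<close> is the fixed point of
  \<open>y \<mapsto> x - h y\<close> with \<open>h = \<sigma> - id\<close>, which halves weighted
  distances. The iterates are germs by composition and converge uniformly in \<open>x\<close>, so
  the fixed point is again a germ.\<close>

lemma Diff_space_unipotent:
  fixes \<sigma> :: "nat \<Rightarrow> (nat \<Rightarrow> complex) \<Rightarrow> complex"
  assumes conv: "\<And>i. i < m \<Longrightarrow> \<sigma> i \<in> conv_ps m" and \<sigma>0: "\<And>i. i < m \<Longrightarrow> \<sigma> i (\<lambda>_. 0) = 0"
    and jac: "\<And>i. i < m \<Longrightarrow> jac0 \<sigma> i i = 1" "\<And>i j. i < m \<Longrightarrow> j < i \<Longrightarrow> jac0 \<sigma> i j = 0"
  shows "\<sigma> \<in> Diff_space m"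
proof -
  obtain r where r: "r > 0" and ph: "\<And>i. i < m \<Longrightarrow> plot_holo m r (\<sigma> i)"
    using common_plot_holo[of m \<sigma> m, OF conv] by blast
  obtain A s where A: "A \<ge> 1" and s: "0 < s" "s < r" and contr:
    "\<And>x y. x \<in> polydisc m s \<Longrightarrow> y \<in> polydisc m s \<Longrightarrow>
      wnorm m A (\<lambda>i. (\<sigma> i x - x i) - (\<sigma> i y - y i)) \<le> wnorm m A (\<lambda>i. x i - y i) / 2"
    using unipotent_contraction[of m r \<sigma>, OF ph r jac] by blast
  define h where "h i x = \<sigma> i x - x i" for i x
  define S where "S = (\<Sum>i<m. A ^ i)"
  have S: "S \<ge> 0" using A by (simp add: S_def sum_nonneg)
  have wn: "wnorm m A x \<ge> 0" for x using A by (simp add: wnorm_nonneg)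
  have w_le: "wnorm m A x \<le> e * S" if "x \<in> polydisc m e" for x e
    unfolding wnorm_def S_def sum_distrib_left
    using that A by (intro sum_mono) (auto simp: polydisc_def mult.commute intro!: mult_left_mono less_imp_le)
  have w_disc: "x \<in> polydisc m e" if "wnorm m A x < e" for x e
    using that norm_le_wnorm[OF A] by (auto simp: polydisc_def intro: le_less_trans)
  \<comment> \<open>On this polydisc the weighted norm of \<open>x\<close> is at most
    \<open>s / 4\<close>; the iterates stay below twice that, inside the domain of the
    contraction.\<close>
  define \<delta> where "\<delta> = min s (s / (4 * (S + 1)))"
  have \<delta>: "\<delta> > 0" "\<delta> \<le> s" using s S by (auto simp: \<delta>_def)
  have \<delta>S: "e * S \<le> s / 4" if "0 < e" "e \<le> \<delta>" for e
  proof -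
    have "e * S \<le> s / (4 * (S + 1)) * S" using that S by (intro mult_right_mono) (auto simp: \<delta>_def)
    also have "\<dots> \<le> s / 4" using s S by (simp add: field_simps)
    finally show ?thesis .
  qed
  have zero: "(\<lambda>_. 0) \<in> polydisc m s" using s by (simp add: polydisc_def)
  have h0: "h i (\<lambda>_. 0) = 0" if "i < m" for i using \<sigma>0[OF that] by (simp add: h_def)
  have contr': "wnorm m A (\<lambda>i. h i x - h i y) \<le> wnorm m A (\<lambda>i. x i - y i) / 2"
    if "x \<in> polydisc m s" "y \<in> polydisc m s" for x y
    using contr[OF that] by (simp add: h_def)
  have h_half: "wnorm m A (\<lambda>i. h i x) \<le> wnorm m A x / 2" if "x \<in> polydisc m s" for x
    using contr'[OF that zero] h0 by (simp add: wnorm_def)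
  define y where "y n x = ((\<lambda>y i. x i - h i y) ^^ n) (\<lambda>_. 0)" for n x
  have y_0: "y 0 x = (\<lambda>_. 0)" and y_Suc: "y (Suc n) x = (\<lambda>i. x i - h i (y n x))" for n x
    by (simp_all add: y_def)
  have y_le: "wnorm m A (y n x) \<le> 2 * wnorm m A x \<and> y n x \<in> polydisc m s" if x: "x \<in> polydisc m \<delta>" for n x
  proof (induction n)
    case 0
    then show ?case using wn[of x] zero by (simp add: y_0 wnorm_def)
  next
    case (Suc n)
    have "wnorm m A (y (Suc n) x) \<le> wnorm m A x + wnorm m A (\<lambda>i. - h i (y n x))"
      using wnorm_triangle[of A m x "\<lambda>i. - h i (y n x)"] A by (simp add: y_Suc)
    also have "wnorm m A (\<lambda>i. - h i (y n x)) = wnorm m A (\<lambda>i. h i (y n x))" by (simp add: wnorm_def)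
    also have "\<dots> \<le> wnorm m A (y n x) / 2" using Suc by (intro h_half) auto
    finally have "wnorm m A (y (Suc n) x) \<le> 2 * wnorm m A x" using Suc by simp
    moreover have "wnorm m A x \<le> s / 4" using w_le[OF x] \<delta>S[of \<delta>] \<delta> by simp
    ultimately show ?case using s by (auto intro!: w_disc)
  qed
  have y_diff: "wnorm m A (\<lambda>i. y (Suc n) x i - y n x i) \<le> s / 4 * (1 / 2) ^ n" if x: "x \<in> polydisc m \<delta>" for n x
  proof (induction n)
    case 0
    have "wnorm m A (\<lambda>i. y (Suc 0) x i - y 0 x i) = wnorm m A x"
      using h0 by (simp add: y_Suc y_0 wnorm_def)
    then show ?case using w_le[OF x] \<delta>S[of \<delta>] \<delta> by simp
  next
    case (Suc n)
    have "wnorm m A (\<lambda>i. y (Suc (Suc n)) x i - y (Suc n) x i) = wnorm m A (\<lambda>i. h i (y (Suc n) x) - h i (y n x))"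
      unfolding wnorm_def y_Suc[of "Suc n"] by (subst y_Suc) (simp add: norm_minus_commute)
    also have "\<dots> \<le> wnorm m A (\<lambda>i. y (Suc n) x i - y n x i) / 2"
      using y_le[OF x] by (intro contr') auto
    finally show ?case using Suc by simp
  qed
  have y_holo: "plot_holo m \<delta> (\<lambda>x. y n x i)" if "i < m" for n i
    using that
  proof (induction n arbitrary: i)
    case 0
    then show ?case by (simp add: y_0 plot_holo_const)
  next
    case (Suc n)
    have "plot_holo m s (h i)"
      unfolding h_def using s Suc.prems
      by (intro plot_holo_diff plot_holo_coord plot_holo_mono[OF ph]) auto
    then have "plot_holo m \<delta> (\<lambda>x. h i (\<lambda>i. y n x i))"
      by (rule plot_holo_compose) (use Suc.IH y_le in auto)
    then show ?case
      unfolding y_Suc using Suc.prems by (intro plot_holo_diff plot_holo_coord) auto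
  qed
  \<comment> \<open>Written as a telescoping series so that the Weierstrass test applies.\<close>
  define \<tau> where "\<tau> i x = (\<Sum>n. y (Suc n) x i - y n x i)" for i x
  have uni: "uniform_limit (polydisc m \<delta>) (\<lambda>n x. y n x i) (\<tau> i) sequentially" if "i < m" for i
  proof -
    have "uniform_limit (polydisc m \<delta>) (\<lambda>n x. \<Sum>k<n. y (Suc k) x i - y k x i) (\<lambda>x. \<Sum>n. y (Suc n) x i - y n x i) sequentially"
    proof (rule Weierstrass_m_test)
      show "norm (y (Suc n) x i - y n x i) \<le> s / 4 * (1 / 2) ^ n" if "x \<in> polydisc m \<delta>" for n x
        using norm_le_wnorm[OF A \<open>i < m\<close>, of "\<lambda>i. y (Suc n) x i - y n x i"] y_diff[OF that, of n] by simp
      show "summable (\<lambda>n. s / 4 * (1 / 2) ^ n)" by (intro summable_mult summable_geometric) simp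
    qed
    moreover have "(\<Sum>k<n. y (Suc k) x i - y k x i) = y n x i" for n x
      using sum_lessThan_telescope[of "\<lambda>k. y k x i" n] by (simp add: y_0)
    ultimately show ?thesis by (simp add: \<tau>_def[abs_def])
  qed
  have lim: "(\<lambda>n. y n x i) \<longlonglongrightarrow> \<tau> i x" if "i < m" "x \<in> polydisc m \<delta>" for i x
    using tendsto_uniform_limitI[OF uni] that by blast
  have \<tau>_holo: "plot_holo m \<delta> (\<tau> i)" if "i < m" for i
  proof (rule plot_holo_uniform_limit[OF y_holo[OF that] uni[OF that]])
    show "\<tau> i x = \<tau> i z" if "x \<in> polydisc m \<delta>" "\<And>j. j < m \<Longrightarrow> x j = z j" for x z
      unfolding \<tau>_def using plot_holo_cong[OF y_holo[OF \<open>i < m\<close>] that] by simp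
  qed
  have \<tau>_le: "wnorm m A (\<lambda>i. \<tau> i x) \<le> 2 * wnorm m A x" if "x \<in> polydisc m \<delta>" for x
  proof (rule LIMSEQ_le_const2)
    show "(\<lambda>n. wnorm m A (y n x)) \<longlonglongrightarrow> wnorm m A (\<lambda>i. \<tau> i x)"
      unfolding wnorm_def by (intro tendsto_intros lim that) auto
  qed (use y_le[OF that] in auto)
  have \<tau>_disc: "(\<lambda>i. \<tau> i x) \<in> polydisc m s" if "x \<in> polydisc m \<delta>" for x
    using \<tau>_le[OF that] w_le[OF that] \<delta>S[of \<delta>] \<delta> s by (intro w_disc) simp
  have fixpoint: "\<tau> i x = x i - h i (\<lambda>j. \<tau> j x)" if i: "i < m" and x: "x \<in> polydisc m \<delta>" for i x
  proof -
    have "(\<lambda>n. wnorm m A (\<lambda>i. y n x i - \<tau> i x)) \<longlonglongrightarrow> wnorm m A (\<lambda>i. \<tau> i x - \<tau> i x)"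
      unfolding wnorm_def by (intro tendsto_intros lim x) auto
    then have w0: "(\<lambda>n. wnorm m A (\<lambda>i. y n x i - \<tau> i x)) \<longlonglongrightarrow> 0" by (simp add: wnorm_def)
    have "(\<lambda>n. h i (y n x) - h i (\<lambda>j. \<tau> j x)) \<longlonglongrightarrow> 0"
    proof (rule tendsto_0_le[OF w0, where K = 1], rule always_eventually, rule allI)
      fix n
      have "norm (h i (y n x) - h i (\<lambda>j. \<tau> j x)) \<le> wnorm m A (\<lambda>i. h i (y n x) - h i (\<lambda>j. \<tau> j x))"
        by (rule norm_le_wnorm[OF A i])
      also have "\<dots> \<le> wnorm m A (\<lambda>i. y n x i - \<tau> i x) / 2"
        using y_le[OF x] \<tau>_disc[OF x] by (intro contr') auto
      finally show "norm (h i (y n x) - h i (\<lambda>j. \<tau> j x)) \<le> norm (wnorm m A (\<lambda>i. y n x i - \<tau> i x)) * 1"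
        using wn[of "\<lambda>i. y n x i - \<tau> i x"] by simp
    qed
    then have "(\<lambda>n. h i (y n x)) \<longlonglongrightarrow> h i (\<lambda>j. \<tau> j x)" by (simp add: LIM_zero_iff)
    then have "(\<lambda>n. y (Suc n) x i) \<longlonglongrightarrow> x i - h i (\<lambda>j. \<tau> j x)"
      unfolding y_Suc by (intro tendsto_intros)
    moreover have "(\<lambda>n. y (Suc n) x i) \<longlonglongrightarrow> \<tau> i x" using lim[OF i x] by (rule LIMSEQ_Suc)
    ultimately show ?thesis using LIMSEQ_unique by blast
  qed
  \<comment> \<open>Since \<open>\<sigma>\<close> enlarges the weighted norm at most by the factor
    3/2, it maps this polydisc into the domain of \<open>\<tau>\<close>.\<close>
  define \<eta> where "\<eta> = min \<delta> (\<delta> / (4 * (S + 1)))"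
  have \<eta>: "\<eta> > 0" "\<eta> \<le> \<delta>" using \<delta> S by (auto simp: \<eta>_def)
  have \<eta>S: "\<eta> * S \<le> \<delta> / 4"
  proof -
    have "\<eta> * S \<le> \<delta> / (4 * (S + 1)) * S" using S by (intro mult_right_mono) (auto simp: \<eta>_def)
    also have "\<dots> \<le> \<delta> / 4" using \<delta> S by (simp add: field_simps)
    finally show ?thesis .
  qed
  have right: "\<sigma> i (\<lambda>j. \<tau> j x) = x i" if "i < m" "x \<in> polydisc m \<delta>" for i x
    using fixpoint[OF that] by (simp add: h_def)
  have left: "\<tau> i (\<lambda>j. \<sigma> j x) = x i" if i: "i < m" and x: "x \<in> polydisc m \<eta>" for i x
  proof -
    define p where "p = (\<lambda>j. \<sigma> j x)"
    have xs: "x \<in> polydisc m s" by (rule polydisc_mono[OF _ _ x]) (use \<eta> \<delta> in auto)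
    have px: "p j = x j + h j x" for j by (simp add: p_def h_def)
    have "wnorm m A p \<le> wnorm m A x + wnorm m A x / 2"
      using wnorm_triangle[of A m x "\<lambda>j. h j x"] h_half[OF xs] A by (simp add: px[abs_def])
    then have p: "p \<in> polydisc m \<delta>"
      using w_le[OF x] \<eta>S \<delta> by (intro w_disc) simp
    \<comment> \<open>Both \<open>x\<close> and \<open>\<tau> p\<close> solve the fixed point
      equation for \<open>p\<close>, so their distance is at most half of itself.\<close>
    have "wnorm m A (\<lambda>i. \<tau> i p - x i) = wnorm m A (\<lambda>i. h i x - h i (\<lambda>j. \<tau> j p))"
      unfolding wnorm_def using fixpoint[OF _ p] by (intro sum.cong) (auto simp: px)
    also have "\<dots> \<le> wnorm m A (\<lambda>i. x i - \<tau> i p) / 2" by (rule contr'[OF xs \<tau>_disc[OF p]])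
    also have "wnorm m A (\<lambda>i. x i - \<tau> i p) = wnorm m A (\<lambda>i. \<tau> i p - x i)"
      by (simp add: wnorm_def norm_minus_commute)
    finally have "wnorm m A (\<lambda>i. \<tau> i p - x i) \<le> 0" by simp
    then have "norm (\<tau> i p - x i) \<le> 0" using norm_le_wnorm[OF A i, of "\<lambda>i. \<tau> i p - x i"] by linarith
    then show ?thesis by (simp add: p_def)
  qed
  have \<tau>0: "\<tau> i (\<lambda>_. 0) = 0" if "i < m" for i
  proof -
    have "wnorm m A (\<lambda>i. \<tau> i (\<lambda>_. 0)) \<le> 0"
      using \<tau>_le[of "\<lambda>_. 0"] \<delta> by (simp add: polydisc_def wnorm_def)
    then show ?thesis using norm_le_wnorm[OF A that, of "\<lambda>i. \<tau> i (\<lambda>_. 0)"] by (simp flip: norm_le_zero_iff)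
  qed
  show ?thesis
    unfolding Diff_space_def near0_polydisc
  proof (intro CollectI conjI exI[of _ \<tau>] exI[of _ \<eta>] ballI allI impI)
    fix i x assume i: "i < m" and x: "x \<in> polydisc m \<eta>"
    show "\<sigma> i (\<lambda>j. \<tau> j x) = x i"
      by (rule right[OF i polydisc_mono[OF _ _ x]]) (use \<eta> in auto)
    show "\<tau> i (\<lambda>j. \<sigma> j x) = x i" by (rule left[OF i x])
  qed (use conv \<sigma>0 \<tau>0 plot_holo_imp_conv_ps[OF \<tau>_holo \<delta>(1)] \<eta> in auto)
qed

section \<open>Pulling back along a parametrization\<close>

lemma near0_mono: "near0 m P \<Longrightarrow> m \<le> k \<Longrightarrow> (\<And>x. P x \<Longrightarrow> Q x) \<Longrightarrow> near0 k Q"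
  unfolding near0_polydisc by (meson order_refl polydisc_mono)

lemma near0_conj:
  assumes "near0 m P" "near0 m Q"
  shows "near0 m (\<lambda>x. P x \<and> Q x)"
proof -
  obtain r s where "r > 0" "\<forall>x\<in>polydisc m r. P x" "s > 0" "\<forall>x\<in>polydisc m s. Q x"
    using assms by (auto simp: near0_polydisc)
  then show ?thesis
    unfolding near0_polydisc by (intro exI[of _ "min r s"]) (auto simp: polydisc_def)
qed

lemma near0_all_less:
  fixes k :: nat
  assumes "\<And>i. i < k \<Longrightarrow> near0 m (P i)"
  shows "near0 m (\<lambda>x. \<forall>i<k. P i x)"
proof -
  have "\<exists>r>0. \<forall>i<k. \<forall>x\<in>polydisc m r. P i x"
    by (rule common_radius, use assms in \<open>simp add: near0_polydisc\<close>, meson order_refl polydisc_mono)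
  then show ?thesis unfolding near0_polydisc by blast
qed

lemma conv_ps_mono: "f \<in> conv_ps m \<Longrightarrow> m \<le> k \<Longrightarrow> f \<in> conv_ps k"
  by (auto simp: conv_ps_iff intro: plot_holo_mono)

lemma conv_ps_const [simp]: "(\<lambda>_. c) \<in> conv_ps m"
  unfolding conv_ps_iff by (intro exI[of _ 1] conjI plot_holo_const zero_less_one)

lemma conv_ps_coord: "i < m \<Longrightarrow> (\<lambda>x. x i) \<in> conv_ps m"
  unfolding conv_ps_iff by (intro exI[of _ 1] conjI plot_holo_coord zero_less_one)

lemma conv_ps_common:
  assumes "f \<in> conv_ps m" "g \<in> conv_ps m"
  obtains r where "r > 0" "plot_holo m r f" "plot_holo m r g"
proof -
  obtain r s where "r > 0" "plot_holo m r f" "s > 0" "plot_holo m s g"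
    using assms by (auto simp: conv_ps_iff)
  then show thesis
    by (intro that[of "min r s"]) (auto intro: plot_holo_mono)
qed

lemma conv_ps_add: "f \<in> conv_ps m \<Longrightarrow> g \<in> conv_ps m \<Longrightarrow> (\<lambda>x. f x + g x) \<in> conv_ps m"
  by (erule conv_ps_common, assumption) (auto intro: plot_holo_add plot_holo_imp_conv_ps)

lemma conv_ps_diff: "f \<in> conv_ps m \<Longrightarrow> g \<in> conv_ps m \<Longrightarrow> (\<lambda>x. f x - g x) \<in> conv_ps m"
  by (erule conv_ps_common, assumption) (auto intro: plot_holo_diff plot_holo_imp_conv_ps)

lemma conv_ps_mult: "f \<in> conv_ps m \<Longrightarrow> g \<in> conv_ps m \<Longrightarrow> (\<lambda>x. f x * g x) \<in> conv_ps m"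
  by (erule conv_ps_common, assumption) (auto intro: plot_holo_mult plot_holo_imp_conv_ps)

lemma conv_ps_sum: "(\<And>i. i \<in> A \<Longrightarrow> f i \<in> conv_ps m) \<Longrightarrow> (\<lambda>x. \<Sum>i\<in>A. f i x) \<in> conv_ps m"
  by (induction A rule: infinite_finite_induct) (auto intro: conv_ps_add)

lemma conv_ps_small:
  assumes "g \<in> conv_ps m" "g (\<lambda>_. 0) = 0" "s > 0"
  shows "\<exists>r>0. \<forall>x\<in>polydisc m r. norm (g x) < s"
proof -
  obtain r where r: "r > 0" "plot_holo m r g" using assms(1) by (auto simp: conv_ps_iff)
  obtain L where L: "L \<ge> 0" "\<And>x y. x \<in> polydisc m (r / 2) \<Longrightarrow> y \<in> polydisc m (r / 2) \<Longrightarrow>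
    norm (g x - g y) \<le> L * (\<Sum>j<m. norm (x j - y j))"
    using plot_holo_lipschitz[OF r(2,1)] by blast
  define e where "e = min (r / 2) (s / (2 * (L * m + 1)))"
  have Lm: "L * m \<ge> 0" using L(1) by simp
  show ?thesis
  proof (intro exI[of _ e] conjI ballI)
    show e: "e > 0" using r(1) assms(3) Lm by (simp add: e_def)
    fix x assume x: "x \<in> polydisc m e"
    have "norm (g x - g (\<lambda>_. 0)) \<le> L * (\<Sum>j<m. norm (x j - 0))"
      by (rule L(2)) (use x r in \<open>auto simp: polydisc_def e_def\<close>)
    also have "\<dots> \<le> L * (\<Sum>j<m. e)"
      using x L(1) by (intro mult_left_mono sum_mono) (auto simp: polydisc_def intro: less_imp_le)
    also have "\<dots> = L * m * e" by simp
    also have "\<dots> \<le> L * m * (s / (2 * (L * m + 1)))"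
      using Lm by (intro mult_left_mono) (auto simp: e_def)
    also have "\<dots> \<le> s / 2" using Lm assms(3) by (simp add: field_simps)
    also have "\<dots> < s" using assms(3) by simp
    finally show "norm (g x) < s" using assms(2) by simp
  qed
qed

lemma conv_ps_tuple_small:
  assumes "\<And>i. i < k \<Longrightarrow> g i \<in> conv_ps m" "\<And>i. i < k \<Longrightarrow> g i (\<lambda>_. 0) = 0" "s > 0"
  shows "\<exists>r>0. \<forall>x\<in>polydisc m r. (\<lambda>i. g i x) \<in> polydisc k s"
proof -
  have "\<exists>r>0. \<forall>i<k. \<forall>x\<in>polydisc m r. norm (g i x) < s"
    by (rule common_radius, use assms conv_ps_small in blast, meson order_refl polydisc_mono)
  then show ?thesis by (auto simp: polydisc_def)
qed

lemma near0_compose: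
  assumes "near0 k P" "\<And>i. i < k \<Longrightarrow> g i \<in> conv_ps m" "\<And>i. i < k \<Longrightarrow> g i (\<lambda>_. 0) = 0"
  shows "near0 m (\<lambda>x. P (\<lambda>i. g i x))"
  using assms(1) conv_ps_tuple_small[of k g m, OF assms(2,3)] unfolding near0_polydisc by meson

lemma conv_ps_compose:
  assumes "f \<in> conv_ps k" and g: "\<And>i. i < k \<Longrightarrow> g i \<in> conv_ps m" "\<And>i. i < k \<Longrightarrow> g i (\<lambda>_. 0) = 0"
  shows "(\<lambda>x. f (\<lambda>i. g i x)) \<in> conv_ps m"
proof -
  obtain s where s: "s > 0" "plot_holo k s f" using assms(1) by (auto simp: conv_ps_iff)
  obtain r where r: "r > 0" "\<And>x. x \<in> polydisc m r \<Longrightarrow> (\<lambda>i. g i x) \<in> polydisc k s"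
    using conv_ps_tuple_small[of k g m s] g s by blast
  obtain r' where r': "r' > 0" "\<And>i. i < k \<Longrightarrow> plot_holo m r' (g i)"
    using common_plot_holo[of k g m, OF g(1)] by blast
  have "plot_holo m (min r r') (\<lambda>x. f (\<lambda>i. g i x))"
  proof (rule plot_holo_compose[OF s(2)])
    show "plot_holo m (min r r') (g i)" if "i < k" for i
      by (rule plot_holo_mono[OF r'(2)[OF that]]) auto
    show "(\<lambda>i. g i x) \<in> polydisc k s" if "x \<in> polydisc m (min r r')" for x
      using that by (intro r(2)) (auto simp: polydisc_def)
  qed
  then show ?thesis using r(1) r'(1) by (auto intro: plot_holo_imp_conv_ps)
qed

text \<open>Points carry infinitely many coordinates, while identities between maps or curves hold
  only for the first \<open>m\<close> of them. This is what allows such identities to be substituted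
  into \<open>f\<close>.\<close>

lemma conv_ps_dep:
  assumes "f \<in> conv_ps m"
  shows "near0 m (\<lambda>x. \<forall>y. (\<forall>i<m. x i = y i) \<longrightarrow> f x = f y)"
  using assms unfolding conv_ps_iff near0_polydisc by (meson plot_holo_cong)

text \<open>Setting later coordinates to 0 is how germs in fewer variables arise below, both for
  values of initial components and for the passage from \<open>\<phi>1\<close> back to
  \<open>\<phi>0\<close>.\<close>

lemma conv_ps_restrict:
  assumes "f \<in> conv_ps m"
  shows "(\<lambda>x. f (\<lambda>i. if i < k then x i else 0)) \<in> conv_ps k"
proof (rule conv_ps_compose[OF assms])
  show "(\<lambda>x. if i < k then x i else 0) \<in> conv_ps k" for i
    by (cases "i < k") (auto intro: conv_ps_coord)
qed simp

section \<open>Curves and the pull-back of germs along them\<close>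

definition germ :: "nat \<Rightarrow> (nat \<Rightarrow> complex fps) \<Rightarrow> bool" where
  "germ m \<phi> \<longleftrightarrow> (\<forall>i<m. fps_conv_radius (\<phi> i) > 0 \<and> fps_nth (\<phi> i) 0 = 0)"

lemma map_germ_germ: "map_germ N \<phi> \<longleftrightarrow> germ (Suc N) \<phi>"
  by (auto simp: map_germ_def germ_def less_Suc_eq_le)

lemma germ_mono: "germ m \<phi> \<Longrightarrow> k \<le> m \<Longrightarrow> germ k \<phi>"
  by (auto simp: germ_def)

lemma germ_plot:
  assumes "germ m \<phi>" "r > 0"
  obtains e where "e > 0" "\<And>i. i < m \<Longrightarrow> eval_fps (\<phi> i) holomorphic_on ball 0 e"
    "\<And>t. t \<in> ball 0 e \<Longrightarrow> (\<lambda>i. eval_fps (\<phi> i) t) \<in> polydisc m r"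
proof -
  have "\<exists>e>0. \<forall>i<m. eval_fps (\<phi> i) holomorphic_on ball 0 e \<and> (\<forall>t\<in>ball 0 e. norm (eval_fps (\<phi> i) t) < r)"
  proof (rule common_radius)
    fix i assume "i < m"
    then have \<phi>: "fps_conv_radius (\<phi> i) > 0" "fps_nth (\<phi> i) 0 = 0" using assms by (auto simp: germ_def)
    have exp: "eval_fps (\<phi> i) has_fps_expansion \<phi> i" by (rule eval_fps_has_fps_expansion[OF \<phi>(1)])
    obtain S where S: "open S" "0 \<in> S" "eval_fps (\<phi> i) holomorphic_on S"
      by (rule has_fps_expansion_imp_holomorphic[OF exp])
    then obtain d where d: "d > 0" "ball 0 d \<subseteq> S" using open_contains_ball by blast
    have "continuous (at 0) (eval_fps (\<phi> i))"
      using has_fps_expansion_imp_continuous[OF exp] by simp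
    then obtain d' where d': "d' > 0" "\<And>t. dist t 0 < d' \<Longrightarrow> norm (eval_fps (\<phi> i) t) < r"
      using assms(2) \<phi>(2) unfolding continuous_at_eps_delta by (force simp: eval_fps_at_0)
    show "\<exists>e>0. eval_fps (\<phi> i) holomorphic_on ball 0 e \<and> (\<forall>t\<in>ball 0 e. norm (eval_fps (\<phi> i) t) < r)"
    proof (intro exI[of _ "min d d'"] conjI ballI)
      show "eval_fps (\<phi> i) holomorphic_on ball 0 (min d d')"
        by (rule holomorphic_on_subset[OF S(3)]) (use d(2) in auto)
    qed (use d d' in auto)
  qed (auto elim: holomorphic_on_subset)
  then show thesis using that by (auto simp: polydisc_def)
qed

lemma germ_eventually:
  assumes "near0 m P" "germ m \<phi>"
  shows "\<forall>\<^sub>F t in nhds 0. P (\<lambda>i. eval_fps (\<phi> i) t)"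
proof -
  obtain r where r: "r > 0" "\<forall>x\<in>polydisc m r. P x" using assms(1) by (auto simp: near0_polydisc)
  obtain e where e: "e > 0" "\<And>i. i < m \<Longrightarrow> eval_fps (\<phi> i) holomorphic_on ball 0 e"
    "\<And>t. t \<in> ball 0 e \<Longrightarrow> (\<lambda>i. eval_fps (\<phi> i) t) \<in> polydisc m r"
    using germ_plot[OF assms(2) r(1)] by blast
  show ?thesis
    by (rule eventually_mono[OF eventually_nhds_ball[OF e(1)]]) (use e(3) r(2) in blast)
qed

lemma pull_expansion:
  assumes "g \<in> conv_ps m" "germ m \<phi>"
  shows "(\<lambda>t. g (\<lambda>i. eval_fps (\<phi> i) t)) has_fps_expansion pull g \<phi>"
proof -
  obtain r where r: "r > 0" "plot_holo m r g" using assms(1) by (auto simp: conv_ps_iff)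
  obtain e where e: "e > 0" "\<And>i. i < m \<Longrightarrow> eval_fps (\<phi> i) holomorphic_on ball 0 e"
    "\<And>t. t \<in> ball 0 e \<Longrightarrow> (\<lambda>i. eval_fps (\<phi> i) t) \<in> polydisc m r"
    using germ_plot[OF assms(2) r(1)] by blast
  have "(\<lambda>t. g (\<lambda>i. eval_fps (\<phi> i) t)) holomorphic_on ball 0 e"
    by (rule plot_holo_plot[OF r(2) _ e(2,3)]) auto
  then show ?thesis
    unfolding pull_def using e(1) by (intro has_fps_expansion_fps_expansion[of "ball 0 e"]) auto
qed

lemma pull_eqI: "(\<lambda>t. g (\<lambda>i. eval_fps (\<phi> i) t)) has_fps_expansion F \<Longrightarrow> pull g \<phi> = F"
  unfolding pull_def by (rule fps_expansion_eqI)

lemma has_fps_expansion_eventually: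
  assumes "f has_fps_expansion F" "\<forall>\<^sub>F t in nhds 0. f t = g t"
  shows "g has_fps_expansion F"
  using assms has_fps_expansion_cong by metis

lemma pull_cong:
  assumes "f \<in> conv_ps m" "near0 m (\<lambda>x. f x = g x)" "germ m \<phi>"
  shows "pull f \<phi> = pull g \<phi>"
  by (rule pull_eqI[symmetric], rule has_fps_expansion_eventually[OF pull_expansion[OF assms(1,3)]])
     (rule germ_eventually[OF assms(2,3)])

lemma pull_dep:
  assumes "f \<in> conv_ps m" "germ m \<phi>" "\<And>i. i < m \<Longrightarrow> \<psi> i = \<phi> i"
  shows "pull f \<psi> = pull f \<phi>"
  by (rule pull_eqI, rule has_fps_expansion_eventually[OF pull_expansion[OF assms(1,2)]],
      rule eventually_mono[OF germ_eventually[OF conv_ps_dep[OF assms(1)] assms(2)]])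
     (use assms(3) in auto)

lemma pull_coord: "germ m \<phi> \<Longrightarrow> i < m \<Longrightarrow> pull (\<lambda>x. x i) \<phi> = \<phi> i"
  by (rule pull_eqI) (auto simp: germ_def intro: eval_fps_has_fps_expansion)

lemma pull_const [simp]: "pull (\<lambda>_. c) \<phi> = fps_const c"
  by (rule pull_eqI) auto

lemma pull_add:
  "f \<in> conv_ps m \<Longrightarrow> g \<in> conv_ps m \<Longrightarrow> germ m \<phi> \<Longrightarrow> pull (\<lambda>x. f x + g x) \<phi> = pull f \<phi> + pull g \<phi>"
  by (rule pull_eqI) (intro has_fps_expansion_add pull_expansion)

lemma pull_diff:
  "f \<in> conv_ps m \<Longrightarrow> g \<in> conv_ps m \<Longrightarrow> germ m \<phi> \<Longrightarrow> pull (\<lambda>x. f x - g x) \<phi> = pull f \<phi> - pull g \<phi>"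
  by (rule pull_eqI) (intro has_fps_expansion_diff pull_expansion)

lemma pull_mult:
  "f \<in> conv_ps m \<Longrightarrow> g \<in> conv_ps m \<Longrightarrow> germ m \<phi> \<Longrightarrow> pull (\<lambda>x. f x * g x) \<phi> = pull f \<phi> * pull g \<phi>"
  by (rule pull_eqI) (intro has_fps_expansion_mult pull_expansion)

lemma pull_sum:
  "(\<And>i. i \<in> A \<Longrightarrow> f i \<in> conv_ps m) \<Longrightarrow> germ m \<phi> \<Longrightarrow> pull (\<lambda>x. \<Sum>i\<in>A. f i x) \<phi> = (\<Sum>i\<in>A. pull (f i) \<phi>)"
  by (rule pull_eqI) (intro has_fps_expansion_sum pull_expansion)

lemma pull_conv_radius: "g \<in> conv_ps m \<Longrightarrow> germ m \<phi> \<Longrightarrow> fps_conv_radius (pull g \<phi>) > 0"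
  using pull_expansion has_fps_expansion_def by metis

lemma pull_nth_0:
  assumes "g \<in> conv_ps m" "germ m \<phi>"
  shows "fps_nth (pull g \<phi>) 0 = g (\<lambda>_. 0)"
proof -
  have "fps_nth (pull g \<phi>) 0 = g (\<lambda>i. eval_fps (\<phi> i) 0)"
    using fps_nth_fps_expansion[OF pull_expansion[OF assms], of 0] by simp
  also have "\<dots> = g (\<lambda>_. 0)"
  proof -
    obtain r where r: "r > 0" "plot_holo m r g" using assms(1) by (auto simp: conv_ps_iff)
    show ?thesis
      by (rule plot_holo_cong[OF r(2)]) (use r(1) assms(2) in \<open>auto simp: polydisc_def germ_def eval_fps_at_0\<close>)
  qed
  finally show ?thesis .
qed

lemma germ_pull:
  "(\<And>i. i < k \<Longrightarrow> g i \<in> conv_ps m) \<Longrightarrow> (\<And>i. i < k \<Longrightarrow> g i (\<lambda>_. 0) = 0) \<Longrightarrow> germ m \<phi> \<Longrightarrow>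
   germ k (\<lambda>i. pull (g i) \<phi>)"
  unfolding germ_def[of k] using pull_nth_0 pull_conv_radius by metis

lemma pull_compose:
  assumes f: "f \<in> conv_ps k" and g: "\<And>i. i < k \<Longrightarrow> g i \<in> conv_ps m" "\<And>i. i < k \<Longrightarrow> g i (\<lambda>_. 0) = 0"
    and \<phi>: "germ m \<phi>"
  shows "pull (\<lambda>x. f (\<lambda>i. g i x)) \<phi> = pull f (\<lambda>i. pull (g i) \<phi>)"
proof -
  let ?c = "\<lambda>t i. eval_fps (\<phi> i) t"
  have "(\<lambda>t. f (\<lambda>i. g i (?c t))) has_fps_expansion pull (\<lambda>x. f (\<lambda>i. g i x)) \<phi>"
    by (rule pull_expansion[OF conv_ps_compose[of f k g m] \<phi>]) (use assms in auto)
  moreover have "\<forall>\<^sub>F t in nhds 0. f (\<lambda>i. g i (?c t)) = f (\<lambda>i. eval_fps (pull (g i) \<phi>) t)"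
  proof -
    have "\<forall>\<^sub>F t in nhds 0. \<forall>y. (\<forall>i<k. g i (?c t) = y i) \<longrightarrow> f (\<lambda>i. g i (?c t)) = f y"
      by (rule germ_eventually[OF near0_compose[of k _ g m, OF conv_ps_dep[OF f]] \<phi>]) (use g in auto)
    moreover have "\<forall>\<^sub>F t in nhds 0. \<forall>i\<in>{..<k}. eval_fps (pull (g i) \<phi>) t = g i (?c t)"
      using pull_expansion[OF g(1) \<phi>]
      by (intro eventually_ball_finite) (auto simp: has_fps_expansion_def)
    ultimately show ?thesis by eventually_elim auto
  qed
  ultimately have "(\<lambda>t. f (\<lambda>i. eval_fps (pull (g i) \<phi>) t)) has_fps_expansion pull (\<lambda>x. f (\<lambda>i. g i x)) \<phi>"
    by (rule has_fps_expansion_eventually)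
  then show ?thesis by (rule pull_eqI[symmetric])
qed

lemma pull_oo:
  assumes f: "f \<in> conv_ps m" and \<psi>: "germ m \<psi>" and \<tau>: "fps_conv_radius \<tau> > 0" "fps_nth \<tau> 0 = 0"
  shows "pull f (\<lambda>i. \<psi> i oo \<tau>) = pull f \<psi> oo \<tau>"
proof -
  let ?c = "\<lambda>t i. eval_fps (\<psi> i) (eval_fps \<tau> t)"
  have \<tau>': "eval_fps \<tau> has_fps_expansion \<tau>" by (rule eval_fps_has_fps_expansion[OF \<tau>(1)])
  have "isCont (eval_fps \<tau>) 0" using has_fps_expansion_imp_continuous[OF \<tau>'] by simp
  then have lim: "filterlim (eval_fps \<tau>) (nhds 0) (nhds 0)"
    unfolding isCont_def tendsto_at_iff_tendsto_nhds by (simp add: eval_fps_at_0 \<tau>(2))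
  have "(\<lambda>t. f (?c t)) has_fps_expansion (pull f \<psi> oo \<tau>)"
    using has_fps_expansion_compose[OF pull_expansion[OF f \<psi>] \<tau>' \<tau>(2)] by (simp add: o_def)
  moreover have "\<forall>\<^sub>F t in nhds 0. f (?c t) = f (\<lambda>i. eval_fps (\<psi> i oo \<tau>) t)"
  proof -
    have "\<forall>\<^sub>F t in nhds 0. \<forall>y. (\<forall>i<m. eval_fps (\<psi> i) t = y i) \<longrightarrow> f (\<lambda>i. eval_fps (\<psi> i) t) = f y"
      by (rule germ_eventually[OF conv_ps_dep[OF f] \<psi>])
    then have "\<forall>\<^sub>F t in nhds 0. \<forall>y. (\<forall>i<m. ?c t i = y i) \<longrightarrow> f (?c t) = f y"
      by (rule eventually_compose_filterlim[OF _ lim])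
    moreover have "\<forall>\<^sub>F t in nhds 0. \<forall>i\<in>{..<m}. eval_fps (\<psi> i oo \<tau>) t = ?c t i"
    proof (intro eventually_ball_finite ballI)
      fix i assume "i \<in> {..<m}"
      then have "eval_fps (\<psi> i) has_fps_expansion \<psi> i"
        using \<psi> by (auto simp: germ_def intro: eval_fps_has_fps_expansion)
      from has_fps_expansion_compose[OF this \<tau>' \<tau>(2)]
      show "\<forall>\<^sub>F t in nhds 0. eval_fps (\<psi> i oo \<tau>) t = ?c t i"
        by (simp add: has_fps_expansion_def)
    qed simp
    ultimately show ?thesis by eventually_elim auto
  qed
  ultimately have "(\<lambda>t. f (\<lambda>i. eval_fps (\<psi> i oo \<tau>) t)) has_fps_expansion (pull f \<psi> oo \<tau>)"
    by (rule has_fps_expansion_eventually)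
  then show ?thesis by (rule pull_eqI)
qed

section \<open>Orders of vanishing, growth near the origin and first order comparison\<close>

lemma has_fps_expansion_bound:
  fixes f :: "complex \<Rightarrow> complex"
  assumes "f has_fps_expansion F" "\<And>j. j < k \<Longrightarrow> fps_nth F j = 0"
  obtains C where "C > 0" "\<forall>\<^sub>F t in nhds 0. norm (f t) \<le> C * norm t ^ k"
proof -
  define G where "G = fps_shift k F"
  have F: "F = G * fps_X ^ k"
    by (rule fps_ext) (use assms(2) in \<open>auto simp: G_def fps_X_power_mult_right_nth\<close>)
  have G: "fps_conv_radius G > 0" using assms(1) by (simp add: G_def has_fps_expansion_def)
  note G' = eval_fps_has_fps_expansion[OF G]
  have "isCont (eval_fps G) 0" using has_fps_expansion_imp_continuous[OF G'] by simp
  then have "filterlim (eval_fps G) (nhds (eval_fps G 0)) (nhds 0)"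
    by (simp add: isCont_def tendsto_at_iff_tendsto_nhds)
  then have "\<forall>\<^sub>F t in nhds 0. norm (eval_fps G t) < norm (eval_fps G 0) + 1"
    by (intro order_tendstoD(2)[OF tendsto_norm]) auto
  moreover have "(\<lambda>t. eval_fps G t * t ^ k) has_fps_expansion F"
    unfolding F by (intro has_fps_expansion_mult G' has_fps_expansion_fps_X_power)
  then have "\<forall>\<^sub>F t in nhds 0. eval_fps G t * t ^ k = eval_fps F t"
    by (auto simp: has_fps_expansion_def elim: eventually_mono)
  moreover have "\<forall>\<^sub>F t in nhds 0. eval_fps F t = f t" using assms(1) by (simp add: has_fps_expansion_def)
  ultimately have "\<forall>\<^sub>F t in nhds 0. norm (f t) \<le> (norm (eval_fps G 0) + 1) * norm t ^ k"
  proof eventually_elim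
    case (elim t)
    then have "norm (f t) = norm (eval_fps G t) * norm t ^ k" by (metis norm_mult norm_power)
    then show ?case using elim(1) by (simp add: mult_right_mono less_imp_le)
  qed
  then show thesis by (rule that[rotated]) (simp add: add_nonneg_pos)
qed

text \<open>Converse of the preceding estimate: together they turn inequalities for germs near the
  origin into statements about coefficients.\<close>

lemma has_fps_expansion_bound_imp:
  fixes f :: "complex \<Rightarrow> complex"
  assumes "f has_fps_expansion F" "\<forall>\<^sub>F t in at 0. norm (f t) \<le> C * norm t ^ k" "j < k"
  shows "fps_nth F j = 0"
proof (rule ccontr)
  assume nz: "fps_nth F j \<noteq> 0"
  define d where "d = subdegree F"
  have "F \<noteq> 0" using nz by auto
  have d: "d < k" using assms(3) subdegree_leI[OF nz] by (simp add: d_def)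
  define G where "G = fps_shift d F"
  have F: "F = G * fps_X ^ d" unfolding G_def d_def by (simp add: subdegree_decompose[symmetric])
  have G0: "fps_nth G 0 \<noteq> 0" using \<open>F \<noteq> 0\<close> by (simp add: G_def d_def)
  have G: "fps_conv_radius G > 0" using assms(1) by (simp add: G_def has_fps_expansion_def)
  note G' = eval_fps_has_fps_expansion[OF G]
  have lim: "(eval_fps G \<longlongrightarrow> fps_nth G 0) (at 0)"
    using has_fps_expansion_imp_continuous[OF G', of UNIV] unfolding isCont_def eval_fps_at_0 .
  have "(\<lambda>t. eval_fps G t * t ^ d) has_fps_expansion F"
    unfolding F by (intro has_fps_expansion_mult G' has_fps_expansion_fps_X_power)
  then have "\<forall>\<^sub>F t in nhds 0. eval_fps F t = eval_fps G t * t ^ d" by (auto simp: has_fps_expansion_def)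
  then have 1: "\<forall>\<^sub>F t in at 0. eval_fps F t = eval_fps G t * t ^ d"
    by (simp add: eventually_at_filter eventually_mono)
  have "\<forall>\<^sub>F t in nhds 0. eval_fps F t = f t" using assms(1) by (simp add: has_fps_expansion_def)
  then have 2: "\<forall>\<^sub>F t in at 0. eval_fps F t = f t" by (simp add: eventually_at_filter eventually_mono)
  have "\<forall>\<^sub>F t in at 0. norm (eval_fps G t) \<le> C * norm t ^ (k - d)"
    using 1 2 assms(2) eventually_neq_at_within[of 0 0 UNIV]
  proof eventually_elim
    case (elim t)
    have "norm (eval_fps G t) * norm t ^ d = norm (f t)" using elim by (metis norm_mult norm_power)
    also have "\<dots> \<le> C * norm t ^ (k - d) * norm t ^ d"
      using elim(3) d by (simp add: mult.assoc flip: power_add)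
    finally show ?case using elim(4) by simp
  qed
  moreover have "((\<lambda>t :: complex. C * norm t ^ (k - d)) \<longlongrightarrow> C * norm (0 :: complex) ^ (k - d)) (at 0)"
    by (intro tendsto_mult tendsto_power tendsto_norm tendsto_const tendsto_ident_at)
  ultimately have "norm (fps_nth G 0) \<le> C * norm (0 :: complex) ^ (k - d)"
    by (intro tendsto_le[OF _ _ tendsto_norm[OF lim]]) auto
  then show False using G0 d by (simp add: power_0_left)
qed

text \<open>Both curves are \<open>O(t)\<close> and their difference is \<open>O(t^k)\<close>, so
  the first order estimate on a polydisc of radius proportional to \<open>norm t\<close> leaves an
  error \<open>O(t^(k + 1))\<close>. Hence at order \<open>k\<close> only the linear part of
  \<open>f\<close> is felt.\<close>

lemma pull_linear_approx:
  assumes f: "f \<in> conv_ps m" and \<phi>: "germ m \<phi>" and \<psi>: "germ m \<psi>"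
    and ord: "\<And>i j. i < m \<Longrightarrow> j < k \<Longrightarrow> fps_nth (\<phi> i) j = fps_nth (\<psi> i) j" and "j \<le> k"
  shows "fps_nth (pull f \<phi>) j - fps_nth (pull f \<psi>) j = (\<Sum>i<m. pd0 f i * (fps_nth (\<phi> i) j - fps_nth (\<psi> i) j))"
proof -
  define E where "E = pull f \<phi> - pull f \<psi> - (\<Sum>i<m. fps_const (pd0 f i) * (\<phi> i - \<psi> i))"
  let ?x = "\<lambda>t i. eval_fps (\<phi> i) t" and ?y = "\<lambda>t i. eval_fps (\<psi> i) t"
  obtain r where r: "r > 0" "plot_holo m r f" using f by (auto simp: conv_ps_iff)
  obtain K where K: "K \<ge> 0" "\<And>s x y. 0 < s \<Longrightarrow> s \<le> r / 4 \<Longrightarrow> x \<in> polydisc m s \<Longrightarrow> y \<in> polydisc m s \<Longrightarrow>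
    norm (f x - f y - (\<Sum>j<m. pd0 f j * (x j - y j))) \<le> K * s * (\<Sum>j<m. norm (x j - y j))"
    using plot_holo_linear_approx[OF r(2,1)] by blast
  have E: "(\<lambda>t. f (?x t) - f (?y t) - (\<Sum>i<m. pd0 f i * (?x t i - ?y t i))) has_fps_expansion E"
    unfolding E_def using \<phi> \<psi>
    by (intro has_fps_expansion_diff has_fps_expansion_sum has_fps_expansion_cmult_left
        pull_expansion[OF f] eval_fps_has_fps_expansion) (auto simp: germ_def)
  have bnd: "\<exists>C>0. \<forall>\<^sub>F t in nhds 0. norm (eval_fps (\<theta> i) t) \<le> C * norm t ^ 1" if "germ m \<theta>" "i < m" for \<theta> i
  proof -
    have "eval_fps (\<theta> i) has_fps_expansion \<theta> i" "fps_nth (\<theta> i) 0 = 0"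
      using that by (auto simp: germ_def intro: eval_fps_has_fps_expansion)
    then show ?thesis using has_fps_expansion_bound[of "eval_fps (\<theta> i)" "\<theta> i" 1] by auto
  qed
  obtain C where C: "\<And>i. i < m \<Longrightarrow> C i > 0 \<and> (\<forall>\<^sub>F t in nhds 0. norm (?x t i) \<le> C i * norm t ^ 1)"
    using bnd[OF \<phi>] by metis
  obtain D where D: "\<And>i. i < m \<Longrightarrow> D i > 0 \<and> (\<forall>\<^sub>F t in nhds 0. norm (?y t i) \<le> D i * norm t ^ 1)"
    using bnd[OF \<psi>] by metis
  have "\<exists>C>0. \<forall>\<^sub>F t in nhds 0. norm (?x t i - ?y t i) \<le> C * norm t ^ k" if "i < m" for i
  proof -
    have "(\<lambda>t. ?x t i - ?y t i) has_fps_expansion (\<phi> i - \<psi> i)"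
      using \<phi> \<psi> that by (intro has_fps_expansion_diff eval_fps_has_fps_expansion) (auto simp: germ_def)
    then show ?thesis using has_fps_expansion_bound[of _ "\<phi> i - \<psi> i" k] ord[OF that] by fastforce
  qed
  then obtain B where B: "\<And>i. i < m \<Longrightarrow> B i > 0 \<and> (\<forall>\<^sub>F t in nhds 0. norm (?x t i - ?y t i) \<le> B i * norm t ^ k)"
    by metis
  \<comment> \<open>The summand 1 makes \<open>M\<close> strictly larger than every constant,
    because the polydisc is open; for the same reason \<open>t = 0\<close> is set aside
    below.\<close>
  define M where "M = 1 + (\<Sum>i<m. C i + D i)"
  have M: "C i < M \<and> D i < M" if "i < m" for i
  proof -
    have "C i + D i \<le> (\<Sum>i<m. C i + D i)"
      using C D that by (intro member_le_sum) (auto simp: add_nonneg_nonneg less_imp_le)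
    then show ?thesis using C[OF that] D[OF that] by (simp add: M_def)
  qed
  have M0: "M > 0" unfolding M_def using C D by (intro add_pos_nonneg sum_nonneg) (auto simp: add_nonneg_nonneg less_imp_le)
  have ev: "\<forall>\<^sub>F t in nhds 0. \<forall>i\<in>{..<m}. norm (?x t i) \<le> C i * norm t \<and> norm (?y t i) \<le> D i * norm t \<and>
       norm (?x t i - ?y t i) \<le> B i * norm t ^ k"
    using B C D by (intro eventually_ball_finite ballI eventually_conj) auto
  have small: "\<forall>\<^sub>F t :: complex in nhds 0. norm t < r / (4 * M)"
    using eventually_nhds_ball[of "r / (4 * M)" "0 :: complex"] r M0 by (auto elim: eventually_mono)
  have "\<forall>\<^sub>F t in nhds 0. t \<noteq> 0 \<longrightarrow> norm (f (?x t) - f (?y t) - (\<Sum>i<m. pd0 f i * (?x t i - ?y t i)))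
      \<le> K * M * (\<Sum>i<m. B i) * norm t ^ Suc k"
    using ev small
  proof eventually_elim
    case (elim t)
    show ?case
    proof
      assume t: "t \<noteq> 0"
      have "C i * norm t < M * norm t" "D i * norm t < M * norm t" if "i < m" for i
        using M[OF that] t by auto
      then have xy: "?x t \<in> polydisc m (M * norm t)" "?y t \<in> polydisc m (M * norm t)"
        using elim(1) by (force simp: polydisc_def)+
      have "norm (f (?x t) - f (?y t) - (\<Sum>i<m. pd0 f i * (?x t i - ?y t i)))
          \<le> K * (M * norm t) * (\<Sum>i<m. norm (?x t i - ?y t i))"
        by (rule K(2)[OF _ _ xy]) (use t M0 elim(2) in \<open>auto simp: field_simps\<close>)
      also have "\<dots> \<le> K * (M * norm t) * (\<Sum>i<m. B i * norm t ^ k)"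
        using elim(1) K(1) M0 by (intro mult_left_mono sum_mono) auto
      finally show "norm (f (?x t) - f (?y t) - (\<Sum>i<m. pd0 f i * (?x t i - ?y t i)))
          \<le> K * M * (\<Sum>i<m. B i) * norm t ^ Suc k"
        by (simp add: sum_distrib_right[symmetric] mult_ac)
    qed
  qed
  then have "\<forall>\<^sub>F t in at 0. norm (f (?x t) - f (?y t) - (\<Sum>i<m. pd0 f i * (?x t i - ?y t i)))
      \<le> K * M * (\<Sum>i<m. B i) * norm t ^ Suc k"
    unfolding eventually_at_filter by (rule eventually_mono) auto
  from has_fps_expansion_bound_imp[OF E this] have "fps_nth E j = 0" using \<open>j \<le> k\<close> by simp
  then show ?thesis by (simp add: E_def fps_sum_nth)
qed

section \<open>Values of a parametrization\<close>

lemma pull_agree: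
  assumes "f \<in> conv_ps m" "germ m \<phi>" "germ m \<psi>"
    and "\<And>i j. i < m \<Longrightarrow> j < k \<Longrightarrow> fps_nth (\<phi> i) j = fps_nth (\<psi> i) j" and "j < k"
  shows "fps_nth (pull f \<phi>) j = fps_nth (pull f \<psi>) j"
  using pull_linear_approx[OF assms(1-4), of k j] assms(4,5) by simp

lemma pull_restrict:
  "pull (\<lambda>x. f (\<lambda>i. if i < k then x i else 0)) \<phi> = pull f (\<lambda>i. if i < k then \<phi> i else 0)"
proof -
  have "eval_fps (if i < k then \<phi> i else 0) t = (if i < k then eval_fps (\<phi> i) t else 0)" for i t
    by simp
  then show ?thesis by (simp add: pull_def)
qed

lemma germ_restrict: "germ m \<phi> \<Longrightarrow> germ m (\<lambda>i. if i < k then \<phi> i else 0)"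
  by (auto simp: germ_def)

lemma values_uptoI:
  assumes "h \<in> conv_ps i" "fps_nth (pull h \<phi>) s \<noteq> 0" "\<And>l. l < s \<Longrightarrow> fps_nth (pull h \<phi>) l = 0"
  shows "s \<in> values_upto i \<phi>"
proof -
  have "subdegree (pull h \<phi>) = s" by (rule subdegreeI) (use assms in auto)
  moreover have "pull h \<phi> \<noteq> 0" using assms(2) by auto
  ultimately show ?thesis using assms(1) unfolding values_upto_def by blast
qed

lemma values_uptoE:
  assumes "s \<in> values_upto i \<phi>"
  obtains h where "h \<in> conv_ps i" "fps_nth (pull h \<phi>) s \<noteq> 0" "\<And>l. l < s \<Longrightarrow> fps_nth (pull h \<phi>) l = 0"
proof -
  obtain h where h: "h \<in> conv_ps i" "pull h \<phi> \<noteq> 0" "s = subdegree (pull h \<phi>)"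
    using assms unfolding values_upto_def by blast
  show thesis
    by (rule that[OF h(1)]; unfold h(3)) (rule nth_subdegree_nonzero[OF h(2)], rule nth_less_subdegree_zero)
qed

text \<open>Germs in no variables are constants. Hence the positive number \<open>w 0\<close> is not
  a value of the empty list of components, and the first component can be treated like all
  others.\<close>

lemma values_upto_zero: "values_upto 0 \<phi> \<subseteq> {0}"
proof
  fix s assume "s \<in> values_upto 0 \<phi>"
  then obtain h where h: "h \<in> conv_ps 0" "fps_nth (pull h \<phi>) s \<noteq> 0" by (rule values_uptoE)
  have "h x = h y" for x y
    using conv_ps_dep[OF h(1)] by (auto simp: near0_def intro: zero_less_one)
  then have "h = (\<lambda>_. h (\<lambda>_. 0))" by blast
  then have "pull h \<phi> = fps_const (h (\<lambda>_. 0))" by (metis pull_const)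
  then show "s \<in> {0}" using h(2) by (cases s) auto
qed

text \<open>
  If \<open>pd0 f k\<close> were nonzero, the components before the \<open>k\<close>-th one would have to cancel
  \<open>t ^ W\<close>, so \<open>W\<close> would be one of their values.
\<close>

lemma pd0_eq_0_of_order:
  assumes f: "f \<in> conv_ps m" and \<phi>: "germ m \<phi>" and k: "k < m" and W: "W \<notin> values_upto k \<phi>"
    and lead: "fps_nth (\<phi> k) W = 1"
    and ord: "\<And>i l. k \<le> i \<Longrightarrow> i < m \<Longrightarrow> l < W \<Longrightarrow> fps_nth (\<phi> i) l = 0"
    and ord': "\<And>i. k < i \<Longrightarrow> i < m \<Longrightarrow> fps_nth (\<phi> i) W = 0"
    and van: "\<And>l. l \<le> W \<Longrightarrow> fps_nth (pull f \<phi>) l = 0"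
  shows "pd0 f k = 0"
proof (rule ccontr)
  assume nz: "pd0 f k \<noteq> 0"
  define \<psi> where "\<psi> i = (if i < k then \<phi> i else 0)" for i
  have \<psi>: "germ m \<psi>" unfolding \<psi>_def by (rule germ_restrict[OF \<phi>])
  have eq: "fps_nth (\<phi> i) j = fps_nth (\<psi> i) j" if "i < m" "j < W" for i j
    using that ord[of i j] by (auto simp: \<psi>_def)
  have "fps_nth (pull f \<phi>) W - fps_nth (pull f \<psi>) W = (\<Sum>i<m. pd0 f i * (fps_nth (\<phi> i) W - fps_nth (\<psi> i) W))"
    by (rule pull_linear_approx[OF f \<phi> \<psi> eq]) auto
  also have "\<dots> = (\<Sum>i<m. if i = k then pd0 f k else 0)"
    by (rule sum.cong) (use lead ord' in \<open>auto simp: \<psi>_def not_less dest: le_neq_implies_less\<close>)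
  also have "\<dots> = pd0 f k" using k by simp
  finally have 1: "fps_nth (pull f \<psi>) W \<noteq> 0" using van[of W] nz by auto
  have 2: "fps_nth (pull f \<psi>) l = 0" if "l < W" for l
    using pull_agree[OF f \<phi> \<psi> eq that] van[of l] that by simp
  have "pull (\<lambda>x. f (\<lambda>i. if i < k then x i else 0)) \<phi> = pull f \<psi>"
    unfolding \<psi>_def by (rule pull_restrict)
  then have "W \<in> values_upto k \<phi>"
    using values_uptoI[OF conv_ps_restrict[OF f], of k \<phi> W] 1 2 by simp
  with W show False ..
qed

lemma values_upto_mono: "i \<le> k \<Longrightarrow> values_upto i \<phi> \<subseteq> values_upto k \<phi>"
  unfolding values_upto_def using conv_ps_mono by blast

text \<open>Components of order at least \<open>W\<close> do not influence coefficients below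
  \<open>W\<close>, so a germ realising \<open>s\<close> still does so after they are replaced by
  0.\<close>

lemma values_upto_restrict:
  assumes "s \<in> values_upto m \<phi>" "s < W" "germ m \<phi>"
    and "\<And>i l. k \<le> i \<Longrightarrow> i < m \<Longrightarrow> l < W \<Longrightarrow> fps_nth (\<phi> i) l = 0"
  shows "s \<in> values_upto k \<phi>"
proof -
  obtain h where h: "h \<in> conv_ps m" "fps_nth (pull h \<phi>) s \<noteq> 0" "\<And>l. l < s \<Longrightarrow> fps_nth (pull h \<phi>) l = 0"
    using values_uptoE[OF assms(1)] by blast
  have "fps_nth (pull h \<phi>) l = fps_nth (pull h (\<lambda>i. if i < k then \<phi> i else 0)) l" if "l < W" for l
    by (rule pull_agree[OF h(1) assms(3) germ_restrict[OF assms(3)] _ that]) (use assms(4) in auto)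
  then show ?thesis
    using values_uptoI[OF conv_ps_restrict[OF h(1)], of k \<phi> s] h assms(2) unfolding pull_restrict by simp
qed

lemma values_upto_add:
  assumes "s \<in> values_upto m \<phi>" "t \<in> values_upto m \<phi>" "germ m \<phi>"
  shows "s + t \<in> values_upto m \<phi>"
proof -
  obtain f g where fg: "f \<in> conv_ps m" "pull f \<phi> \<noteq> 0" "s = subdegree (pull f \<phi>)"
    "g \<in> conv_ps m" "pull g \<phi> \<noteq> 0" "t = subdegree (pull g \<phi>)"
    using assms(1,2) unfolding values_upto_def by blast
  have "pull (\<lambda>x. f x * g x) \<phi> = pull f \<phi> * pull g \<phi>" by (rule pull_mult[OF fg(1,4) assms(3)])
  moreover from this have "subdegree (pull (\<lambda>x. f x * g x) \<phi>) = s + t" using fg by simp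
  ultimately show ?thesis unfolding values_upto_def using conv_ps_mult[OF fg(1,4)] fg(2,5) by force
qed

lemma values_upto_component:
  assumes "germ m \<phi>" "i < m" "fps_nth (\<phi> i) s \<noteq> 0" "\<And>l. l < s \<Longrightarrow> fps_nth (\<phi> i) l = 0"
  shows "s \<in> values_upto m \<phi>"
  using values_uptoI[OF conv_ps_coord[OF assms(2)], of \<phi> s] assms pull_coord[OF assms(1,2)] by simp

section \<open>Surjectivity of the pull-back above the conductor\<close>

lemma conv_ps_eval_fps:
  assumes F: "fps_conv_radius F > 0" and "m > 0"
  shows "(\<lambda>x. eval_fps F (x 0)) \<in> conv_ps m"
proof -
  obtain d where d: "d > 0" "ereal d < fps_conv_radius F"
    using F by (metis ereal_dense2 ereal_less(2) zero_ereal_def)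
  have hol: "eval_fps F holomorphic_on ball 0 d" by (intro holomorphic_on_eval_fps ball_eball_mono less_imp_le d)
  have "compact (eval_fps F ` cball 0 (d / 2))"
    using d(1) by (intro compact_continuous_image continuous_on_subset[OF holomorphic_on_imp_continuous_on[OF hol]]) auto
  then obtain B where B: "\<And>z. norm z \<le> d / 2 \<Longrightarrow> norm (eval_fps F z) \<le> B"
    by (force dest!: compact_imp_bounded simp: bounded_iff)
  have "plot_holo m (d / 2) (\<lambda>x. eval_fps F (x 0))"
  proof (rule plot_holoI)
    show "norm (eval_fps F (x 0)) \<le> B" if "x \<in> polydisc m (d / 2)" for x
      using that \<open>m > 0\<close> by (intro B) (auto simp: polydisc_def intro: less_imp_le)
    fix S g assume S: "open S" "\<And>i. i < m \<Longrightarrow> g i holomorphic_on S" "\<And>z. z \<in> S \<Longrightarrow> (\<lambda>i. g i z) \<in> polydisc m (d / 2)"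
    have "norm (g 0 z) < d" if "z \<in> S" for z
      using S(3)[OF that] \<open>m > 0\<close> d(1) by (force simp: polydisc_def)
    then have "g 0 ` S \<subseteq> ball 0 d" by auto
    then show "(\<lambda>z. eval_fps F (g 0 z)) holomorphic_on S"
      using holomorphic_on_compose_gen[OF S(2)[OF \<open>m > 0\<close>] hol] by (simp add: o_def)
  qed (use \<open>m > 0\<close> in auto)
  then show ?thesis using d(1) by (auto intro: plot_holo_imp_conv_ps)
qed

lemma pull_eval_fps:
  assumes "fps_conv_radius F > 0" "fps_conv_radius (\<phi> 0) > 0" "fps_nth (\<phi> 0) 0 = 0"
  shows "pull (\<lambda>x. eval_fps F (x 0)) \<phi> = F oo \<phi> 0"
  using has_fps_expansion_compose[OF eval_fps_has_fps_expansion[OF assms(1)] eval_fps_has_fps_expansion[OF assms(2)] assms(3)]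
  by (intro pull_eqI) (simp add: o_def)

text \<open>The exponent \<open>Suc n\<close> absorbs the constant of the usual Cauchy estimate, so
  a single number controls all the series.\<close>

lemma geometric_coeff_bound:
  fixes F :: "nat \<Rightarrow> complex fps" and k :: nat
  assumes "\<And>i. i < k \<Longrightarrow> fps_conv_radius (F i) > 0"
  obtains M where "M \<ge> 1" "\<And>i n. i < k \<Longrightarrow> norm (fps_nth (F i) n) \<le> M ^ Suc n"
proof -
  have "\<exists>r>0. \<forall>i<k. \<forall>n. norm (fps_nth (F i) n) * r ^ Suc n \<le> 1"
  proof (rule common_radius)
    fix i assume "i < k"
    then have "fps_conv_radius (F i) > 0" by (rule assms)
    then obtain d where d: "d > 0" "ereal d < fps_conv_radius (F i)"
      by (metis ereal_dense2 ereal_less(2) zero_ereal_def)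
    have "summable (\<lambda>n. norm (fps_nth (F i) n * of_real d ^ n))"
      using d by (intro norm_summable_fps) auto
    then have "(\<lambda>n. norm (fps_nth (F i) n * of_real d ^ n)) \<longlonglongrightarrow> 0" by (rule summable_LIMSEQ_zero)
    then obtain K where K: "K > 0" "\<And>n. norm (fps_nth (F i) n * of_real d ^ n) \<le> K"
      by (auto elim!: BseqE dest!: convergentI convergent_imp_Bseq)
    define r where "r = min d (1 / K)"
    have r: "r > 0" "r \<le> d" "r * K \<le> 1" using d K by (auto simp: r_def field_simps min_def)
    have "norm (fps_nth (F i) n) * r ^ Suc n \<le> 1" for n
    proof -
      have "norm (fps_nth (F i) n) * r ^ n \<le> norm (fps_nth (F i) n) * d ^ n"
        using r by (intro mult_left_mono power_mono) auto
      also have "\<dots> \<le> K" using K(2)[of n] d by (simp add: norm_mult norm_power)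
      finally have "norm (fps_nth (F i) n) * r ^ n * r \<le> K * r" using r by (intro mult_right_mono) auto
      then show ?thesis using r(3) by (simp add: mult_ac)
    qed
    then show "\<exists>r>0. \<forall>n. norm (fps_nth (F i) n) * r ^ Suc n \<le> 1" using r(1) by blast
  next
    fix i and r s :: real assume *: "\<forall>n. norm (fps_nth (F i) n) * r ^ Suc n \<le> 1" "0 < s" "s \<le> r"
    have "norm (fps_nth (F i) n) * s ^ Suc n \<le> norm (fps_nth (F i) n) * r ^ Suc n" for n
      using * by (intro mult_left_mono power_mono) auto
    with * show "\<forall>n. norm (fps_nth (F i) n) * s ^ Suc n \<le> 1" by (meson order_trans)
  qed
  then obtain r where r: "r > 0" "\<And>i n. i < k \<Longrightarrow> norm (fps_nth (F i) n) * r ^ Suc n \<le> 1" by blast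
  show thesis
  proof (rule that)
    show "max 1 (1 / r) \<ge> 1" by simp
    fix i n assume "i < k"
    then have "norm (fps_nth (F i) n) \<le> (1 / r) ^ Suc n"
      using r(2)[of i n] r(1) by (simp add: field_simps power_divide)
    also have "\<dots> \<le> max 1 (1 / r) ^ Suc n" using r(1) by (intro power_mono) auto
    finally show "norm (fps_nth (F i) n) \<le> max 1 (1 / r) ^ Suc n" .
  qed
qed

lemma conv_radius_geometric:
  fixes F :: "complex fps"
  assumes "N > 0" "\<And>n. norm (fps_nth F n) \<le> K * N ^ n"
  shows "fps_conv_radius F > 0"
proof -
  have "summable (\<lambda>n. fps_nth F n * of_real (1 / (2 * N)) ^ n)"
  proof (rule summable_comparison_test')
    show "summable (\<lambda>n. K * (1 / 2) ^ n :: real)" by (intro summable_mult summable_geometric) simp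
    show "norm (fps_nth F n * of_real (1 / (2 * N)) ^ n) \<le> K * (1 / 2) ^ n" if "n \<ge> 0" for n
    proof -
      have "norm (of_real (1 / (2 * N)) :: complex) = 1 / (2 * N)" unfolding norm_of_real using assms(1) by simp
      then have "norm (fps_nth F n * of_real (1 / (2 * N)) ^ n) \<le> K * N ^ n * (1 / (2 * N)) ^ n"
        unfolding norm_mult norm_power using assms by (simp add: mult_right_mono)
      also have "\<dots> = K * (1 / 2) ^ n" using assms(1) by (simp add: field_simps power_mult_distrib)
      finally show ?thesis .
    qed
  qed
  from conv_radius_geI[OF this] have "fps_conv_radius F \<ge> ereal (norm (of_real (1 / (2 * N)) :: complex))"
    by (simp add: fps_conv_radius_def)
  moreover have "norm (of_real (1 / (2 * N)) :: complex) > 0" using assms(1) unfolding norm_of_real by simp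
  ultimately show ?thesis by (metis ereal_less(2) order_less_le_trans)
qed

text \<open>The solution \<open>e\<close> of the unitriangular system
  \<open>r n = e 0 * b 0 n + ... + e (n - 1) * b (n - 1) n + e n\<close>.\<close>

fun forward_subst :: "(nat \<Rightarrow> complex) \<Rightarrow> (nat \<Rightarrow> nat \<Rightarrow> complex) \<Rightarrow> nat \<Rightarrow> complex" where
  "forward_subst r b n = r n - (\<Sum>k<n. forward_subst r b k * b k n)"

declare forward_subst.simps [simp del]

text \<open>The contributions of earlier unknowns form a geometric series with
  \<open>K * (1 + (1 + K) + ... + (1 + K)^(n - 1)) = (1 + K)^n - 1\<close>. Adding the bound for
  \<open>r n\<close> gives exactly the rate \<open>M * (1 + K)\<close>.\<close>

lemma forward_subst_bound:
  assumes "M \<ge> 0" "K \<ge> 0" "\<And>n. norm (r n) \<le> K * M ^ n" "\<And>k n. k < n \<Longrightarrow> norm (b k n) \<le> K * M ^ (n - k)"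
  shows "norm (forward_subst r b n) \<le> K * (M * (1 + K)) ^ n"
proof (induction n rule: less_induct)
  case (less n)
  have "norm (forward_subst r b n) \<le> norm (r n) + norm (\<Sum>k<n. forward_subst r b k * b k n)"
    unfolding forward_subst.simps[of r b n] by (rule norm_triangle_ineq4)
  also have "norm (\<Sum>k<n. forward_subst r b k * b k n) \<le> (\<Sum>k<n. K * M ^ n * K * (1 + K) ^ k)"
  proof (rule sum_norm_le)
    fix k assume k: "k \<in> {..<n}"
    have "norm (forward_subst r b k * b k n) \<le> K * (M * (1 + K)) ^ k * (K * M ^ (n - k))"
      unfolding norm_mult using less k assms by (intro mult_mono) auto
    also have "\<dots> = K * (M ^ k * M ^ (n - k)) * K * (1 + K) ^ k" by (simp add: power_mult_distrib mult_ac)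
    also have "M ^ k * M ^ (n - k) = M ^ n" using k by (simp flip: power_add)
    finally show "norm (forward_subst r b k * b k n) \<le> K * M ^ n * K * (1 + K) ^ k" .
  qed
  also have "norm (r n) \<le> K * M ^ n" by (rule assms)
  also have "(\<Sum>k<n. K * M ^ n * K * (1 + K) ^ k) = K * M ^ n * (K * (\<Sum>k<n. (1 + K) ^ k))"
    by (simp add: sum_distrib_left mult_ac)
  also have "K * (\<Sum>k<n. (1 + K) ^ k) = (1 + K) ^ n - 1"
    by (induction n) (auto simp: algebra_simps)
  finally show ?case by (simp add: power_mult_distrib right_diff_distrib mult.assoc)
qed

text \<open>Powers of \<open>a\<close> beyond exponent \<open>l\<close> do not reach the coefficient
  \<open>l\<close>. A range of summation common to all factors allows the sums to be
  interchanged.\<close>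

lemma compose_mult_nth:
  fixes F a p :: "complex fps"
  assumes "fps_nth a 0 = 0"
  shows "fps_nth ((F oo a) * p) l = (\<Sum>q<Suc l. fps_nth F q * fps_nth (a ^ q * p) l)"
proof -
  have *: "fps_nth (F oo a) i = (\<Sum>q<Suc l. fps_nth F q * fps_nth (a ^ q) i)" if "i \<le> l" for i
    unfolding fps_compose_nth using that assms
    by (intro sum.mono_neutral_left) (auto simp: startsby_zero_power_prefix)
  have "fps_nth ((F oo a) * p) l = (\<Sum>i=0..l. (\<Sum>q<Suc l. fps_nth F q * fps_nth (a ^ q) i) * fps_nth p (l - i))"
    unfolding fps_mult_nth using * by (intro sum.cong) auto
  also have "\<dots> = (\<Sum>q<Suc l. \<Sum>i=0..l. fps_nth F q * fps_nth (a ^ q) i * fps_nth p (l - i))"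
    unfolding sum_distrib_right by (rule sum.swap)
  also have "\<dots> = (\<Sum>q<Suc l. fps_nth F q * fps_nth (a ^ q * p) l)"
    unfolding fps_mult_nth sum_distrib_left by (simp add: mult.assoc)
  finally show ?thesis .
qed

text \<open>
  Once \<open>v\<close> consecutive values occur, \<open>\<complex>{t}\<close> above order \<open>c\<close> is spanned over \<open>\<complex>{t ^ v}\<close> by elements
  realising them.  The coefficients are found by forward substitution, and their geometric growth
  makes the resulting power series convergent.
\<close>

lemma conductor_pull:
  assumes \<phi>: "germ m \<phi>" and m: "m > 0" and \<phi>0: "\<phi> 0 = fps_X ^ v" and v: "v > 0"
    and vals: "\<And>s. c \<le> s \<Longrightarrow> s < c + v \<Longrightarrow> s \<in> values_upto m \<phi>"
    and R: "fps_conv_radius R > 0" "\<And>j. j < c \<Longrightarrow> fps_nth R j = 0"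
  shows "\<exists>g\<in>conv_ps m. pull g \<phi> = R"
proof -
  have "\<exists>f\<in>conv_ps m. fps_nth (pull f \<phi>) (c + j) = 1 \<and> (\<forall>l<c + j. fps_nth (pull f \<phi>) l = 0)" if "j < v" for j
  proof -
    from vals[of "c + j"] that have "c + j \<in> values_upto m \<phi>" by simp
    then obtain h where h: "h \<in> conv_ps m" "fps_nth (pull h \<phi>) (c + j) \<noteq> 0" "\<And>l. l < c + j \<Longrightarrow> fps_nth (pull h \<phi>) l = 0"
      using values_uptoE by blast
    let ?a = "inverse (fps_nth (pull h \<phi>) (c + j))"
    have "(\<lambda>x. ?a * h x) \<in> conv_ps m" by (intro conv_ps_mult h) simp
    moreover have "pull (\<lambda>x. ?a * h x) \<phi> = fps_const ?a * pull h \<phi>"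
      using pull_mult[OF conv_ps_const h(1) \<phi>, of ?a] by simp
    ultimately show ?thesis using h by (intro bexI[of _ "\<lambda>x. ?a * h x"]) auto
  qed
  then obtain f where f: "\<And>j. j < v \<Longrightarrow> f j \<in> conv_ps m" "\<And>j. j < v \<Longrightarrow> fps_nth (pull (f j) \<phi>) (c + j) = 1"
    "\<And>j l. j < v \<Longrightarrow> l < c + j \<Longrightarrow> fps_nth (pull (f j) \<phi>) l = 0"
    by metis
  \<comment> \<open>\<open>R\<close> is stored at index \<open>v\<close> so that one constant
    \<open>M\<close> bounds its coefficients too.\<close>
  define p where "p j = (if j < v then pull (f j) \<phi> else R)" for j
  have "fps_conv_radius (p j) > 0" if "j < Suc v" for j
    using pull_conv_radius[OF f(1) \<phi>] R(1) by (auto simp: p_def)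
  then obtain M where M: "M \<ge> 1" "\<And>j n. j < Suc v \<Longrightarrow> norm (fps_nth (p j) n) \<le> M ^ Suc n"
    using geometric_coeff_bound[of "Suc v" p] by blast
  define K where "K = M ^ Suc (c + v)"
  have K: "K \<ge> 0" using M(1) by (simp add: K_def)
  \<comment> \<open>\<open>B k\<close> has order \<open>c + k\<close> and leading coefficient 1, so
    expressing \<open>R\<close> through the \<open>B k\<close> is a unitriangular system.\<close>
  define B where "B k = fps_X ^ (v * (k div v)) * p (k mod v)" for k
  have modv: "k mod v < v" for k using v by simp
  have B_nth: "fps_nth (B k) (c + n) = (if n < k then 0 else fps_nth (p (k mod v)) (c + k mod v + (n - k)))" for k n
  proof -
    have k: "k = v * (k div v) + k mod v" by simp
    consider "c + n < v * (k div v)" | "v * (k div v) \<le> c + n" "n < k" | "k \<le> n" by linarith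
    then show ?thesis
    proof cases
      case 1
      then have "n < k" using k by linarith
      with 1 show ?thesis by (simp add: B_def fps_X_power_mult_nth)
    next
      case 2
      then have "c + n - v * (k div v) < c + k mod v" using k by linarith
      then show ?thesis using 2 f(3)[OF modv] modv by (simp add: B_def fps_X_power_mult_nth p_def)
    next
      case 3
      then have "c + n - v * (k div v) = c + k mod v + (n - k)" using k by linarith
      moreover have "v * (k div v) \<le> c + n" using k 3 by linarith
      ultimately show ?thesis using 3 by (simp add: B_def fps_X_power_mult_nth)
    qed
  qed
  have B_diag: "fps_nth (B n) (c + n) = 1" for n
    using B_nth[of n n] f(2)[OF modv] modv by (simp add: p_def)
  have B_low: "fps_nth (B k) l = 0" if "l < c" for k l
    using that f(3)[OF modv, of "l - v * (k div v)" k] modv[of k] by (simp add: B_def fps_X_power_mult_nth p_def)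
  define e where "e = forward_subst (\<lambda>n. fps_nth R (c + n)) (\<lambda>k n. fps_nth (B k) (c + n))"
  have M_mono: "M ^ i \<le> M ^ j" if "i \<le> j" for i j using M(1) that by (rule power_increasing[rotated])
  have e_bound: "norm (e n) \<le> K * (M * (1 + K)) ^ n" for n
    unfolding e_def
  proof (rule forward_subst_bound[OF _ K])
    show "norm (fps_nth R (c + n)) \<le> K * M ^ n" for n
    proof -
      have "norm (fps_nth R (c + n)) \<le> M ^ Suc (c + n)" using M(2)[of v "c + n"] by (simp add: p_def)
      also have "\<dots> \<le> M ^ (Suc (c + v) + n)" by (rule M_mono) simp
      finally show ?thesis by (simp only: K_def power_add)
    qed
    show "norm (fps_nth (B k) (c + n)) \<le> K * M ^ (n - k)" if "k < n" for k n
    proof -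
      have "norm (fps_nth (B k) (c + n)) \<le> M ^ Suc (c + k mod v + (n - k))"
        unfolding B_nth using that M(2)[of "k mod v"] modv[of k] by (auto simp del: power_Suc)
      also have "\<dots> \<le> M ^ (Suc (c + v) + (n - k))" by (rule M_mono) (use modv[of k] in auto)
      finally show ?thesis by (simp only: K_def power_add)
    qed
  qed (use M in auto)
  \<comment> \<open>The coefficients of all \<open>B k\<close> with \<open>k\<close> congruent to
    \<open>j\<close> modulo \<open>v\<close>, collected into a series in the first coordinate, which
    is \<open>t^v\<close> on the curve.\<close>
  define u where "u j = Abs_fps (\<lambda>q. e (q * v + j))" for j
  have u: "fps_conv_radius (u j) > 0" for j
  proof (rule conv_radius_geometric)
    let ?N = "M * (1 + K)"
    have N: "?N > 0" using M(1) K by (intro mult_pos_pos) auto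
    then show "?N ^ v > 0" by simp
    show "norm (fps_nth (u j) n) \<le> (K * ?N ^ j) * (?N ^ v) ^ n" for n
      using e_bound[of "n * v + j"] by (simp add: u_def power_add power_mult mult_ac flip: power_mult)
  qed
  define g where "g x = (\<Sum>j<v. eval_fps (u j) (x 0) * f j x)" for x
  have summand: "(\<lambda>x. eval_fps (u j) (x 0) * f j x) \<in> conv_ps m" if "j < v" for j
    by (intro conv_ps_mult conv_ps_eval_fps u m f that)
  have g: "g \<in> conv_ps m" unfolding g_def[abs_def] by (intro conv_ps_sum summand) auto
  have "pull g \<phi> = (\<Sum>j<v. pull (\<lambda>x. eval_fps (u j) (x 0) * f j x) \<phi>)"
    unfolding g_def[abs_def] by (rule pull_sum[OF summand \<phi>]) auto
  also have "\<dots> = (\<Sum>j<v. (u j oo fps_X ^ v) * p j)"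
  proof (rule sum.cong[OF refl])
    fix j assume "j \<in> {..<v}"
    then have "pull (\<lambda>x. eval_fps (u j) (x 0) * f j x) \<phi> = pull (\<lambda>x. eval_fps (u j) (x 0)) \<phi> * pull (f j) \<phi>"
      by (intro pull_mult[OF _ _ \<phi>] conv_ps_eval_fps u m f) auto
    also have "pull (\<lambda>x. eval_fps (u j) (x 0)) \<phi> = u j oo fps_X ^ v"
      using pull_eval_fps[of "u j" \<phi>] u v by (simp add: \<phi>0)
    finally show "pull (\<lambda>x. eval_fps (u j) (x 0) * f j x) \<phi> = (u j oo fps_X ^ v) * p j"
      using \<open>j \<in> {..<v}\<close> by (simp add: p_def)
  qed
  finally have pg: "pull g \<phi> = (\<Sum>j<v. (u j oo fps_X ^ v) * p j)" .
  have nth: "fps_nth (pull g \<phi>) l = (\<Sum>k<Suc l * v. e k * fps_nth (B k) l)" for l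
  proof -
    have "fps_nth (pull g \<phi>) l = (\<Sum>j<v. \<Sum>q<Suc l. fps_nth (u j) q * fps_nth ((fps_X ^ v) ^ q * p j) l)"
      unfolding pg fps_sum_nth using v by (intro sum.cong refl compose_mult_nth) simp
    also have "\<dots> = (\<Sum>q<Suc l. \<Sum>j<v. e (q * v + j) * fps_nth (B (q * v + j)) l)"
      by (subst sum.swap) (simp add: u_def B_def power_mult)
    also have "\<dots> = (\<Sum>q<Suc l. \<Sum>k\<in>{q * v..<q * v + v}. e k * fps_nth (B k) l)"
    proof (rule sum.cong[OF refl])
      fix q
      show "(\<Sum>j<v. e (q * v + j) * fps_nth (B (q * v + j)) l) = (\<Sum>k\<in>{q * v..<q * v + v}. e k * fps_nth (B k) l)"
        using sum.shift_bounds_nat_ivl[of "\<lambda>k. e k * fps_nth (B k) l" 0 "q * v" v]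
        by (simp add: atLeast0LessThan add.commute)
    qed
    also have "\<dots> = (\<Sum>k<Suc l * v. e k * fps_nth (B k) l)" by (rule sum.nat_group)
    finally show ?thesis .
  qed
  have "fps_nth (pull g \<phi>) l = fps_nth R l" for l
  proof (cases "l < c")
    case True
    then show ?thesis using R(2) B_low by (simp add: nth)
  next
    case False
    then obtain n where l: "l = c + n" using le_Suc_ex not_less by blast
    \<comment> \<open>The finite sum for the coefficient \<open>l\<close> reaches the diagonal term;
      all later terms vanish.\<close>
    have "n < Suc l * v" using v l by (cases v) auto
    then have "(\<Sum>k<Suc l * v. e k * fps_nth (B k) l) = (\<Sum>k<Suc n. e k * fps_nth (B k) l)"
      by (intro sum.mono_neutral_right) (auto simp: l B_nth)
    also have "\<dots> = fps_nth R l"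
      unfolding l sum.lessThan_Suc B_diag by (subst (2) e_def, subst forward_subst.simps) (simp add: e_def)
    finally show ?thesis using nth by simp
  qed
  then have "pull g \<phi> = R" by (rule fps_ext)
  with g show ?thesis by blast
qed

section \<open>Residue classes and the Apery set\<close>

lemma is_min_unique: "is_min a S \<Longrightarrow> is_min b S \<Longrightarrow> a = b"
  by (auto simp: is_min_def intro: antisym)

text \<open>The Apery elements represent every residue class modulo \<open>v0\<close>, and each
  class other than that of \<open>V\<close> has its representative at most
  \<open>a (v0 - 2)\<close>, below \<open>V\<close>. A representative congruent to \<open>x\<close>
  and smaller than \<open>x + v0\<close> is at most \<open>x\<close>, so multiples of
  \<open>v0\<close> lead from it to \<open>x\<close>.\<close>

lemma apery_tail:
  assumes ap: "is_apery S a" and v0: "is_min v0 (S - {0})" and add: "\<And>s. s \<in> S \<Longrightarrow> s + v0 \<in> S"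
    and 0: "0 \<in> S" and v2: "v0 \<ge> 2"
    and V: "[V = a (v0 - 1)] (mod v0)" "a (v0 - 2) < V"
    and x: "V < x + v0" "x mod v0 \<noteq> V mod v0"
  shows "x \<in> S"
proof -
  let ?U = "\<lambda>i. \<Union>j<i. {a j + v0 * k | k. True}"
  have a0: "a 0 = 0" and a: "\<And>i. 1 \<le> i \<Longrightarrow> i < v0 \<Longrightarrow> is_min (a i) (S - ?U i)"
    using ap is_min_unique[OF v0] unfolding is_apery_def by metis+
  have aS: "a i \<in> S" if "i < v0" for i
    using a[of i] that a0 0 by (cases "i = 0") (auto simp: is_min_def)
  \<comment> \<open>The removed sets grow with the index, so \<open>a j\<close> competes in the
    minimum that defines \<open>a i\<close>.\<close>
  have mono: "a i \<le> a j" if "i < j" "j < v0" for i j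
  proof (cases "i = 0")
    case False
    then have ai: "is_min (a i) (S - ?U i)" and aj: "is_min (a j) (S - ?U j)" using a that by auto
    have "?U i \<subseteq> ?U j" using that by (intro UN_mono) auto
    then have "a j \<in> S - ?U i" using aj unfolding is_min_def by blast
    then show ?thesis using ai unfolding is_min_def by blast
  qed (simp add: a0)
  have ne: "a i mod v0 \<noteq> a j mod v0" if "i < j" "j < v0" for i j
  proof
    assume eq: "a i mod v0 = a j mod v0"
    then have "v0 dvd a j - a i" using mod_eq_dvd_iff_nat[OF mono[OF that], of v0] eq by simp
    then obtain k where "a j - a i = v0 * k" by (auto elim: dvdE)
    then have "a j = a i + v0 * k" using mono[OF that] by simp
    then have "a j \<in> ?U j" using that by blast
    then show False using a[of j] that by (auto simp: is_min_def)
  qed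
  have "inj_on (\<lambda>i. a i mod v0) {..<v0}"
  proof (rule inj_onI)
    fix i j assume "i \<in> {..<v0}" "j \<in> {..<v0}" "a i mod v0 = a j mod v0"
    then show "i = j" using ne[of i j] ne[of j i] by (cases i j rule: linorder_cases) auto
  qed
  then have "(\<lambda>i. a i mod v0) ` {..<v0} = {..<v0}"
    using v2 by (intro endo_inj_surj) auto
  moreover have "x mod v0 \<in> {..<v0}" using v2 by simp
  ultimately obtain j where j: "j < v0" "a j mod v0 = x mod v0" by (metis (no_types, lifting) imageE lessThan_iff)
  have "j \<noteq> v0 - 1" using x(2) V(1) j(2) by (auto simp: cong_def)
  then have "a j \<le> a (v0 - 2)" using mono[of j "v0 - 2"] j v2 by (cases "j = v0 - 2") auto
  then have lt: "a j < x + v0" using V(2) x(1) by simp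
  have "a j \<le> x"
  proof (rule ccontr)
    assume "\<not> a j \<le> x"
    then have "v0 dvd a j - x" using j(2) mod_eq_dvd_iff_nat[of x "a j" v0] by simp
    then have "v0 \<le> a j - x" using \<open>\<not> a j \<le> x\<close> by (intro dvd_imp_le) auto
    then show False using lt \<open>\<not> a j \<le> x\<close> by simp
  qed
  then have "v0 dvd x - a j" using j(2) mod_eq_dvd_iff_nat[of "a j" x v0] by simp
  then obtain k where "x - a j = v0 * k" by (auto elim: dvdE)
  then have "x = a j + v0 * k" using \<open>a j \<le> x\<close> by simp
  moreover have "a j + v0 * k \<in> S" for k
  proof (induction k)
    case (Suc k)
    have "a j + v0 * Suc k = a j + v0 * k + v0" by simp
    then show ?case using add[OF Suc] by metis
  qed (use aS[OF j(1)] in simp)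
  ultimately show ?thesis by simp
qed

section \<open>Elimination of terms\<close>

lemma fps_mult_nth_eq_0:
  fixes F G :: "'a :: comm_ring_1 fps"
  assumes "\<And>p. p < a \<Longrightarrow> fps_nth F p = 0" "\<And>p. p < b \<Longrightarrow> fps_nth G p = 0" "j < a + b"
  shows "fps_nth (F * G) j = 0"
  unfolding fps_mult_nth
proof (rule sum.neutral, rule ballI)
  fix p assume "p \<in> {0..j}"
  then have "p < a \<or> j - p < b" using assms(3) by auto
  then show "fps_nth F p * fps_nth G (j - p) = 0" using assms(1,2) by auto
qed

text \<open>In the factorisation of the difference of two \<open>i\<close>-th powers,
  \<open>\<beta> - \<beta>'\<close>, of order at least \<open>d\<close>, is multiplied by products
  of \<open>i - 1\<close> series without constant term.\<close>

lemma fps_power_agree: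
  fixes \<beta> \<beta>' :: "'a :: idom fps"
  assumes "fps_nth \<beta> 0 = 0" "fps_nth \<beta>' 0 = 0" "\<And>j. j < d \<Longrightarrow> fps_nth \<beta> j = fps_nth \<beta>' j" "Suc j < d + i"
  shows "fps_nth (\<beta> ^ i) j = fps_nth (\<beta>' ^ i) j"
  using assms(4)
proof (induction i arbitrary: j)
  case (Suc i)
  have "fps_nth (\<beta> * (\<beta> ^ i - \<beta>' ^ i)) j = 0"
    by (rule fps_mult_nth_eq_0[of 1 _ "d + i - 1"]) (use Suc assms(1) in auto)
  moreover have "fps_nth ((\<beta> - \<beta>') * \<beta>' ^ i) j = 0"
    by (rule fps_mult_nth_eq_0[of d _ i]) (use Suc.prems assms(3) startsby_zero_power_prefix[OF assms(2)] in auto)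
  moreover have "\<beta> ^ Suc i - \<beta>' ^ Suc i = \<beta> * (\<beta> ^ i - \<beta>' ^ i) + (\<beta> - \<beta>') * \<beta>' ^ i"
    by (simp add: algebra_simps)
  ultimately have "fps_nth (\<beta> ^ Suc i - \<beta>' ^ Suc i) j = 0" by simp
  then show ?case by simp
qed simp

text \<open>Apart from its constant term the outer series starts at order \<open>k\<close>, which
  improves agreement below \<open>d\<close> to agreement below \<open>d + k - 1\<close>. This gain
  keeps a change of the reparametrization away from the low orders of a component.\<close>

lemma fps_compose_agree:
  fixes A \<beta> \<beta>' :: "'a :: idom fps"
  assumes "fps_nth \<beta> 0 = 0" "fps_nth \<beta>' 0 = 0" "\<And>j. j < d \<Longrightarrow> fps_nth \<beta> j = fps_nth \<beta>' j"
    and "\<And>i. 0 < i \<Longrightarrow> i < k \<Longrightarrow> fps_nth A i = 0" "Suc j < d + k"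
  shows "fps_nth (A oo \<beta>) j = fps_nth (A oo \<beta>') j"
  unfolding fps_compose_nth
proof (rule sum.cong[OF refl])
  fix i
  consider "i = 0" | "0 < i" "i < k" | "k \<le> i" by linarith
  then show "fps_nth A i * fps_nth (\<beta> ^ i) j = fps_nth A i * fps_nth (\<beta>' ^ i) j"
  proof cases
    case 3
    then show ?thesis using fps_power_agree[OF assms(1-3), of d j i] assms(5) by simp
  qed (use assms(4) in auto)
qed

lemma fps_compose_agree_left:
  fixes A A' \<beta> :: "'a :: idom fps"
  assumes "\<And>i. i < d \<Longrightarrow> fps_nth A i = fps_nth A' i" "j < d"
  shows "fps_nth (A oo \<beta>) j = fps_nth (A' oo \<beta>) j"
  unfolding fps_compose_nth by (rule sum.cong) (use assms in auto)

lemma fps_inv_nth_0 [simp]: "fps_nth (fps_inv \<rho>) 0 = (0 :: 'a :: field)"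
  by (simp add: fps_inv_def)

text \<open>The inverse of \<open>\<rho>'\<close> is the inverse of \<open>\<rho>\<close> composed
  with \<open>\<rho> oo fps_inv \<rho>'\<close>, and the latter agrees with the identity below order
  \<open>d\<close>.\<close>

lemma fps_inv_agree:
  fixes \<rho> \<rho>' :: "complex fps"
  assumes "fps_nth \<rho> 0 = 0" "fps_nth \<rho> 1 \<noteq> 0" "fps_nth \<rho>' 0 = 0" "fps_nth \<rho>' 1 \<noteq> 0"
    and "\<And>j. j < d \<Longrightarrow> fps_nth \<rho> j = fps_nth \<rho>' j" "j < d"
  shows "fps_nth (fps_inv \<rho>) j = fps_nth (fps_inv \<rho>') j"
proof -
  have "fps_inv \<rho> oo (\<rho> oo fps_inv \<rho>') = (fps_inv \<rho> oo \<rho>) oo fps_inv \<rho>'"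
    by (rule fps_compose_assoc) (use assms(1) in auto)
  also have "\<dots> = fps_inv \<rho>'"
    using assms(1,2) by (simp add: fps_inv fps_X_fps_compose_startby0)
  finally have 1: "fps_inv \<rho>' = fps_inv \<rho> oo (\<rho> oo fps_inv \<rho>')" by simp
  have "fps_nth (\<rho> oo fps_inv \<rho>') i = fps_nth (\<rho>' oo fps_inv \<rho>') i" if "i < d" for i
    by (rule fps_compose_agree_left[OF assms(5) that])
  then have 2: "fps_nth (\<rho> oo fps_inv \<rho>') i = fps_nth fps_X i" if "i < d" for i
    using that assms(3,4) by (simp add: fps_inv_right)
  have "fps_nth (fps_inv \<rho> oo (\<rho> oo fps_inv \<rho>')) j = fps_nth (fps_inv \<rho> oo fps_X) j"
    by (rule fps_compose_agree[where d = d and k = 1]) (use assms 2 in auto)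
  then show ?thesis using 1 by simp
qed

text \<open>The point is convergence of the inverse series; it is supplied by the inverse of
  unipotent germs in one variable.\<close>

lemma Diff_lineI:
  assumes \<rho>: "fps_conv_radius \<rho> > 0" "fps_nth \<rho> 0 = 0" "fps_nth \<rho> 1 = 1"
  shows "\<rho> \<in> Diff_line"
proof -
  define \<sigma> :: "nat \<Rightarrow> (nat \<Rightarrow> complex) \<Rightarrow> complex" where "\<sigma> i x = eval_fps \<rho> (x 0)" for i x
  note exp = eval_fps_has_fps_expansion[OF \<rho>(1)]
  have "\<sigma> \<in> Diff_space 1"
  proof (rule Diff_space_unipotent)
    show "\<sigma> i \<in> conv_ps 1" for i unfolding \<sigma>_def[abs_def] by (rule conv_ps_eval_fps[OF \<rho>(1)]) simp
    show "\<sigma> i (\<lambda>_. 0) = 0" for i using \<rho>(2) by (simp add: \<sigma>_def eval_fps_at_0)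
    show "jac0 \<sigma> i i = 1" if "i < 1" for i
      using that fps_nth_fps_expansion[OF exp, of 1] \<rho>(3) by (simp add: jac0_def \<sigma>_def)
  qed simp
  then obtain \<tau> where \<tau>: "\<tau> 0 \<in> conv_ps 1" "\<tau> 0 (\<lambda>_. 0) = 0"
    and inv: "near0 1 (\<lambda>x. \<forall>i<1. \<sigma> i (\<lambda>j. \<tau> j x) = x i \<and> \<tau> i (\<lambda>j. \<sigma> j x) = x i)"
    unfolding Diff_space_def by auto
  have g: "germ 1 (\<lambda>_. fps_X)" by (simp add: germ_def)
  define \<beta> where "\<beta> = pull (\<tau> 0) (\<lambda>_. fps_X)"
  have \<beta>: "fps_conv_radius \<beta> > 0" "fps_nth \<beta> 0 = 0"
    unfolding \<beta>_def using pull_conv_radius[OF \<tau>(1) g] pull_nth_0[OF \<tau>(1) g] \<tau>(2) by auto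
  have ev: "\<forall>\<^sub>F t in nhds 0. eval_fps \<rho> (\<tau> 0 (\<lambda>_. t)) = t \<and> \<tau> 0 (\<lambda>_. eval_fps \<rho> t) = t"
    using germ_eventually[OF inv g] by (simp add: \<sigma>_def)
  have X: "(\<lambda>t :: complex. t) has_fps_expansion fps_X" by (rule has_fps_expansion_fps_X)
  have "(\<lambda>t. \<tau> 0 (\<lambda>_. t)) has_fps_expansion \<beta>"
    unfolding \<beta>_def using pull_expansion[OF \<tau>(1) g] by simp
  from has_fps_expansion_compose[OF exp this \<beta>(2)]
  have "(\<lambda>t. eval_fps \<rho> (\<tau> 0 (\<lambda>_. t))) has_fps_expansion (\<rho> oo \<beta>)" by (simp add: o_def)
  then have "(\<lambda>t. t) has_fps_expansion (\<rho> oo \<beta>)"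
    by (rule has_fps_expansion_eventually) (use ev in \<open>auto elim: eventually_mono\<close>)
  then have 1: "\<rho> oo \<beta> = fps_X" using X by (rule fps_expansion_unique_complex)
  have g': "germ 1 (\<lambda>_. \<rho>)" using \<rho> by (simp add: germ_def)
  have "\<beta> oo \<rho> = pull (\<tau> 0) (\<lambda>_. fps_X oo \<rho>)"
    unfolding \<beta>_def by (rule pull_oo[OF \<tau>(1) g \<rho>(1,2), symmetric])
  also have "\<dots> = pull (\<tau> 0) (\<lambda>_. \<rho>)" using \<rho>(2) by (simp add: fps_X_fps_compose_startby0)
  also have "(\<lambda>t. t) has_fps_expansion \<dots>"
    by (rule has_fps_expansion_eventually[OF pull_expansion[OF \<tau>(1) g']]) (use ev in \<open>auto elim: eventually_mono\<close>)
  then have "pull (\<tau> 0) (\<lambda>_. \<rho>) = fps_X" using X by (rule fps_expansion_unique_complex)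
  finally have 2: "\<beta> oo \<rho> = fps_X" .
  show ?thesis unfolding Diff_line_def using \<rho> \<beta> 1 2 by blast
qed

text \<open>\<open>\<rho>\<close> is the \<open>v\<close>-th root of \<open>t^v + H\<close> that is
  tangent to the identity. Composing a first component \<open>t^v + H\<close> with the inverse of
  \<open>\<rho>\<close> therefore restores \<open>t^v\<close>.\<close>

lemma root_reparametrization:
  fixes H :: "complex fps"
  assumes v: "v > 0" and H: "fps_conv_radius H > 0" "\<And>j. j \<le> v \<Longrightarrow> fps_nth H j = 0"
  defines "\<rho> \<equiv> fps_X * (fps_binomial (1 / of_nat v) oo (H / fps_X ^ v))"
  shows "fps_nth \<rho> 0 = 0" "fps_nth \<rho> 1 = 1" "fps_conv_radius \<rho> > 0" "\<rho> ^ v = fps_X ^ v + H"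
proof -
  define K where "K = fps_shift v H"
  have K: "fps_conv_radius K > 0" "fps_nth K 0 = 0" using H by (auto simp: K_def)
  have \<rho>: "\<rho> = fps_X * (fps_binomial (1 / of_nat v) oo K)" by (simp add: \<rho>_def K_def)
  show "fps_nth \<rho> 0 = 0" "fps_nth \<rho> 1 = 1" by (simp_all add: \<rho>)
  have "fps_conv_radius (fps_binomial (1 / of_nat v) :: complex fps) > 0"
    by (simp add: fps_conv_radius_binomial)
  from has_fps_expansion_compose[OF eval_fps_has_fps_expansion[OF this] eval_fps_has_fps_expansion[OF K(1)] K(2)]
  have "fps_conv_radius (fps_binomial (1 / of_nat v) oo K) > 0" by (simp add: has_fps_expansion_def)
  then have "0 < min (fps_conv_radius (fps_X :: complex fps)) (fps_conv_radius (fps_binomial (1 / of_nat v) oo K))"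
    by simp
  then show "fps_conv_radius \<rho> > 0" unfolding \<rho> by (rule less_le_trans[OF _ fps_conv_radius_mult])
  have "\<rho> ^ v = fps_X ^ v * (fps_binomial (1 / of_nat v) ^ v oo K)"
    unfolding \<rho> power_mult_distrib by (simp add: fps_compose_power[OF K(2)])
  also have "fps_binomial (1 / of_nat v) ^ v = (1 + fps_X :: complex fps)"
    using v by (simp add: fps_binomial_power fps_binomial_1)
  also have "fps_X ^ v * ((1 + fps_X) oo K) = fps_X ^ v + fps_X ^ v * K"
    by (simp add: fps_compose_add_distrib fps_X_fps_compose_startby0 K(2) algebra_simps)
  also have "fps_X ^ v * K = H"
    by (rule fps_ext) (use H(2) in \<open>auto simp: K_def fps_X_power_mult_nth\<close>)
  finally show "\<rho> ^ v = fps_X ^ v + H" .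
qed

lemma fps_ord_gt: "fps_ord F > enat k \<longleftrightarrow> (\<forall>l\<le>k. fps_nth F l = 0)"
proof (cases "F = 0")
  case False
  then have "subdegree F > k \<longleftrightarrow> (\<forall>l\<le>k. fps_nth F l = 0)"
    using nth_subdegree_nonzero[OF False] by (metis leI le_less_trans nth_less_subdegree_zero)
  with False show ?thesis by (simp add: fps_ord_def)
qed (simp add: fps_ord_def)

lemma jet_nth: "fps_nth (jet k F) j = (if j \<le> k then fps_nth F j else 0)"
  by (simp add: jet_def)

lemma jet_cong: "(\<And>j. j \<le> k \<Longrightarrow> fps_nth F j = fps_nth G j) \<Longrightarrow> jet k F = jet k G"
  by (rule fps_ext) (simp add: jet_nth)

section \<open>Ideals under extension and restriction of coordinates\<close>

lemma ideal_ps_mono: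
  assumes "f \<in> ideal_ps m I e" "I \<subseteq> J" "finite J" "m \<le> k"
  shows "f \<in> ideal_ps k J e"
proof -
  obtain u where u: "f \<in> conv_ps m" "\<And>i. i \<in> I \<Longrightarrow> u i \<in> conv_ps m" "near0 m (\<lambda>x. f x = (\<Sum>i\<in>I. u i x * e i x))"
    using assms(1) unfolding ideal_ps_def by blast
  define u' where "u' i = (if i \<in> I then u i else (\<lambda>_. 0))" for i
  have "(\<Sum>i\<in>J. u' i x * e i x) = (\<Sum>i\<in>I. u i x * e i x)" for x
    using assms(2,3) by (intro sum.mono_neutral_cong_right) (auto simp: u'_def)
  then have "near0 k (\<lambda>x. f x = (\<Sum>i\<in>J. u' i x * e i x))"
    using near0_mono[OF u(3) assms(4)] by simp
  moreover have "u' i \<in> conv_ps k" for i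
    using conv_ps_mono[OF u(2) assms(4)] by (auto simp: u'_def)
  ultimately show ?thesis
    unfolding ideal_ps_def by (intro CollectI conjI conv_ps_mono[OF u(1) assms(4)] exI[of _ u']) auto
qed

lemma near0_restrict:
  assumes "near0 m P"
  shows "near0 k (\<lambda>x. P (\<lambda>i. if i < k then x i else 0))"
proof -
  obtain r where "r > 0" "\<forall>x\<in>polydisc m r. P x" using assms by (auto simp: near0_polydisc)
  then show ?thesis unfolding near0_polydisc
    by (intro exI[of _ r]) (auto simp: polydisc_def)
qed

text \<open>Setting coordinates to 0 kills the generators that involve them and fixes the others, so
  the ideal conditions on \<open>h k\<close> survive in fewer variables.\<close>

lemma ideal_ps_restrict:
  assumes "f \<in> ideal_ps m J e" "I \<subseteq> J" "finite J"
    and "\<And>i x. i \<in> I \<Longrightarrow> e i (\<lambda>i. if i < k then x i else 0) = e i x"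
    and "\<And>i x. i \<in> J - I \<Longrightarrow> e i (\<lambda>i. if i < k then x i else 0) = 0"
  shows "(\<lambda>x. f (\<lambda>i. if i < k then x i else 0)) \<in> ideal_ps k I e"
proof -
  let ?T = "\<lambda>(x :: nat \<Rightarrow> complex) i. if i < k then x i else 0"
  obtain u where u: "f \<in> conv_ps m" "\<And>i. i \<in> J \<Longrightarrow> u i \<in> conv_ps m" "near0 m (\<lambda>x. f x = (\<Sum>i\<in>J. u i x * e i x))"
    using assms(1) unfolding ideal_ps_def by blast
  have "(\<Sum>i\<in>J. u i (?T x) * e i (?T x)) = (\<Sum>i\<in>I. u i (?T x) * e i x)" for x
    using assms(2-5) by (intro sum.mono_neutral_cong_right) auto
  then have "near0 k (\<lambda>x. f (?T x) = (\<Sum>i\<in>I. u i (?T x) * e i x))"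
    using near0_restrict[OF u(3), of k] by simp
  moreover have "(\<lambda>x. u i (?T x)) \<in> conv_ps k" if "i \<in> I" for i
    using that assms(2) by (intro conv_ps_restrict[OF u(2)]) auto
  ultimately show ?thesis
    unfolding ideal_ps_def
    by (intro CollectI conjI conv_ps_restrict[OF u(1)] exI[of _ "\<lambda>i x. u i (?T x)"]) auto
qed

lemma zero_in_ideal_ps: "(\<lambda>_. 0) \<in> ideal_ps m I e"
proof -
  have "near0 m (\<lambda>x. 0 = (\<Sum>i\<in>I. 0 * e i x))" unfolding near0_def by (intro exI[of _ 1]) simp
  moreover have "\<forall>i\<in>I. (\<lambda>_. 0) \<in> conv_ps m" by simp
  ultimately show ?thesis
    unfolding ideal_ps_def by (intro CollectI conjI conv_ps_const exI[of _ "\<lambda>_ _. 0"])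
qed

section \<open>Transfer of eliminability between the two curves\<close>

lemma eliminable_extend:
  assumes \<phi>: "germ (Suc n) \<phi>" and elim: "eliminable n w \<phi> i l" and "i \<le> n"
  shows "eliminable (Suc n) (w(Suc n := V)) (\<phi>(Suc n := Y)) i l"
proof -
  let ?w = "w(Suc n := V)" and ?\<phi> = "\<phi>(Suc n := Y)"
  obtain \<rho> \<sigma> where adm: "admissible n w \<phi> \<rho> \<sigma>" and act0: "act \<rho> \<sigma> \<phi> 0 = fps_X ^ w 0"
    and jet: "jet l (act \<rho> \<sigma> \<phi> i) = jet (l - 1) (\<phi> i)"
    using elim unfolding eliminable_def by blast
  from adm obtain h where A1: "(\<rho>, \<sigma>) \<in> A1_tilde n" and h: "\<And>k. k \<le> n \<Longrightarrow> h k \<in> conv_ps (Suc n)"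
    and ideals: "\<And>k. k \<le> n \<Longrightarrow> \<exists>a \<in> ideal_ps (Suc n) {k<..n} (\<lambda>j x. x j). \<exists>b \<in> max_ideal_sq (Suc n). near0 (Suc n) (\<lambda>x. h k x = a x + b x)"
    and ord: "\<And>k. k \<le> n \<Longrightarrow> fps_ord (pull (h k) \<phi>) > enat (w k)"
    and \<rho>: "\<rho> = fps_X * (fps_binomial (1 / of_nat (w 0)) oo (pull (h 0) \<phi> / fps_X ^ w 0))"
    and \<sigma>h: "\<And>k. k \<le> n \<Longrightarrow> near0 (Suc n) (\<lambda>x. \<sigma> k x = x k + h k x)"
    unfolding admissible_def by blast
  have \<rho>D: "\<rho> \<in> Diff_line" "jet 1 \<rho> = fps_X" and \<sigma>D: "\<sigma> \<in> Diff_space (Suc n)"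
    and jac: "\<And>k. k \<le> n \<Longrightarrow> jac0 \<sigma> k k = 1" "\<And>k j. k \<le> n \<Longrightarrow> j < k \<Longrightarrow> jac0 \<sigma> k j = 0"
    using A1 unfolding A1_tilde_def by auto
  have \<sigma>: "\<sigma> k \<in> conv_ps (Suc n)" "\<sigma> k (\<lambda>_. 0) = 0" if "k \<le> n" for k
    using \<sigma>D that unfolding Diff_space_def by (auto simp: less_Suc_eq_le)
  \<comment> \<open>The new coordinate is left alone; its increment 0 has infinite order along the
    curve, hence order above \<open>V\<close>.\<close>
  define \<sigma>' where "\<sigma>' k = (if k \<le> n then \<sigma> k else (\<lambda>x. x k))" for k
  define h' where "h' k = (if k \<le> n then h k else (\<lambda>_. 0))" for k
  have pull_eq: "pull f ?\<phi> = pull f \<phi>" if "f \<in> conv_ps (Suc n)" for f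
    by (rule pull_dep[OF that \<phi>]) simp
  have jac': "jac0 \<sigma>' k k = 1" "\<And>j. j < k \<Longrightarrow> jac0 \<sigma>' k j = 0" if "k \<le> Suc n" for k
    using that jac by (auto simp: jac0_def \<sigma>'_def)
  have "\<sigma>' \<in> Diff_space (Suc (Suc n))"
  proof (rule Diff_space_unipotent)
    show "\<sigma>' k \<in> conv_ps (Suc (Suc n))" if "k < Suc (Suc n)" for k
      using that conv_ps_mono[OF \<sigma>(1), of k "Suc (Suc n)"] conv_ps_coord[OF that] by (auto simp: \<sigma>'_def)
  qed (use \<sigma> jac' in \<open>auto simp: \<sigma>'_def less_Suc_eq_le\<close>)
  then have A1': "(\<rho>, \<sigma>') \<in> A1_tilde (Suc n)"
    unfolding A1_tilde_def using \<rho>D jac' by auto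
  have "admissible (Suc n) ?w ?\<phi> \<rho> \<sigma>'"
    unfolding admissible_def
  proof (intro conjI exI[of _ h'] allI impI A1')
    fix k assume k: "k \<le> Suc n"
    show "h' k \<in> conv_ps (Suc (Suc n))"
      using conv_ps_mono[OF h, of k "Suc (Suc n)"] by (auto simp: h'_def)
    show "\<exists>a \<in> ideal_ps (Suc (Suc n)) {k<..Suc n} (\<lambda>j x. x j). \<exists>b \<in> max_ideal_sq (Suc (Suc n)).
             near0 (Suc (Suc n)) (\<lambda>x. h' k x = a x + b x)"
    proof (cases "k \<le> n")
      case True
      obtain a b where ab: "a \<in> ideal_ps (Suc n) {k<..n} (\<lambda>j x. x j)" "b \<in> max_ideal_sq (Suc n)"
        "near0 (Suc n) (\<lambda>x. h k x = a x + b x)" using ideals[OF True] by blast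
      have "a \<in> ideal_ps (Suc (Suc n)) {k<..Suc n} (\<lambda>j x. x j)"
        by (rule ideal_ps_mono[OF ab(1)]) auto
      moreover have "b \<in> max_ideal_sq (Suc (Suc n))"
        using ab(2) unfolding max_ideal_sq_def by (rule ideal_ps_mono) auto
      moreover have "near0 (Suc (Suc n)) (\<lambda>x. h' k x = a x + b x)"
        using near0_mono[OF ab(3)] True by (simp add: h'_def)
      ultimately show ?thesis by blast
    next
      case False
      have "near0 (Suc (Suc n)) (\<lambda>x. h' k x = 0 + 0)"
        using False by (auto simp: h'_def near0_def intro: zero_less_one)
      then show ?thesis
        unfolding max_ideal_sq_def by (intro bexI[of _ "\<lambda>_. 0"] zero_in_ideal_ps)
    qed
    show "fps_ord (pull (h' k) ?\<phi>) > enat (?w k)"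
    proof (cases "k \<le> n")
      case True
      then show ?thesis using ord[OF True] pull_eq[OF h[OF True]] by (simp add: h'_def)
    next
      case False
      have "pull (h' k) ?\<phi> = 0" using False by (simp add: h'_def)
      then show ?thesis by (simp add: fps_ord_def)
    qed
    show "near0 (Suc (Suc n)) (\<lambda>x. \<sigma>' k x = x k + h' k x)"
    proof (cases "k \<le> n")
      case True
      then show ?thesis using near0_mono[OF \<sigma>h[OF True]] by (simp add: h'_def \<sigma>'_def)
    qed (auto simp: h'_def \<sigma>'_def near0_def intro: zero_less_one)
  next
    show "\<rho> = fps_X * (fps_binomial (1 / of_nat (?w 0)) oo (pull (h' 0) ?\<phi> / fps_X ^ ?w 0))"
      using \<rho> pull_eq[OF h[of 0]] by (simp add: h'_def)
  qed
  moreover have "act \<rho> \<sigma>' ?\<phi> k = act \<rho> \<sigma> \<phi> k" if "k \<le> n" for k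
    using that pull_eq[OF \<sigma>(1)[OF that]] by (simp add: act_def \<sigma>'_def)
  ultimately show ?thesis
    unfolding eliminable_def using act0 jet \<open>i \<le> n\<close>
    by (intro exI[of _ \<rho>] exI[of _ \<sigma>']) auto
qed

text \<open>
  Dropping the last coordinate changes \<open>h 0\<close> along the curve from order \<open>V\<close> on, hence \<open>\<rho>\<close>
  from order \<open>V - w 0 + 1\<close> on, hence \<open>y i\<close> composed with the inverse of \<open>\<rho>\<close> only from
  order \<open>V - w 0 + w i > V\<close> on.
\<close>

lemma eliminable_restrict:
  assumes \<phi>: "germ (Suc (Suc n)) \<phi>" and \<phi>0: "\<phi> 0 = fps_X ^ w 0" and w0: "w 0 > 0"
    and w_mono: "\<And>k. 0 < k \<Longrightarrow> k \<le> n \<Longrightarrow> w 0 < w k" and wV: "\<And>k. k \<le> n \<Longrightarrow> w k < V"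
    and ordV: "\<And>l. l < V \<Longrightarrow> fps_nth (\<phi> (Suc n)) l = 0"
    and ord: "\<And>k l. k \<le> n \<Longrightarrow> l < w k \<Longrightarrow> fps_nth (\<phi> k) l = 0"
    and elim: "eliminable (Suc n) (w(Suc n := V)) \<phi> i l" and i: "0 < i" "i \<le> n" and l: "l < V"
    and \<psi>: "\<And>k. k \<le> n \<Longrightarrow> \<psi> k = \<phi> k"
  shows "eliminable n w \<psi> i l"
proof -
  let ?w = "w(Suc n := V)"
  define T :: "(nat \<Rightarrow> complex) \<Rightarrow> nat \<Rightarrow> complex" where "T x = (\<lambda>i. if i < Suc n then x i else 0)" for x
  obtain \<rho> \<sigma> where adm: "admissible (Suc n) ?w \<phi> \<rho> \<sigma>"
    and jet: "jet l (act \<rho> \<sigma> \<phi> i) = jet (l - 1) (\<phi> i)"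
    using elim unfolding eliminable_def by blast
  from adm obtain h where A1: "(\<rho>, \<sigma>) \<in> A1_tilde (Suc n)" and h: "\<And>k. k \<le> Suc n \<Longrightarrow> h k \<in> conv_ps (Suc (Suc n))"
    and ideals: "\<And>k. k \<le> Suc n \<Longrightarrow> \<exists>a \<in> ideal_ps (Suc (Suc n)) {k<..Suc n} (\<lambda>j x. x j).
        \<exists>b \<in> max_ideal_sq (Suc (Suc n)). near0 (Suc (Suc n)) (\<lambda>x. h k x = a x + b x)"
    and hord: "\<And>k. k \<le> Suc n \<Longrightarrow> fps_ord (pull (h k) \<phi>) > enat (?w k)"
    and \<rho>: "\<rho> = fps_X * (fps_binomial (1 / of_nat (w 0)) oo (pull (h 0) \<phi> / fps_X ^ w 0))"
    and \<sigma>h: "\<And>k. k \<le> Suc n \<Longrightarrow> near0 (Suc (Suc n)) (\<lambda>x. \<sigma> k x = x k + h k x)"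
    unfolding admissible_def by auto
  have \<sigma>D: "\<sigma> \<in> Diff_space (Suc (Suc n))"
    and jac: "\<And>k. k \<le> Suc n \<Longrightarrow> jac0 \<sigma> k k = 1" "\<And>k j. k \<le> Suc n \<Longrightarrow> j < k \<Longrightarrow> jac0 \<sigma> k j = 0"
    using A1 unfolding A1_tilde_def by auto
  have \<sigma>: "\<sigma> k \<in> conv_ps (Suc (Suc n))" "\<sigma> k (\<lambda>_. 0) = 0" if "k \<le> Suc n" for k
    using \<sigma>D that unfolding Diff_space_def by (auto simp: less_Suc_eq_le)
  define \<sigma>' where "\<sigma>' k x = \<sigma> k (T x)" for k x
  define h' where "h' k x = h k (T x)" for k x
  have conv': "(\<lambda>x. f (T x)) \<in> conv_ps (Suc n)" if "f \<in> conv_ps (Suc (Suc n))" for f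
    unfolding T_def by (rule conv_ps_restrict[OF that])
  have \<psi>g: "germ (Suc n) \<psi>" using \<phi> \<psi> by (auto simp: germ_def less_Suc_eq_le)
  \<comment> \<open>The last component has order at least \<open>V\<close>, so setting it to 0
    changes any germ along the curve only from order \<open>V\<close> on.\<close>
  have agree: "fps_nth (pull (\<lambda>x. f (T x)) \<psi>) j = fps_nth (pull f \<phi>) j" if "f \<in> conv_ps (Suc (Suc n))" "j < V" for f j
  proof -
    let ?\<chi> = "\<lambda>i. if i < Suc n then \<psi> i else 0"
    have g: "germ (Suc (Suc n)) ?\<chi>" using \<psi>g by (auto simp: germ_def)
    have "fps_nth (pull f \<phi>) j = fps_nth (pull f ?\<chi>) j"
    proof (rule pull_agree[OF that(1) \<phi> g _ that(2)])
      fix i j assume "i < Suc (Suc n)" "j < V"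
      then show "fps_nth (\<phi> i) j = fps_nth (?\<chi> i) j"
        using ordV \<psi> by (cases "i = Suc n") (auto simp: less_Suc_eq_le)
    qed
    then show ?thesis unfolding T_def pull_restrict ..
  qed
  have h'c: "h' k \<in> conv_ps (Suc n)" if "k \<le> n" for k
    unfolding h'_def[abs_def] using h[of k] that by (intro conv') simp
  have \<sigma>'c: "\<sigma>' k \<in> conv_ps (Suc n)" if "k \<le> n" for k
    unfolding \<sigma>'_def[abs_def] using \<sigma>[of k] that by (intro conv') simp
  have T0: "T (\<lambda>_. 0) = (\<lambda>_. 0)" by (auto simp: T_def)
  have Tupd: "T ((\<lambda>_. 0)(j := z)) = (\<lambda>_. 0)(j := z)" if "j \<le> n" for j z
    using that by (auto simp: T_def)
  have jac': "jac0 \<sigma>' k k = 1" "\<And>j. j < k \<Longrightarrow> jac0 \<sigma>' k j = 0" if "k \<le> n" for k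
    using that jac[of k] by (auto simp: jac0_def \<sigma>'_def Tupd)
  have \<sigma>'D: "\<sigma>' \<in> Diff_space (Suc n)"
    by (rule Diff_space_unipotent) (use \<sigma>'c jac' \<sigma> T0 in \<open>auto simp: \<sigma>'_def less_Suc_eq_le\<close>)
  have hord': "fps_nth (pull (h' k) \<psi>) j = 0" if "k \<le> n" "j \<le> w k" for k j
    using agree[OF h[of k], of j] hord[of k] that wV[of k] by (simp add: fps_ord_gt h'_def[abs_def])
  define H where "H = pull (h 0) \<phi>"
  define H' where "H' = pull (h' 0) \<psi>"
  have H: "fps_conv_radius H > 0" "\<And>j. j \<le> w 0 \<Longrightarrow> fps_nth H j = 0"
    unfolding H_def using pull_conv_radius[OF h[of 0] \<phi>] hord[of 0] by (auto simp: fps_ord_gt)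
  have H': "fps_conv_radius H' > 0" "\<And>j. j \<le> w 0 \<Longrightarrow> fps_nth H' j = 0"
    unfolding H'_def using pull_conv_radius[OF h'c[of 0] \<psi>g] hord'[of 0] by auto
  define \<rho>' where "\<rho>' = fps_X * (fps_binomial (1 / of_nat (w 0)) oo (H' / fps_X ^ w 0))"
  note \<rho>p = root_reparametrization[OF w0 H, folded H_def, unfolded H_def, folded \<rho>]
  note \<rho>'p = root_reparametrization[OF w0 H', folded \<rho>'_def]
  have \<rho>'D: "\<rho>' \<in> Diff_line" by (rule Diff_lineI[OF \<rho>'p(3,1,2)])
  have \<rho>'jet: "jet 1 \<rho>' = fps_X"
    using \<rho>'p(1,2) by (intro fps_ext) (auto simp: jet_nth fps_X_nth le_Suc_eq)
  have A1': "(\<rho>', \<sigma>') \<in> A1_tilde n"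
    unfolding A1_tilde_def using \<rho>'D \<sigma>'D \<rho>'jet jac' by auto
  have \<sigma>h': "near0 (Suc n) (\<lambda>x. \<sigma>' k x = x k + h' k x)" if "k \<le> n" for k
    using near0_restrict[OF \<sigma>h[of k], of "Suc n"] that
    by (simp add: \<sigma>'_def h'_def T_def)
  have "admissible n w \<psi> \<rho>' \<sigma>'"
    unfolding admissible_def
  proof (intro conjI exI[of _ h'] allI impI A1')
    fix k assume k: "k \<le> n"
    show "h' k \<in> conv_ps (Suc n)" by (rule h'c[OF k])
    show "near0 (Suc n) (\<lambda>x. \<sigma>' k x = x k + h' k x)" by (rule \<sigma>h'[OF k])
    show "fps_ord (pull (h' k) \<psi>) > enat (w k)" using hord'[OF k] by (simp add: fps_ord_gt)
    obtain a b where ab: "a \<in> ideal_ps (Suc (Suc n)) {k<..Suc n} (\<lambda>j x. x j)" "b \<in> max_ideal_sq (Suc (Suc n))"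
      "near0 (Suc (Suc n)) (\<lambda>x. h k x = a x + b x)" using ideals[of k] k by auto
    have "(\<lambda>x. a (T x)) \<in> ideal_ps (Suc n) {k<..n} (\<lambda>j x. x j)"
      unfolding T_def by (rule ideal_ps_restrict[OF ab(1)]) auto
    moreover have "(\<lambda>x. b (T x)) \<in> max_ideal_sq (Suc n)"
      using ab(2) unfolding max_ideal_sq_def T_def by (rule ideal_ps_restrict) (auto split: if_splits)
    moreover have "near0 (Suc n) (\<lambda>x. h' k x = a (T x) + b (T x))"
      using near0_restrict[OF ab(3), of "Suc n"] by (simp add: h'_def T_def)
    ultimately show "\<exists>a \<in> ideal_ps (Suc n) {k<..n} (\<lambda>j x. x j). \<exists>b \<in> max_ideal_sq (Suc n).
             near0 (Suc n) (\<lambda>x. h' k x = a x + b x)"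
      by (intro bexI[of _ "\<lambda>x. a (T x)"] bexI[of _ "\<lambda>x. b (T x)"])
  next
    show "\<rho>' = fps_X * (fps_binomial (1 / of_nat (w 0)) oo (pull (h' 0) \<psi> / fps_X ^ w 0))"
      by (simp add: \<rho>'_def H'_def)
  qed
  moreover have "act \<rho>' \<sigma>' \<psi> 0 = fps_X ^ w 0"
  proof -
    have "pull (\<sigma>' 0) \<psi> = pull (\<lambda>x. x 0 + h' 0 x) \<psi>"
      by (rule pull_cong[OF \<sigma>'c \<sigma>h' \<psi>g]) auto
    also have "\<dots> = pull (\<lambda>x. x 0) \<psi> + H'"
      unfolding H'_def by (rule pull_add[OF _ h'c \<psi>g]) (auto intro: conv_ps_coord)
    also have "pull (\<lambda>x. x 0) \<psi> = fps_X ^ w 0"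
      using pull_coord[OF \<psi>g, of 0] \<psi>[of 0] \<phi>0 by simp
    finally have "act \<rho>' \<sigma>' \<psi> 0 = \<rho>' ^ w 0 oo fps_inv \<rho>'" by (simp add: act_def \<rho>'p(4))
    also have "\<dots> = (\<rho>' oo fps_inv \<rho>') ^ w 0" by (simp add: fps_compose_power)
    also have "\<rho>' oo fps_inv \<rho>' = fps_X" using \<rho>'p by (intro fps_inv_right) auto
    finally show ?thesis .
  qed
  moreover have "jet l (act \<rho>' \<sigma>' \<psi> i) = jet (l - 1) (\<psi> i)"
  proof -
    define A where "A = pull (\<sigma> i) \<phi>"
    define d where "d = Suc (V - w 0)"
    have Vw: "w 0 < V" using wV[of 0] by simp
    have \<rho>agree: "fps_nth \<rho> j = fps_nth \<rho>' j" if "j < d" for j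
    proof (cases j)
      case 0
      then show ?thesis using \<rho>p(1) \<rho>'p(1) by simp
    next
      case (Suc j')
      have HH: "fps_nth H j = fps_nth H' j" if "j < V" for j
        using agree[OF h[of 0] that] by (simp add: H_def H'_def h'_def[abs_def])
      have "fps_nth (fps_binomial (1 / of_nat (w 0)) oo (H / fps_X ^ w 0)) j'
          = fps_nth (fps_binomial (1 / of_nat (w 0)) oo (H' / fps_X ^ w 0)) j'"
        by (rule fps_compose_agree[where d = "V - w 0" and k = 1])
           (use H(2) H'(2) HH \<open>j < d\<close> Suc in \<open>auto simp: d_def\<close>)
      then show ?thesis by (simp add: \<rho> \<rho>'_def Suc H_def)
    qed
    have inv: "fps_nth (fps_inv \<rho>) j = fps_nth (fps_inv \<rho>') j" if "j < d" for j
      by (rule fps_inv_agree[OF _ _ _ _ \<rho>agree that]) (use \<rho>p \<rho>'p in auto)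
    have A_low: "fps_nth A j = 0" if "j < w i" for j
    proof -
      have "A = pull (\<lambda>x. x i + h i x) \<phi>"
        unfolding A_def by (rule pull_cong[OF \<sigma>(1) \<sigma>h \<phi>]) (use i in auto)
      also have "\<dots> = \<phi> i + pull (h i) \<phi>"
        using pull_add[OF conv_ps_coord h \<phi>, of i i] pull_coord[OF \<phi>, of i] i by simp
      finally show ?thesis using ord[of i j] hord[of i] i that by (simp add: fps_ord_gt)
    qed
    have "fps_nth (act \<rho>' \<sigma>' \<psi> i) j = fps_nth (act \<rho> \<sigma> \<phi> i) j" if "j \<le> l" for j
    proof -
      have "fps_nth (act \<rho>' \<sigma>' \<psi> i) j = fps_nth (A oo fps_inv \<rho>') j"
        unfolding act_def A_def \<sigma>'_def[abs_def]
        by (rule fps_compose_agree_left[where d = V, OF agree[OF \<sigma>(1)]]) (use i l that in auto)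
      \<comment> \<open>Agreement holds below \<open>d + w i - 1 = V - w 0 + w i\<close>, which
        exceeds \<open>V\<close> because \<open>w 0 < w i\<close>.\<close>
      also have "\<dots> = fps_nth (A oo fps_inv \<rho>) j"
        by (rule fps_compose_agree[where d = d and k = "w i", symmetric])
           (use inv A_low w_mono[of i] i l that Vw in \<open>auto simp: d_def\<close>)
      finally show ?thesis by (simp add: act_def A_def)
    qed
    then have "jet l (act \<rho>' \<sigma>' \<psi> i) = jet l (act \<rho> \<sigma> \<phi> i)" by (rule jet_cong)
    then show ?thesis using jet \<psi>[of i] i by simp
  qed
  ultimately show ?thesis unfolding eliminable_def by blast
qed

section \<open>Truncation above the conductor\<close>

lemma P_setD:
  assumes "\<phi> \<in> P_set N w"
  shows "germ (Suc N) \<phi>" "\<phi> 0 = fps_X ^ w 0" "w 0 > 0"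
    and "\<And>i j. i < j \<Longrightarrow> j \<le> N \<Longrightarrow> w i < w j"
    and "\<And>i. i \<le> N \<Longrightarrow> fps_nth (\<phi> i) (w i) = 1"
    and "\<And>i l. i \<le> N \<Longrightarrow> l < w i \<Longrightarrow> fps_nth (\<phi> i) l = 0"
    and "\<And>i. i \<le> N \<Longrightarrow> w i \<notin> values_upto i \<phi>"
proof -
  note P = assms[unfolded P_set_def parametrization_def map_germ_germ, simplified]
  show "germ (Suc N) \<phi>" "\<phi> 0 = fps_X ^ w 0" using P by auto
  show w0: "w 0 > 0" using P by (auto simp: is_min_def)
  show "w i < w j" if "i < j" "j \<le> N" for i j
    using P that by (auto simp: strict_mono_on_def)
  show "fps_nth (\<phi> i) (w i) = 1" if "i \<le> N" for i
    using P that by (cases "i = 0") auto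
  show "fps_nth (\<phi> i) l = 0" if "i \<le> N" "l < w i" for i l
    using P that by (cases "i = 0") auto
  show "w i \<notin> values_upto i \<phi>" if "i \<le> N" for i
    using P that w0 values_upto_zero[of \<phi>] by (cases "i = 0") (auto simp: is_min_def)
qed

lemma pd0_diff:
  assumes "f \<in> conv_ps m" "g \<in> conv_ps m"
  shows "pd0 (\<lambda>x. f x - g x) j = pd0 f j - pd0 g j"
proof -
  obtain r where r: "r > 0" "plot_holo m r f" "plot_holo m r g"
    using conv_ps_common[OF assms] by blast
  have 0: "(\<lambda>_. 0) \<in> polydisc m r" using r(1) by (simp add: polydisc_def)
  have "(\<lambda>z. f ((\<lambda>_. 0)(j := z))) field_differentiable at 0"
    by (rule holomorphic_on_imp_differentiable_at[OF plot_holo_coord_holomorphic[OF r(2) 0]]) (use r in auto)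
  moreover have "(\<lambda>z. g ((\<lambda>_. 0)(j := z))) field_differentiable at 0"
    by (rule holomorphic_on_imp_differentiable_at[OF plot_holo_coord_holomorphic[OF r(3) 0]]) (use r in auto)
  ultimately show ?thesis unfolding pd0_def by (rule deriv_diff)
qed

lemma pd0_coord: "pd0 (\<lambda>x. x i) j = (if i = j then 1 else 0)"
  by (simp add: pd0_def)

lemma Diff_space_compose:
  assumes "\<sigma>' \<in> Diff_space m" "\<sigma> \<in> Diff_space m"
  shows "(\<lambda>i x. \<sigma>' i (\<lambda>j. \<sigma> j x)) \<in> Diff_space m"
proof -
  \<comment> \<open>Stated for arbitrary germs, since it is applied once to the given maps and once
    to their inverses in reverse order.\<close>
  have comp: "near0 m (\<lambda>x. \<forall>i<m. \<sigma>' i (\<lambda>j. \<sigma> j (\<lambda>k. \<tau> k (\<lambda>l. \<tau>' l x))) = x i)"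
    if \<sigma>': "\<And>i. i < m \<Longrightarrow> \<sigma>' i \<in> conv_ps m"
      and \<tau>': "\<And>i. i < m \<Longrightarrow> \<tau>' i \<in> conv_ps m" "\<And>i. i < m \<Longrightarrow> \<tau>' i (\<lambda>_. 0) = 0"
      and inv: "near0 m (\<lambda>x. \<forall>i<m. \<sigma> i (\<lambda>j. \<tau> j x) = x i)"
      and inv': "near0 m (\<lambda>x. \<forall>i<m. \<sigma>' i (\<lambda>j. \<tau>' j x) = x i)"
    for \<sigma> \<sigma>' \<tau> \<tau>' :: "nat \<Rightarrow> (nat \<Rightarrow> complex) \<Rightarrow> complex"
  proof -
    have "near0 m (\<lambda>x. \<forall>i<m. \<forall>y. (\<forall>j<m. x j = y j) \<longrightarrow> \<sigma>' i x = \<sigma>' i y)"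
      by (rule near0_all_less, rule conv_ps_dep[OF \<sigma>'])
    from near0_conj[OF inv this]
    have "near0 m (\<lambda>x. \<forall>i<m. \<sigma>' i (\<lambda>j. \<sigma> j (\<lambda>k. \<tau> k x)) = \<sigma>' i x)"
    proof (rule near0_mono)
      fix x :: "nat \<Rightarrow> complex"
      assume a: "(\<forall>i<m. \<sigma> i (\<lambda>j. \<tau> j x) = x i) \<and> (\<forall>i<m. \<forall>y. (\<forall>j<m. x j = y j) \<longrightarrow> \<sigma>' i x = \<sigma>' i y)"
      show "\<forall>i<m. \<sigma>' i (\<lambda>j. \<sigma> j (\<lambda>k. \<tau> k x)) = \<sigma>' i x"
      proof (intro allI impI)
        fix i assume "i < m"
        then have "\<sigma>' i x = \<sigma>' i (\<lambda>j. \<sigma> j (\<lambda>k. \<tau> k x))" using a by simp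
        then show "\<sigma>' i (\<lambda>j. \<sigma> j (\<lambda>k. \<tau> k x)) = \<sigma>' i x" ..
      qed
    qed simp
    from near0_conj[OF near0_compose[OF this \<tau>'] inv'] show ?thesis
      by (rule near0_mono) auto
  qed
  obtain \<tau>' where \<tau>': "\<And>i. i < m \<Longrightarrow> \<tau>' i \<in> conv_ps m" "\<And>i. i < m \<Longrightarrow> \<tau>' i (\<lambda>_. 0) = 0"
    and \<sigma>': "\<And>i. i < m \<Longrightarrow> \<sigma>' i \<in> conv_ps m" "\<And>i. i < m \<Longrightarrow> \<sigma>' i (\<lambda>_. 0) = 0"
    and inv': "near0 m (\<lambda>x. \<forall>i<m. \<sigma>' i (\<lambda>j. \<tau>' j x) = x i \<and> \<tau>' i (\<lambda>j. \<sigma>' j x) = x i)"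
    using assms(1) unfolding Diff_space_def by auto
  obtain \<tau> where \<tau>: "\<And>i. i < m \<Longrightarrow> \<tau> i \<in> conv_ps m" "\<And>i. i < m \<Longrightarrow> \<tau> i (\<lambda>_. 0) = 0"
    and \<sigma>: "\<And>i. i < m \<Longrightarrow> \<sigma> i \<in> conv_ps m" "\<And>i. i < m \<Longrightarrow> \<sigma> i (\<lambda>_. 0) = 0"
    and inv: "near0 m (\<lambda>x. \<forall>i<m. \<sigma> i (\<lambda>j. \<tau> j x) = x i \<and> \<tau> i (\<lambda>j. \<sigma> j x) = x i)"
    using assms(2) unfolding Diff_space_def by auto
  have 1: "near0 m (\<lambda>x. \<forall>i<m. \<sigma>' i (\<lambda>j. \<sigma> j (\<lambda>k. \<tau> k (\<lambda>l. \<tau>' l x))) = x i)"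
    by (rule comp[OF \<sigma>'(1) \<tau>']) (use near0_mono[OF inv] near0_mono[OF inv'] in auto)
  have 2: "near0 m (\<lambda>x. \<forall>i<m. \<tau> i (\<lambda>j. \<tau>' j (\<lambda>k. \<sigma>' k (\<lambda>l. \<sigma> l x))) = x i)"
    by (rule comp[OF \<tau>(1) \<sigma>]) (use near0_mono[OF inv] near0_mono[OF inv'] in auto)
  have zero: "f (\<lambda>j. g j (\<lambda>_. 0)) = (0 :: complex)"
    if f: "f \<in> conv_ps m" "f (\<lambda>_. 0) = 0" and g: "\<And>i. i < m \<Longrightarrow> g i (\<lambda>_. 0) = 0" for f g
  proof -
    obtain r where r: "r > 0" "plot_holo m r f" using f(1) by (auto simp: conv_ps_iff)
    have "f (\<lambda>_. 0) = f (\<lambda>j. g j (\<lambda>_. 0))"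
      by (rule plot_holo_cong[OF r(2)]) (use r(1) g in \<open>auto simp: polydisc_def\<close>)
    then show ?thesis using f(2) by simp
  qed
  show ?thesis
    unfolding Diff_space_def
  proof (intro CollectI conjI allI impI exI[of _ "\<lambda>i x. \<tau> i (\<lambda>j. \<tau>' j x)"])
    fix i assume i: "i < m"
    show "(\<lambda>x. \<sigma>' i (\<lambda>j. \<sigma> j x)) \<in> conv_ps m" by (rule conv_ps_compose[OF \<sigma>'(1)[OF i] \<sigma>])
    show "\<sigma>' i (\<lambda>j. \<sigma> j (\<lambda>_. 0)) = 0" by (rule zero[of "\<sigma>' i" \<sigma>, OF \<sigma>'(1,2)[OF i] \<sigma>(2)])
    show "(\<lambda>x. \<tau> i (\<lambda>j. \<tau>' j x)) \<in> conv_ps m" by (rule conv_ps_compose[OF \<tau>(1)[OF i] \<tau>'])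
    show "\<tau> i (\<lambda>j. \<tau>' j (\<lambda>_. 0)) = 0" by (rule zero[of "\<tau> i" \<tau>', OF \<tau>(1,2)[OF i] \<tau>'(2)])
  next
    show "near0 m (\<lambda>x. \<forall>i<m. \<sigma>' i (\<lambda>j. \<sigma> j (\<lambda>j. \<tau> j (\<lambda>j. \<tau>' j x))) = x i \<and>
        \<tau> i (\<lambda>j. \<tau>' j (\<lambda>j. \<sigma>' j (\<lambda>j. \<sigma> j x))) = x i)"
      by (rule near0_mono[OF near0_conj[OF 1 2]]) auto
  qed
qed

lemma values_upto_pull_subset:
  assumes \<sigma>: "\<And>i. i < m \<Longrightarrow> \<sigma> i \<in> conv_ps m" "\<And>i. i < m \<Longrightarrow> \<sigma> i (\<lambda>_. 0) = 0"
    and \<phi>: "germ m \<phi>" and \<psi>: "\<And>i. i < m \<Longrightarrow> \<psi> i = pull (\<sigma> i) \<phi>"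
  shows "values_upto m \<psi> \<subseteq> values_upto m \<phi>"
proof -
  have eq: "pull h \<psi> = pull (\<lambda>x. h (\<lambda>i. \<sigma> i x)) \<phi>" if "h \<in> conv_ps m" for h
    using pull_dep[OF that germ_pull[OF \<sigma> \<phi>] \<psi>] pull_compose[OF that \<sigma> \<phi>] by simp
  show ?thesis
  proof
    fix s assume "s \<in> values_upto m \<psi>"
    then obtain h where h: "h \<in> conv_ps m" "pull h \<psi> \<noteq> 0" "s = subdegree (pull h \<psi>)"
      unfolding values_upto_def by blast
    then show "s \<in> values_upto m \<phi>"
      unfolding values_upto_def
      by (intro CollectI exI[of _ "\<lambda>x. h (\<lambda>i. \<sigma> i x)"]) (simp add: eq conv_ps_compose[OF h(1) \<sigma>])
  qed
qed

text \<open>The \<open>w 0\<close> consecutive values from \<open>c\<close> on make every difference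
  \<open>\<phi> i - \<psi> i\<close> the pull-back of some \<open>g i\<close>, and subtracting these
  from the coordinates carries \<open>\<phi>\<close> to \<open>\<psi>\<close> with no
  reparametrization. Agreement up to order \<open>w i\<close> forces the linear part of
  \<open>g i\<close> to vanish in the coordinates up to the \<open>i\<close>-th, which makes the
  change unipotent.\<close>

lemma A_equiv_P_set_of_jets:
  assumes P: "\<phi> \<in> P_set N w"
    and c: "\<And>s. c \<le> s \<Longrightarrow> s < c + w 0 \<Longrightarrow> s \<in> value_semigroup N \<phi>"
    and \<psi>0: "\<psi> 0 = fps_X ^ w 0"
    and rad: "\<And>i. i \<le> N \<Longrightarrow> fps_conv_radius (\<psi> i) > 0"
    and jet: "\<And>i l. i \<le> N \<Longrightarrow> l < c \<or> l \<le> w i \<Longrightarrow> fps_nth (\<psi> i) l = fps_nth (\<phi> i) l"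
  shows "A_equiv N \<phi> \<psi> \<and> \<psi> \<in> P_set N w"
proof -
  note \<phi> = P_setD[OF P]
  let ?m = "Suc N"
  have \<psi>: "germ ?m \<psi>"
    using rad jet \<phi>(1) by (auto simp: germ_def less_Suc_eq_le)
  have \<psi>low: "fps_nth (\<psi> i) l = 0" if "i \<le> N" "l < w i" for i l
    using jet[of i l] \<phi>(6)[OF that] that by simp
  have \<psi>lead: "fps_nth (\<psi> i) (w i) = 1" if "i \<le> N" for i
    using jet[of i "w i"] \<phi>(5)[OF that] that by simp
  have wle: "w i \<le> w j" if "i \<le> j" "j \<le> N" for i j
    using \<phi>(4)[of i j] that by (cases "i = j") auto
  have "\<exists>g\<in>conv_ps ?m. pull g \<phi> = \<phi> i - \<psi> i" if "i \<le> N" for i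
  proof (rule conductor_pull[OF \<phi>(1) _ \<phi>(2,3), where c = c])
    have "0 < min (fps_conv_radius (\<phi> i)) (fps_conv_radius (\<psi> i))"
      using \<phi>(1) rad that by (auto simp: germ_def)
    then show "fps_conv_radius (\<phi> i - \<psi> i) > 0" by (rule less_le_trans[OF _ fps_conv_radius_diff])
    show "s \<in> values_upto ?m \<phi>" if "c \<le> s" "s < c + w 0" for s
      using c[OF that] by (simp add: value_semigroup_def)
  qed (use jet that in auto)
  then obtain g where g: "\<And>i. i \<le> N \<Longrightarrow> g i \<in> conv_ps ?m" "\<And>i. i \<le> N \<Longrightarrow> pull (g i) \<phi> = \<phi> i - \<psi> i"
    by metis
  have g_low: "fps_nth (pull (g i) \<phi>) l = 0" if "i \<le> N" "l \<le> w i" for i l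
    using g(2)[OF that(1)] jet that by simp
  have g0: "g i (\<lambda>_. 0) = 0" if "i \<le> N" for i
    using pull_nth_0[OF g(1) \<phi>(1)] g_low[of i 0] that by simp
  have pdg: "pd0 (g i) k = 0" if "i \<le> N" "k \<le> i" for i k
  proof (rule pd0_eq_0_of_order[OF g(1) \<phi>(1), where W = "w k"])
    show "fps_nth (\<phi> i) l = 0" if "k \<le> i" "i < Suc N" "l < w k" for i l
      using \<phi>(6)[of i l] wle[of k i] that by simp
    show "fps_nth (\<phi> i) (w k) = 0" if "k < i" "i < Suc N" for i
      using \<phi>(6)[of i "w k"] \<phi>(4)[of k i] that by simp
    show "fps_nth (pull (g i) \<phi>) l = 0" if "l \<le> w k" for l
      using g_low[of i l] wle[of k i] that \<open>i \<le> N\<close> \<open>k \<le> i\<close> by simp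
  qed (use that \<phi>(5,7) in auto)
  define \<sigma> where "\<sigma> i x = x i - g i x" for i and x :: "nat \<Rightarrow> complex"
  have \<sigma>c: "\<sigma> i \<in> conv_ps ?m" if "i < ?m" for i
    unfolding \<sigma>_def[abs_def] using g(1)[of i] that by (intro conv_ps_diff conv_ps_coord) auto
  have \<sigma>0: "\<sigma> i (\<lambda>_. 0) = 0" if "i < ?m" for i
    using g0[of i] that by (simp add: \<sigma>_def)
  have jac: "jac0 \<sigma> i k = (if i = k then 1 else 0)" if "i < ?m" "k \<le> i" for i k
    using pd0_diff[OF conv_ps_coord g(1), of i i k] pdg[of i k] that
    by (simp add: jac0_pd0 \<sigma>_def[abs_def] pd0_coord)
  have \<sigma>D: "\<sigma> \<in> Diff_space ?m"
    by (rule Diff_space_unipotent[OF \<sigma>c \<sigma>0]) (use jac in auto)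
  have pull\<sigma>: "\<psi> i = pull (\<sigma> i) \<phi>" if "i < ?m" for i
    using pull_diff[OF conv_ps_coord g(1) \<phi>(1), of i i] g(2)[of i] pull_coord[OF \<phi>(1)] that
    by (simp add: \<sigma>_def[abs_def])
  obtain \<tau> where \<tau>: "\<And>i. i < ?m \<Longrightarrow> \<tau> i \<in> conv_ps ?m" "\<And>i. i < ?m \<Longrightarrow> \<tau> i (\<lambda>_. 0) = 0"
    and inv: "near0 ?m (\<lambda>x. \<forall>i<?m. \<sigma> i (\<lambda>j. \<tau> j x) = x i \<and> \<tau> i (\<lambda>j. \<sigma> j x) = x i)"
    using \<sigma>D unfolding Diff_space_def by auto
  have pull\<psi>: "pull f \<psi> = pull (\<lambda>x. f (\<lambda>i. \<sigma> i x)) \<phi>" if "f \<in> conv_ps ?m" for f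
    using pull_dep[OF that germ_pull[OF \<sigma>c \<sigma>0 \<phi>(1)] pull\<sigma>] pull_compose[OF that \<sigma>c \<sigma>0 \<phi>(1)] by simp
  have pull\<tau>: "\<phi> i = pull (\<tau> i) \<psi>" if i: "i < ?m" for i
  proof -
    have "pull (\<lambda>x. x i) \<phi> = pull (\<lambda>x. \<tau> i (\<lambda>j. \<sigma> j x)) \<phi>"
      by (rule pull_cong[OF conv_ps_coord[OF i] _ \<phi>(1)], rule near0_mono[OF inv]) (use i in auto)
    then show ?thesis using pull_coord[OF \<phi>(1) i] pull\<psi>[OF \<tau>(1)[OF i]] by simp
  qed
  have XD: "fps_X \<in> Diff_line" by (rule Diff_lineI) auto
  have invX: "fps_inv fps_X = (fps_X :: complex fps)"
    using fps_inv[of "fps_X :: complex fps"] by simp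
  have equiv: "A_equiv N \<phi> \<psi>"
    unfolding A_equiv_def using pull\<sigma>
    by (intro bexI[OF _ XD] bexI[OF _ \<sigma>D]) (simp add: act_def invX less_Suc_eq_le)
  have sg: "value_semigroup N \<psi> = value_semigroup N \<phi>"
    unfolding value_semigroup_def
    using values_upto_pull_subset[of ?m \<sigma> \<phi> \<psi>, OF \<sigma>c \<sigma>0 \<phi>(1) pull\<sigma>]
      values_upto_pull_subset[of ?m \<tau> \<psi> \<phi>, OF \<tau> \<psi> pull\<tau>] by (rule antisym)
  have "primitive N \<psi>"
    unfolding primitive_def
  proof
    assume "\<exists>\<theta> \<eta>. map_germ N \<theta> \<and> fps_conv_radius \<eta> > 0 \<and> fps_ord \<eta> \<ge> 2 \<and> (\<forall>i\<le>N. \<psi> i = \<theta> i oo \<eta>)"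
    then obtain \<theta> \<eta> where \<theta>: "germ ?m \<theta>" and \<eta>: "fps_conv_radius \<eta> > 0" "fps_ord \<eta> \<ge> 2"
      and eq: "\<And>i. i \<le> N \<Longrightarrow> \<psi> i = \<theta> i oo \<eta>" unfolding map_germ_germ by blast
    have "enat 0 < 2" by (simp add: zero_enat_def[symmetric])
    then have "fps_ord \<eta> > enat 0" using \<eta>(2) by (rule less_le_trans)
    then have \<eta>0: "fps_nth \<eta> 0 = 0" by (simp add: fps_ord_gt)
    \<comment> \<open>A factorisation of \<open>\<psi>\<close> through \<open>\<eta>\<close> passes
      to \<open>\<phi>\<close>, the image of \<open>\<psi>\<close> under the inverse change.\<close>
    have "\<phi> i = pull (\<tau> i) \<theta> oo \<eta>" if "i \<le> N" for i
    proof -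
      have i: "i < ?m" using that by simp
      have "pull (\<tau> i) (\<lambda>i. \<theta> i oo \<eta>) = pull (\<tau> i) \<psi>"
        by (rule pull_dep[OF \<tau>(1)[OF i] \<psi>]) (use eq in simp)
      then show ?thesis
        using pull\<tau>[OF i] pull_oo[OF \<tau>(1)[OF i] \<theta> \<eta>(1) \<eta>0] by simp
    qed
    moreover have "map_germ N (\<lambda>i. pull (\<tau> i) \<theta>)"
      unfolding map_germ_germ by (rule germ_pull[OF \<tau> \<theta>])
    ultimately have "\<not> primitive N \<phi>" unfolding primitive_def using \<eta> by blast
    then show False using P by (simp add: P_set_def parametrization_def)
  qed
  moreover have "nondegenerate N \<psi>"
    unfolding nondegenerate_def
  proof
    assume "\<exists>\<phi>'. map_germ N \<phi>' \<and> A_equiv N \<psi> \<phi>' \<and> (\<exists>i\<le>N. \<phi>' i = 0)"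
    then obtain \<phi>' \<rho>' \<sigma>' where *: "map_germ N \<phi>'" "\<exists>i\<le>N. \<phi>' i = 0" and \<rho>': "\<rho>' \<in> Diff_line"
      and \<sigma>': "\<sigma>' \<in> Diff_space ?m" and eq: "\<And>i. i \<le> N \<Longrightarrow> \<phi>' i = act \<rho>' \<sigma>' \<psi> i"
      unfolding A_equiv_def by blast
    have "\<phi>' i = act \<rho>' (\<lambda>i x. \<sigma>' i (\<lambda>j. \<sigma> j x)) \<phi> i" if "i \<le> N" for i
      using eq[OF that] pull\<psi>[of "\<sigma>' i"] \<sigma>' that by (auto simp: act_def Diff_space_def less_Suc_eq_le)
    then have "A_equiv N \<phi> \<phi>'"
      unfolding A_equiv_def using \<rho>' Diff_space_compose[OF \<sigma>' \<sigma>D] by blast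
    then have "\<not> nondegenerate N \<phi>" unfolding nondegenerate_def using * by blast
    then show False using P by (simp add: P_set_def parametrization_def)
  qed
  ultimately have par: "parametrization N \<psi>"
    unfolding parametrization_def map_germ_germ using \<psi> by blast
  \<comment> \<open>The delicate clause, because \<open>\<sigma>\<close> brings later components
    into the first \<open>i\<close>. Induction is needed since the linear part of \<open>h\<close>
    vanishes in coordinate \<open>k\<close> only if \<open>w k\<close> is already known to be new
    for \<open>\<psi>\<close>.\<close>
  have new: "w i \<notin> values_upto i \<psi>" if "i \<le> N" for i
    using that
  proof (induction i rule: less_induct)
    case (less i)
    show ?case
    proof
      assume "w i \<in> values_upto i \<psi>"
      then obtain h where h: "h \<in> conv_ps i" "fps_nth (pull h \<psi>) (w i) \<noteq> 0" "\<And>l. l < w i \<Longrightarrow> fps_nth (pull h \<psi>) l = 0"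
        using values_uptoE by blast
      have \<psi>i: "germ i \<psi>" and \<phi>i: "germ i \<phi>" using \<psi> \<phi>(1) less.prems by (auto intro: germ_mono)
      have pdh: "pd0 h k = 0" if "k < i" for k
      proof (rule pd0_eq_0_of_order[OF h(1) \<psi>i that, where W = "w k"])
        show "w k \<notin> values_upto k \<psi>" using less that by simp
        show "fps_nth (\<psi> j) l = 0" if "k \<le> j" "j < i" "l < w k" for j l
          using \<psi>low[of j l] wle[of k j] that less.prems by simp
        show "fps_nth (\<psi> j) (w k) = 0" if "k < j" "j < i" for j
          using \<psi>low[of j "w k"] \<phi>(4)[of k j] that less.prems by simp
        show "fps_nth (pull h \<psi>) l = 0" if "l \<le> w k" for l
          using h(3)[of l] \<phi>(4)[of k i] that \<open>k < i\<close> less.prems by simp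
      qed (use \<psi>lead that less.prems in auto)
      \<comment> \<open>The change with all coordinates from \<open>i\<close> on set to 0: it sees
        only the first \<open>i\<close> components of \<open>\<phi>\<close> and departs from
        \<open>\<psi>\<close> only from order \<open>w i\<close> on.\<close>
      define \<sigma>r where "\<sigma>r j x = \<sigma> j (\<lambda>k. if k < i then x k else 0)" for j and x :: "nat \<Rightarrow> complex"
      have \<sigma>r: "\<sigma>r j \<in> conv_ps i" "\<sigma>r j (\<lambda>_. 0) = 0" if "j < i" for j
        unfolding \<sigma>r_def[abs_def] using conv_ps_restrict[OF \<sigma>c, of j i] \<sigma>0[of j] that less.prems by auto
      define \<psi>r where "\<psi>r j = pull (\<sigma>r j) \<phi>" for j
      have \<psi>rg: "germ i \<psi>r" unfolding \<psi>r_def by (rule germ_pull[OF \<sigma>r \<phi>i])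
      have agree: "fps_nth (\<psi> j) l = fps_nth (\<psi>r j) l" if "j < i" "l < w i" for j l
      proof -
        have j: "j < ?m" using that less.prems by simp
        have "fps_nth (pull (\<sigma> j) \<phi>) l = fps_nth (pull (\<sigma> j) (\<lambda>k. if k < i then \<phi> k else 0)) l"
        proof (rule pull_agree[OF \<sigma>c[OF j] \<phi>(1) germ_restrict[OF \<phi>(1)] _ that(2)])
          fix k l assume "k < ?m" "l < w i"
          then show "fps_nth (\<phi> k) l = fps_nth (if k < i then \<phi> k else 0) l"
            using \<phi>(6)[of k l] wle[of i k] by auto
        qed
        then show ?thesis using pull\<sigma>[OF j] by (simp add: \<psi>r_def \<sigma>r_def[abs_def] pull_restrict)
      qed
      \<comment> \<open>As \<open>h\<close> has no linear part, the comparison includes the order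
        \<open>w i\<close> itself, where the contradiction arises.\<close>
      have "fps_nth (pull h \<psi>) l - fps_nth (pull h \<psi>r) l = 0" if "l \<le> w i" for l
        using pull_linear_approx[OF h(1) \<psi>i \<psi>rg agree that] pdh by simp
      then have eq: "fps_nth (pull h \<psi>r) l = fps_nth (pull h \<psi>) l" if "l \<le> w i" for l
        using that by simp
      have "pull (\<lambda>x. h (\<lambda>j. \<sigma>r j x)) \<phi> = pull h \<psi>r"
        unfolding \<psi>r_def by (rule pull_compose[OF h(1) \<sigma>r \<phi>i])
      then have "w i \<in> values_upto i \<phi>"
        using values_uptoI[OF conv_ps_compose[of h i \<sigma>r i, OF h(1) \<sigma>r], where \<phi> = \<phi> and s = "w i"] eq h by simp
      then show False using \<phi>(7) less.prems by blast
    qed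
  qed
  have min: "is_min (w i) (value_semigroup N \<psi> - values_upto i \<psi>)" if i: "i \<le> N" for i
    unfolding is_min_def
  proof (intro conjI ballI DiffI new[OF i])
    show "w i \<in> value_semigroup N \<psi>"
      unfolding value_semigroup_def
      by (rule values_upto_component[OF \<psi>, of i]) (use i \<psi>lead \<psi>low in auto)
    fix s assume s: "s \<in> value_semigroup N \<psi> - values_upto i \<psi>"
    show "w i \<le> s"
    proof (rule ccontr)
      assume "\<not> w i \<le> s"
      then have "s < w i" by simp
      have "s \<in> values_upto ?m \<psi>" using s by (simp add: value_semigroup_def)
      then have "s \<in> values_upto i \<psi>"
      proof (rule values_upto_restrict[OF _ \<open>s < w i\<close> \<psi>])
        show "fps_nth (\<psi> k) l = 0" if "i \<le> k" "k < ?m" "l < w i" for k l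
          using \<psi>low[of k l] wle[of i k] that by simp
      qed
      then show False using s by simp
    qed
  qed
  have "\<psi> \<in> P_set N w"
    unfolding P_set_def using P par \<psi>0 sg \<psi>lead \<psi>low min by (simp add: P_set_def)
  with equiv show ?thesis by blast
qed

theorem theorem5p11:
  fixes n g V :: nat and w v a :: "nat \<Rightarrow> nat" and c :: "nat \<Rightarrow> complex"
    and \<phi>0 \<phi>1 :: "nat \<Rightarrow> complex fps"
  assumes "n \<ge> 1"
    and "\<phi>0 \<in> P_set n w"
    and "v 0 = w 0"
    and "minimal_generators (value_semigroup n \<phi>0) g v"
    and "is_apery (value_semigroup n \<phi>0) a"
    and "V \<notin> value_semigroup n \<phi>0"
    and "[V = a (v 0 - 1)] (mod v 0)"
    and "max (v g) (a (v 0 - 2)) < V" and "V < a (v 0 - 1)"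
    and "\<phi>1 = \<phi>0(Suc n := fps_X ^ V + Abs_fps (\<lambda>j. if j > V then c j else 0))"
    and "\<phi>1 \<in> P_set (Suc n) (w(Suc n := V))"
  defines "\<phi>2 \<equiv> (\<lambda>i. if i = 0 then fps_X ^ v 0
                    else if i \<le> n then jet (max (w i) (V - v 0)) (\<phi>0 i)
                    else fps_X ^ V)"
  shows "(\<forall>i. 1 \<le> i \<and> i \<le> n \<longrightarrow>
            (\<forall>l. w i < l \<and> l < V \<longrightarrow>
               (eliminable n w \<phi>0 i l \<longleftrightarrow> eliminable (Suc n) (w(Suc n := V)) \<phi>1 i l)))
         \<and> A_equiv (Suc n) \<phi>1 \<phi>2 \<and> \<phi>2 \<in> P_set (Suc n) (w(Suc n := V))"
proof (intro conjI allI impI)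
  let ?w = "w(Suc n := V)"
  let ?Y = "fps_X ^ V + Abs_fps (\<lambda>j. if j > V then c j else 0)"
  note P0 = P_setD[OF assms(2)] and P1 = P_setD[OF assms(11)]
  have \<phi>10: "\<phi>1 k = \<phi>0 k" if "k \<le> n" for k using that assms(10) by simp
  have \<phi>1n: "\<phi>1 (Suc n) = ?Y" using assms(10) by simp
  have wV: "w k < V" if "k \<le> n" for k using P1(4)[of k "Suc n"] that by simp
  have w_mono: "w j < w k" if "j < k" "k \<le> n" for j k using P0(4)[OF that] .
  {
    fix i l assume i: "1 \<le> i \<and> i \<le> n" and l: "w i < l \<and> l < V"
    show "eliminable n w \<phi>0 i l \<longleftrightarrow> eliminable (Suc n) ?w \<phi>1 i l"
    proof
      assume "eliminable n w \<phi>0 i l"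
      then show "eliminable (Suc n) ?w \<phi>1 i l"
        unfolding assms(10) using i by (intro eliminable_extend[OF P0(1)]) auto
    next
      assume "eliminable (Suc n) ?w \<phi>1 i l"
      then show "eliminable n w \<phi>0 i l"
      proof (rule eliminable_restrict[OF P1(1), rotated 6])
        show "fps_nth (\<phi>1 k) j = 0" if "k \<le> n" "j < w k" for k j using P1(6)[of k j] that by simp
      qed (use P1(2,3,6) wV w_mono i l \<phi>10 in auto)
    qed
  }
  let ?S = "value_semigroup n \<phi>0" and ?S1 = "value_semigroup (Suc n) \<phi>1"
  have min0: "is_min (w 0) (?S - {0})" using assms(2) by (simp add: P_set_def)
  have w0S: "w 0 \<in> ?S" using min0 by (simp add: is_min_def)
  have "0 \<in> ?S"
    unfolding value_semigroup_def by (rule values_uptoI[of "\<lambda>_. 1"]) auto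
  \<comment> \<open>For multiplicity 1 the bound \<open>V < a (v 0 - 1)\<close> would read
    \<open>V < 0\<close>. Consequently \<open>v 0 - 2\<close> does not truncate.\<close>
  have w0: "w 0 \<ge> 2"
  proof (rule ccontr)
    assume "\<not> w 0 \<ge> 2"
    then have "w 0 = 1" using P0(3) by simp
    then have "V < a 0" using assms(3,9) by simp
    then show False using assms(5) by (auto simp: is_apery_def)
  qed
  have "?S \<subseteq> ?S1"
  proof
    fix s assume "s \<in> ?S"
    then have s: "s \<in> values_upto (Suc n) \<phi>0" by (simp add: value_semigroup_def)
    obtain h where h: "h \<in> conv_ps (Suc n)" "fps_nth (pull h \<phi>0) s \<noteq> 0" "\<And>l. l < s \<Longrightarrow> fps_nth (pull h \<phi>0) l = 0"
      using values_uptoE[OF s] by blast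
    have "pull h \<phi>1 = pull h \<phi>0" by (rule pull_dep[OF h(1) P0(1)]) (use \<phi>10 in auto)
    then have "s \<in> values_upto (Suc n) \<phi>1" using values_uptoI[OF h(1), of \<phi>1 s] h by simp
    then show "s \<in> ?S1" using values_upto_mono[of "Suc n" "Suc (Suc n)"] by (auto simp: value_semigroup_def)
  qed
  have V1: "V \<in> ?S1"
    unfolding value_semigroup_def
    by (rule values_upto_component[OF P1(1), of "Suc n"]) (use P1(5,6)[of "Suc n"] in auto)
  have addv: "s + w 0 \<in> ?S" if "s \<in> ?S" for s
    using values_upto_add[OF _ _ P0(1)] that w0S by (simp add: value_semigroup_def)
  \<comment> \<open>A window of \<open>w 0\<close> consecutive integers ending at \<open>V\<close>.
    Only \<open>V\<close> lies in its own residue class, and it is the order of the last component;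
    the others are already values of \<open>\<phi>0\<close>.\<close>
  have tail: "s \<in> ?S1" if "Suc (V - w 0) \<le> s" "s < Suc (V - w 0) + w 0" for s
  proof (cases "s = V")
    case False
    have ne: "s mod w 0 \<noteq> V mod w 0"
    proof
      assume eq: "s mod w 0 = V mod w 0"
      have "V \<le> s \<or> s \<le> V" by linarith
      then have "w 0 dvd (if s \<le> V then V - s else s - V)"
        using mod_eq_dvd_iff_nat[of s V "w 0"] mod_eq_dvd_iff_nat[of V s "w 0"] eq by auto
      then have "w 0 \<le> (if s \<le> V then V - s else s - V)"
        by (rule dvd_imp_le) (use False in auto)
      then show False using that wV[of 0] by (auto split: if_splits)
    qed
    have "s \<in> ?S"
    proof (rule apery_tail[OF assms(5) min0 addv \<open>0 \<in> ?S\<close> w0 _ _ _ ne])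
      show "V < s + w 0" using that wV[of 0] by simp
    qed (use assms(3,7,8) in auto)
    then show ?thesis using \<open>?S \<subseteq> ?S1\<close> by blast
  qed (use V1 in simp)
  have "A_equiv (Suc n) \<phi>1 \<phi>2 \<and> \<phi>2 \<in> P_set (Suc n) ?w"
  \<comment> \<open>Orders below this \<open>c\<close> are those up to \<open>V - v 0\<close>,
    exactly the ones that the jets retain.\<close>
  proof (rule A_equiv_P_set_of_jets[OF assms(11), where c = "Suc (V - w 0)"])
    show "s \<in> ?S1" if "Suc (V - w 0) \<le> s" "s < Suc (V - w 0) + ?w 0" for s
      using tail that by simp
    show "\<phi>2 0 = fps_X ^ ?w 0" by (simp add: \<phi>2_def assms(3))
    show "fps_conv_radius (\<phi>2 i) > 0" for i
    proof -
      have "fps_conv_radius (jet k F) > 0" for k F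
      proof (rule conv_radius_geometric)
        show "norm (fps_nth (jet k F) n) \<le> (\<Sum>j\<le>k. norm (fps_nth F j)) * 1 ^ n" for n
          by (auto simp: jet_nth intro: member_le_sum sum_nonneg)
      qed simp
      then show ?thesis by (simp add: \<phi>2_def)
    qed
    show "fps_nth (\<phi>2 i) l = fps_nth (\<phi>1 i) l" if "i \<le> Suc n" "l < Suc (V - w 0) \<or> l \<le> ?w i" for i l
    proof -
      consider "i = 0" | "0 < i" "i \<le> n" | "i = Suc n" using \<open>i \<le> Suc n\<close> by linarith
      then show ?thesis
      proof cases
        case 1
        then show ?thesis using P1(2) by (simp add: \<phi>2_def assms(3))
      next
        case 2
        then show ?thesis using that \<phi>10[of i] by (auto simp: \<phi>2_def jet_nth assms(3))
      next
        case 3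
        \<comment> \<open>Both alternatives stay within order \<open>V\<close>, up to which the last
          component is \<open>t^V\<close>.\<close>
        then have "l \<le> V" using that wV[of 0] by auto
        with 3 show ?thesis by (simp add: \<phi>2_def \<phi>1n)
      qed
    qed
  qed
  then show "A_equiv (Suc n) \<phi>1 \<phi>2" "\<phi>2 \<in> P_set (Suc n) ?w" by auto
qed

end
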